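(* Let $\Omega\subset\mathbb{R}^d$ be open and bounded and let $k:\mathbb{R}^d\times\mathbb{R}^d\to[0,\infty]$ be measurable. Assume: (i) $x\mapsto\int_{\mathbb{R}^d}(1\wedge|x-y|^2)\,k_s(x,y)\,dy$ belongs to $L^1_{loc}(\mathbb{R}^d)$; (ii) there is a constant $A$ with $\displaystyle\sup_{x\in\mathbb{R}^d}\int_{\{y:\,k_s(x,y)\ne0\}}\frac{k_a^2(x,y)}{k_s(x,y)}\,dy\le A$; (iii) there is $D>1$ such that $|k_a(x,y)|\le D^{-1}k_s(x,y)$ for almost every $x,y\in\mathbb{R}^d$; (iv) for some $\alpha\in(0,2)$, some $\lambda>0$ and all $u\in L^2(\mathbb{R}^d)$: $$\int_{\mathbb{R}^d}\int_{\mathbb{R}^d}(u(x)-u(y))^2k_s(x,y)\,dy\,dx\ \ge\ \lambda\,\alpha(2-\alpha)\int_{\mathbb{R}^d}\int_{\mathbb{R}^d}\frac{(u(x)-u(y))^2}{|x-y|^{d+\alpha}}\,dy\,dx.$$ Let $f\in H^*_\Omega(\mathbb{R}^d;k)$ and $g\in V(\Omega;k)$. Then there is a unique $u\in V(\Omega;k)$ such that $u-g\in H_\Omega(\mathbb{R}^d;k)$ and $$\mathcal{E}^k(u,\varphi)=\langle f,\varphi\rangle\quad\text{for all }\varphi\in H_\Omega(\mathbb{R}^d;k).$$ Moreover, there is a constant $C=C(C_P,A,D)>0$ such that $$[u,u]_{V(\Omega;k)}\le C\left(\|f\|^2_{H^*_\Omega(\mathbb{R}^d;k)}+\|g\|^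2_{L^2(\Omega)}+[g,g]_{V(\Omega;k)}+\|u\|^2_{L^2(\Omega)}\right).$$
   Context: Notation: $k_s(x,y)=\frac12(k(x,y)+k(y,x))$ and $k_a(x,y)=\frac12(k(x,y)-k(y,x))$ (with $k_a:=0$ where this expression is undefined). Functions are identified if equal a.e. $L^2_\Omega(\mathbb{R}^d)=\{u\in L^2(\mathbb{R}^d):u=0\text{ a.e. on }\mathbb{R}^d\setminus\Omega\}$. $V(\Omega;k)=\{v:\mathbb{R}^d\to\mathbb{R}\ :\ v|_\Omega\in L^2(\Omega),\ (v(x)-v(y))k_s^{1/2}(x,y)\in L^2(\Omega\times\mathbb{R}^d)\}$, with $[u,v]_{V(\Omega;k)}=\int_\Omega\int_{\mathbb{R}^d}(u(x)-u(y))(v(x)-v(y))k_s(x,y)\,dy\,dx$. $H(\mathbb{R}^d;k)=V(\mathbb{R}^d;k)$ with norm $\|v\|^2_{H(\mathbb{R}^d;k)}=\|v\|^2_{L^2(\mathbb{R}^d)}+\int_{\mathbb{R}^d}\int_{\mathbb{R}^d}(v(x)-v(y))^2k_s(x,y)\,dy\,dx$. $H_\Omega(\mathbb{R}^d;k)=\{u\in H(\mathbb{R}^d;k):u=0\text{ a.e. on }\mathbb{R}^d\setminus\Omega\}$ with the norm of $H(\mathbb{R}^d;k)$; $H^*_\Omega(\mathbb{R}^d;k)$ is its dual space and $\langle\cdot,\cdot\rangle$ the duality pairing. $C_P>0$ denotes a constant in the Poincaré–Friedrichs inequality $\|u\|^2_{L^2(\Omega)}\le C_P\int_{\mathbb{R}^d}\int_{\mathbb{R}^d}(u(x)-u(y))^2k_s(x,y)\,dx\,dy$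 for all $u\in L^2_\Omega(\mathbb{R}^d)$ (such a constant exists under assumption (iv)). The bilinear form is $\mathcal{E}^k(u,v)=\iint_{\mathbb{R}^d\times\mathbb{R}^d}(u(x)-u(y))v(x)k(x,y)\,dy\,dx$, understood as $$\mathcal{E}^k(u,v)=\tfrac12\iint_{\mathbb{R}^d\times\mathbb{R}^d}(u(x)-u(y))(v(x)-v(y))k_s(x,y)\,dy\,dx+\iint_{\mathbb{R}^d\times\mathbb{R}^d}(u(x)-u(y))v(x)k_a(x,y)\,dy\,dx .$$ *)

theory Defs
  imports "HOL-Analysis.Analysis"
begin

text \<open>
  The dimension \<open>d\<close> is \<open>CARD('d)\<close>. Measurable means Lebesgue measurable, on \<open>real ^ 'd\<close> as well as on
  the product \<open>(real ^ 'd) \<times> (real ^ 'd)\<close>, which carries its own \<open>lebesgue\<close> measure.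
  Elements of the function spaces are represented by measurable functions; equality in these
  spaces is equality almost everywhere.
\<close>

type_synonym 'a kernel = "'a \<Rightarrow> 'a \<Rightarrow> ennreal"

definition k_sym :: "'a kernel \<Rightarrow> 'a \<Rightarrow> 'a \<Rightarrow> ennreal" where
  "k_sym k x y = (k x y + k y x) / 2"

text \<open>The difference is set to 0 where it would be \<open>\<infinity> - \<infinity>\<close> (which is \<open>\<infinity>\<close> in type \<open>ereal\<close>).\<close>

definition k_anti :: "'a kernel \<Rightarrow> 'a \<Rightarrow> 'a \<Rightarrow> ereal" where
  "k_anti k x y =
     (if k x y = \<infinity> \<and> k y x = \<infinity> then 0 else (enn2ereal (k x y) - enn2ereal (k y x)) / 2)"

definition L2_on :: "(real ^ 'd) set \<Rightarrow> (real ^ 'd \<Rightarrow> real) set" where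
  "L2_on S = {u. u \<in> borel_measurable (lebesgue_on S) \<and>
                 (\<integral>\<^sup>+x. ennreal ((u x)\<^sup>2) \<partial>lebesgue_on S) < \<infinity>}"

definition L2_normsq :: "(real ^ 'd) set \<Rightarrow> (real ^ 'd \<Rightarrow> real) \<Rightarrow> real" where
  "L2_normsq S u = (\<integral>x. (u x)\<^sup>2 \<partial>lebesgue_on S)"

definition L2_zero :: "(real ^ 'd) set \<Rightarrow> (real ^ 'd \<Rightarrow> real) set" where
  "L2_zero \<Omega> = {u \<in> L2_on UNIV. AE x in lebesgue. x \<notin> \<Omega> \<longrightarrow> u x = 0}"

text \<open>
  The last condition says that \<open>(v(x) - v(y)) k_s(x,y)^(1/2)\<close> is in \<open>L^2(\<Omega> \<times> R^d)\<close>; its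
  measurability is inherited from \<open>v\<close> and \<open>k\<close>.
\<close>

definition V_space :: "(real ^ 'd) set \<Rightarrow> (real ^ 'd) kernel \<Rightarrow> (real ^ 'd \<Rightarrow> real) set" where
  "V_space \<Omega> k = {v. v \<in> borel_measurable lebesgue \<and> v \<in> L2_on \<Omega> \<and>
     (\<integral>\<^sup>+(x, y). ennreal ((v x - v y)\<^sup>2) * k_sym k x y \<partial>lebesgue_on (\<Omega> \<times> UNIV)) < \<infinity>}"

text \<open>
  In the signed integrals below the kernels are converted to real numbers, and infinite values
  become 0. This affects only the set where \<open>k_s = \<infinity>\<close>, which is a null set if
  \<open>(1 \<and> |x - y|^2) k_s(x,y)\<close> is locally integrable in \<open>x\<close> after integration in \<open>y\<close>.
\<close>

definition V_form ::
  "(real ^ 'd) set \<Rightarrow> (real ^ 'd) kernel \<Rightarrow> (real ^ 'd \<Rightarrow> real) \<Rightarrow> (real ^ 'd \<Rightarrow> real) \<Rightarrow> real" where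
  "V_form \<Omega> k u v =
     (\<integral>x. (\<integral>y. (u x - u y) * (v x - v y) * enn2real (k_sym k x y) \<partial>lebesgue) \<partial>lebesgue_on \<Omega>)"

definition H_space :: "(real ^ 'd) kernel \<Rightarrow> (real ^ 'd \<Rightarrow> real) set" where
  "H_space k = V_space UNIV k"

definition H_norm :: "(real ^ 'd) kernel \<Rightarrow> (real ^ 'd \<Rightarrow> real) \<Rightarrow> real" where
  "H_norm k v = sqrt (L2_normsq UNIV v + V_form UNIV k v v)"

definition H_zero :: "(real ^ 'd) set \<Rightarrow> (real ^ 'd) kernel \<Rightarrow> (real ^ 'd \<Rightarrow> real) set" where
  "H_zero \<Omega> k = {u \<in> H_space k. AE x in lebesgue. x \<notin> \<Omega> \<longrightarrow> u x = 0}"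

text \<open>
  A functional acts on representatives. The bound forces it to take the same value on functions
  that agree almost everywhere, since their difference has norm 0. Values outside
  \<open>H_zero \<Omega> k\<close> are irrelevant.
\<close>

definition H_dual :: "(real ^ 'd) set \<Rightarrow> (real ^ 'd) kernel \<Rightarrow> ((real ^ 'd \<Rightarrow> real) \<Rightarrow> real) set" where
  "H_dual \<Omega> k = {f.
     (\<forall>\<phi>\<in>H_zero \<Omega> k. \<forall>\<psi>\<in>H_zero \<Omega> k. f (\<lambda>x. \<phi> x + \<psi> x) = f \<phi> + f \<psi>) \<and>
     (\<forall>c. \<forall>\<phi>\<in>H_zero \<Omega> k. f (\<lambda>x. c * \<phi> x) = c * f \<phi>) \<and>
     (\<exists>M. \<forall>\<phi>\<in>H_zero \<Omega> k. \<bar>f \<phi>\<bar> \<le> M * H_norm k \<phi>)}"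

definition H_dual_norm ::
  "(real ^ 'd) set \<Rightarrow> (real ^ 'd) kernel \<Rightarrow> ((real ^ 'd \<Rightarrow> real) \<Rightarrow> real) \<Rightarrow> real" where
  "H_dual_norm \<Omega> k f = (SUP \<phi>\<in>{\<phi> \<in> H_zero \<Omega> k. H_norm k \<phi> \<le> 1}. \<bar>f \<phi>\<bar>)"

definition bilin_form ::
  "(real ^ 'd) kernel \<Rightarrow> (real ^ 'd \<Rightarrow> real) \<Rightarrow> (real ^ 'd \<Rightarrow> real) \<Rightarrow> real" where
  "bilin_form k u v =
     1 / 2 * (\<integral>(x, y). (u x - u y) * (v x - v y) * enn2real (k_sym k x y) \<partial>lebesgue) +
     (\<integral>(x, y). (u x - u y) * v x * real_of_ereal (k_anti k x y) \<partial>lebesgue)"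

definition poincare_friedrichs :: "(real ^ 'd) set \<Rightarrow> (real ^ 'd) kernel \<Rightarrow> real \<Rightarrow> bool" where
  "poincare_friedrichs \<Omega> k C_P \<longleftrightarrow> (\<forall>u\<in>L2_zero \<Omega>.
     (\<integral>\<^sup>+x. ennreal ((u x)\<^sup>2) \<partial>lebesgue_on \<Omega>) \<le> ennreal C_P *
       (\<integral>\<^sup>+x. (\<integral>\<^sup>+y. ennreal ((u x - u y)\<^sup>2) * k_sym k x y \<partial>lebesgue) \<partial>lebesgue))"

definition dirichlet_solution ::
  "(real ^ 'd) set \<Rightarrow> (real ^ 'd) kernel \<Rightarrow> ((real ^ 'd \<Rightarrow> real) \<Rightarrow> real) \<Rightarrow>
     (real ^ 'd \<Rightarrow> real) \<Rightarrow> (real ^ 'd \<Rightarrow> real) \<Rightarrow> bool" where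
  "dirichlet_solution \<Omega> k f g u \<longleftrightarrow>
     u \<in> V_space \<Omega> k \<and> (\<lambda>x. u x - g x) \<in> H_zero \<Omega> k \<and>
     (\<forall>\<phi>\<in>H_zero \<Omega> k. bilin_form k u \<phi> = f \<phi>)"

definition levy_cond :: "(real ^ 'd) kernel \<Rightarrow> bool" where
  "levy_cond k \<longleftrightarrow> (\<forall>K. compact K \<longrightarrow>
     (\<integral>\<^sup>+x. (\<integral>\<^sup>+y. ennreal (min 1 ((norm (x - y))\<^sup>2)) * k_sym k x y \<partial>lebesgue) \<partial>lebesgue_on K) < \<infinity>)"

text \<open>By the conventions of type \<open>ereal\<close>, \<open>k_a^2 / k_s = 0\<close> where \<open>k_s = \<infinity>\<close>.\<close>

definition anti_bound :: "(real ^ 'd) kernel \<Rightarrow> real \<Rightarrow> bool" where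
  "anti_bound k A \<longleftrightarrow>
     (SUP x. \<integral>\<^sup>+y\<in>{y. k_sym k x y \<noteq> 0}.
        e2ennreal ((k_anti k x y)\<^sup>2 / enn2ereal (k_sym k x y)) \<partial>lebesgue) \<le> ennreal A"

definition anti_dominated :: "(real ^ 'd) kernel \<Rightarrow> real \<Rightarrow> bool" where
  "anti_dominated k D \<longleftrightarrow>
     (AE (x, y) in lebesgue. \<bar>k_anti k x y\<bar> \<le> ereal (inverse D) * enn2ereal (k_sym k x y))"

definition fractional_lower_bound :: "(real ^ 'd) kernel \<Rightarrow> real \<Rightarrow> real \<Rightarrow> bool" where
  "fractional_lower_bound k \<alpha> lam \<longleftrightarrow> (\<forall>u\<in>L2_on UNIV.
     (\<integral>\<^sup>+x. (\<integral>\<^sup>+y. ennreal ((u x - u y)\<^sup>2) * k_sym k x y \<partial>lebesgue) \<partial>lebesgue) \<ge>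
     ennreal (lam * \<alpha> * (2 - \<alpha>)) *
       (\<integral>\<^sup>+x. (\<integral>\<^sup>+y. ennreal ((u x - u y)\<^sup>2 / norm (x - y) powr (real CARD('d) + \<alpha>))
          \<partial>lebesgue) \<partial>lebesgue))"

end

theory Submission
  imports Defs
begin

text \<open>
  Split the kernel into its symmetric part \<open>J\<close> and its antisymmetric part \<open>a\<close>, both real valued
  almost everywhere. On the space of functions of finite energy that vanish outside \<open>\<Omega>\<close> the energy
  \<open>[u, v] = \<integral>\<integral> (u(x) - u(y)) (v(x) - v(y)) J\<close> is a complete inner product, because the fractional
  lower bound gives a Poincare inequality (\<open>Poincare\<close>, \<open>zero_space_complete\<close>). The problem is to
  find \<open>w = u - g\<close> with \<open>1/2 [w, \<phi>] + drift w \<phi> = F \<phi>\<close> for a bounded functional \<open>F\<close>. The drift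
  \<open>\<integral>\<integral> (w(x) - w(y)) \<phi>(x) a\<close> is bounded, but the sum is not coercive: it satisfies only a Garding
  inequality, with a loss of a multiple of \<open>\<integral> w\<^sup>2\<close>.

  The loss is removed by an a priori estimate for the adjoint equation (\<open>adjoint_estimate\<close>), that
  is, for \<open>v\<close> with \<open>\<bar>1/2 [\<phi>, v] + t drift \<phi> v\<bar> \<le> M sqrt [\<phi>, \<phi>]\<close> for all \<open>\<phi>\<close>. Antisymmetry of \<open>a\<close>
  turns the drift into \<open>1/2 \<integral>\<integral> (\<phi>(x) - \<phi>(y)) (v(x) + v(y)) a\<close>. Test with
  \<open>\<phi> = v\<^sup>+ / (v\<^sup>+ + M)\<close> and write \<open>v(x) + v(y) = \<bar>v(x) - v(y)\<bar> + 2 min (v(x)) (v(y))\<close> where both values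
  are positive. The first summand is absorbed by \<open>\<bar>a\<bar> \<le> J / D\<close>; the second costs only \<open>a\<^sup>2 / J\<close>, whose
  integral over \<open>\<Omega> \<times> R^d\<close> is at most \<open>A\<close> times the volume of \<open>\<Omega>\<close>. What remains is a bound, by a
  constant, for the energy of \<open>ln (1 + v\<^sup>+ / M)\<close> (\<open>log_estimate\<close>). Hence \<open>\<bar>v\<bar> > M T\<close> holds only on a
  set whose measure is small if \<open>T\<close> is large (\<open>superlevel_measure\<close>). Functions of bounded energy
  do not concentrate on such sets (\<open>energy_small_sets\<close>), so \<open>\<integral> v\<^sup>2\<close> is at most a small multiple of
  \<open>[v, v]\<close> plus a multiple of \<open>M\<^sup>2\<close>, and the Garding inequality gives \<open>[v, v] \<le> C\<^sup>2 M\<^sup>2\<close>.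

  The constant \<open>C\<close> does not depend on \<open>t\<close> in \<open>[0, 1]\<close>. At \<open>t = 0\<close> the adjoint equation is solved by
  the Riesz representation, and the method of continuity leads to \<open>t = 1\<close>. An adjoint equation
  that is uniquely solvable with an estimate yields existence and uniqueness for the equation
  itself by transposition (\<open>inf_sup_solvability\<close>).

  The final estimate is the Garding inequality for \<open>w\<close>, tested with \<open>w\<close> itself. Since \<open>w\<close> vanishes
  outside \<open>\<Omega>\<close>, only increments of \<open>g\<close> with one end in \<open>\<Omega>\<close> enter, and these are controlled by the norm of
  \<open>V(\<Omega>; k)\<close> (\<open>weak_solution_estimate\<close>).
\<close>

section \<open>Lebesgue measure on a product space\<close>

text \<open>
  Lebesgue measure on a product is the completion of the product of the Lebesgue measures, so that
  sections of a measurable function are measurable only at almost every point. The statements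
  below are reduced to Borel functions that agree almost everywhere with the given ones.
\<close>

lemma AE_lebesgue_iff_lborel: "(AE x in lebesgue. P x) \<longleftrightarrow> (AE x in lborel. P x)"
  by (rule AE_completion_iff)

lemma (in complete_measure) measurable_AE_cong:
  fixes f g :: "'a \<Rightarrow> 'b"
  assumes g: "g \<in> measurable M N" and f: "f \<in> space M \<rightarrow> space N"
    and ae: "AE x in M. f x = g x"
  shows "f \<in> measurable M N"
proof (rule measurableI)
  show "f x \<in> space N" if "x \<in> space M" for x using f that by blast
  fix B assume B: "B \<in> sets N"
  show "f -` B \<inter> space M \<in> sets M"
  proof (rule in_sets_AE[OF _ measurable_sets[OF g B]])
    show "AE x in M. x \<in> g -` B \<inter> space M \<longleftrightarrow> x \<in> f -` B \<inter> space M"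
      using ae by eventually_elim auto
  qed auto
qed

lemma AE_lebesgue_pair:
  fixes P :: "'a::euclidean_space \<times> 'b::euclidean_space \<Rightarrow> bool"
  assumes "AE z in lebesgue. P z"
  shows "AE x in lebesgue. AE y in lebesgue. P (x, y)"
proof -
  have "AE z in lborel \<Otimes>\<^sub>M lborel. P z"
    using assms unfolding AE_lebesgue_iff_lborel lborel_prod .
  from lborel_pair.AE_pair[OF this] show ?thesis
    by (simp add: AE_lebesgue_iff_lborel)
qed

text \<open>
  Preimages of null sets must be null, which holds because \<open>X \<times> UNIV\<close> has measure 0 if \<open>X\<close> has.
\<close>

lemma fst_measurable_lebesgue:
  "fst \<in> measurable (lebesgue :: ('a::euclidean_space \<times> 'b::euclidean_space) measure) lebesgue"
proof (rule completion.measurable_completion2)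
  show fst1: "fst \<in> measurable (lebesgue :: ('a \<times> 'b) measure) lborel"
    by (rule measurable_completion) (simp add: lborel_prod[symmetric])
  show "null_sets lborel \<subseteq> null_sets (distr (lebesgue :: ('a \<times> 'b) measure) lborel fst)"
  proof
    fix X :: "'a set" assume X: "X \<in> null_sets lborel"
    have eq: "fst -` X \<inter> space (lebesgue :: ('a \<times> 'b) measure) = X \<times> UNIV" by auto
    have "emeasure (lborel :: ('a \<times> 'b) measure) (X \<times> UNIV) = 0"
      using X by (subst lborel_prod[symmetric], subst lborel.emeasure_pair_measure_Times) auto
    moreover have "X \<times> UNIV \<in> sets (lborel :: ('a \<times> 'b) measure)"
      using X by (subst lborel_prod[symmetric]) auto
    ultimately show "X \<in> null_sets (distr (lebesgue :: ('a \<times> 'b) measure) lborel fst)"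
      using X fst1 eq by (auto simp: null_sets_def emeasure_distr)
  qed
qed

lemma lborel_distr_swap:
  "distr (lborel :: ('a::euclidean_space \<times> 'b::euclidean_space) measure) lborel prod.swap = lborel"
    using lborel_pair.distr_pair_swap[where 'a='b and 'b='a]
    by (simp add: lborel_prod prod.swap_def[abs_def] case_prod_beta')

lemma swap_measurable_lebesgue:
  "prod.swap \<in> measurable (lebesgue :: ('a::euclidean_space \<times> 'b::euclidean_space) measure) lebesgue"
proof (rule completion.measurable_completion2)
  have sw: "prod.swap \<in> measurable (lborel :: ('a \<times> 'b) measure) (lborel :: ('b \<times> 'a) measure)"
    by (simp add: borel_measurable_continuous_onI continuous_on_swap)
  then show "prod.swap \<in> measurable (lebesgue :: ('a \<times> 'b) measure) lborel"
    by (rule measurable_completion)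
  show "null_sets (lborel :: ('b \<times> 'a) measure)
      \<subseteq> null_sets (distr (lebesgue :: ('a \<times> 'b) measure) lborel prod.swap)"
    using distr_completion[OF sw] by (simp add: lborel_distr_swap)
qed

lemma lebesgue_distr_swap:
  "distr (lebesgue :: ('a::euclidean_space \<times> 'b::euclidean_space) measure) lebesgue prod.swap = lebesgue"
proof -
  have sw: "prod.swap \<in> measurable (lebesgue :: ('a \<times> 'b) measure) lborel"
    by (rule measurable_completion) (simp add: borel_measurable_continuous_onI continuous_on_swap)
  have sw2: "prod.swap \<in> measurable (lborel :: ('a \<times> 'b) measure) (lborel :: ('b \<times> 'a) measure)"
    by (simp add: borel_measurable_continuous_onI continuous_on_swap)
  have d: "distr (lebesgue :: ('a \<times> 'b) measure) lborel prod.swap = lborel"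
    using distr_completion[OF sw2] by (simp add: lborel_distr_swap)
  have "completion (distr (lebesgue :: ('a \<times> 'b) measure) lborel prod.swap)
      = distr (lebesgue :: ('a \<times> 'b) measure) lebesgue prod.swap"
    by (rule completion.completion_distr_eq[OF sw]) (simp add: d)
  then show ?thesis by (simp add: d)
qed

lemma snd_measurable_lebesgue:
  "snd \<in> measurable (lebesgue :: ('a::euclidean_space \<times> 'b::euclidean_space) measure) lebesgue"
  using measurable_comp[OF swap_measurable_lebesgue fst_measurable_lebesgue]
  by (simp add: comp_def)

lemma nn_integral_lebesgue_pair:
  fixes f :: "'a::euclidean_space \<times> 'b::euclidean_space \<Rightarrow> ennreal"
  assumes "f \<in> borel_measurable lebesgue"
  shows "(\<integral>\<^sup>+z. f z \<partial>lebesgue) = (\<integral>\<^sup>+x. (\<integral>\<^sup>+y. f (x, y) \<partial>lebesgue) \<partial>lebesgue)"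
proof -
  obtain g where g: "g \<in> borel_measurable lborel" "AE z in lborel. f z = g z"
    using completion_ex_borel_measurable[OF assms] by blast
  have g': "g \<in> borel_measurable (lborel \<Otimes>\<^sub>M lborel)"
    using g(1) by (simp add: lborel_prod)
  have "(\<integral>\<^sup>+z. f z \<partial>lebesgue) = (\<integral>\<^sup>+z. g z \<partial>lborel)"
    unfolding nn_integral_completion by (rule nn_integral_cong_AE[OF g(2)])
  also have "\<dots> = (\<integral>\<^sup>+x. (\<integral>\<^sup>+y. g (x, y) \<partial>lborel) \<partial>lborel)"
    using lborel.nn_integral_fst[OF g'] by (simp add: lborel_prod)
  also have "\<dots> = (\<integral>\<^sup>+x. (\<integral>\<^sup>+y. f (x, y) \<partial>lborel) \<partial>lborel)"
  proof (rule nn_integral_cong_AE)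
    have "AE x in lborel. AE y in lborel. f (x, y) = g (x, y)"
      using AE_lebesgue_pair[of "\<lambda>z. f z = g z"] g(2) by (simp add: AE_lebesgue_iff_lborel)
    then show "AE x in lborel. (\<integral>\<^sup>+y. g (x, y) \<partial>lborel) = (\<integral>\<^sup>+y. f (x, y) \<partial>lborel)"
      by eventually_elim (rule nn_integral_cong_AE, auto)
  qed
  finally show ?thesis unfolding nn_integral_completion .
qed

lemma integral_lebesgue_pair:
  fixes f :: "'a::euclidean_space \<times> 'b::euclidean_space \<Rightarrow> real"
  assumes f: "integrable lebesgue f"
  shows "(\<integral>z. f z \<partial>lebesgue) = (\<integral>x. (\<integral>y. f (x, y) \<partial>lebesgue) \<partial>lebesgue)"
proof -
  obtain g where g: "g \<in> borel_measurable lborel" "AE z in lborel. f z = g z"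
    using completion_ex_borel_measurable_real[OF borel_measurable_integrable[OF f]] by blast
  have g': "g \<in> borel_measurable (lborel \<Otimes>\<^sub>M lborel)"
    using g(1) by (simp add: lborel_prod)
  have AEz: "AE z in lebesgue. f z = g z"
    using g(2) by (simp add: AE_lebesgue_iff_lborel)
  have gl: "g \<in> borel_measurable lebesgue" by (rule measurable_completion[OF g(1)])
  have intg: "integrable lebesgue g"
    using integrable_cong_AE[OF borel_measurable_integrable[OF f] gl AEz] f by simp
  then have intg': "integrable (lborel \<Otimes>\<^sub>M lborel) g"
    using integrable_completion[OF g(1)] by (simp add: lborel_prod)
  have "(\<integral>z. f z \<partial>lebesgue) = (\<integral>z. g z \<partial>lebesgue)"
    by (rule integral_cong_AE[OF borel_measurable_integrable[OF f] gl AEz])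
  also have "\<dots> = (\<integral>z. g z \<partial>(lborel \<Otimes>\<^sub>M lborel))"
    using integral_completion[OF g(1)] by (simp add: lborel_prod)
  also have "\<dots> = (\<integral>x. (\<integral>y. g (x, y) \<partial>lborel) \<partial>lborel)"
    using lborel_pair.integral_fst[of "\<lambda>x y. g (x, y)"] intg' by simp
  also have "\<dots> = (\<integral>x. (\<integral>y. g (x, y) \<partial>lborel) \<partial>lebesgue)"
    by (rule integral_completion[symmetric]) (use g' in measurable)
  also have "\<dots> = (\<integral>x. (\<integral>y. f (x, y) \<partial>lebesgue) \<partial>lebesgue)"
  proof -
    have meas_g: "(\<lambda>x. \<integral>y. g (x, y) \<partial>lborel) \<in> borel_measurable lebesgue"
      by (rule measurable_completion) (use g' in measurable)
    have ae: "AE x in lebesgue. (\<integral>y. g (x, y) \<partial>lborel) = (\<integral>y. f (x, y) \<partial>lebesgue)"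
      using AE_lebesgue_pair[OF AEz]
    proof eventually_elim
      fix x assume e: "AE y in lebesgue. f (x, y) = g (x, y)"
      have m: "(\<lambda>y. g (x, y)) \<in> borel_measurable lborel"
        using g' by measurable
      have ml: "(\<lambda>y. g (x, y)) \<in> borel_measurable lebesgue"
        by (rule measurable_completion[OF m])
      have mf: "(\<lambda>y. f (x, y)) \<in> borel_measurable lebesgue"
        by (rule completion.measurable_AE_cong[OF ml _ e]) simp
      show "(\<integral>y. g (x, y) \<partial>lborel) = (\<integral>y. f (x, y) \<partial>lebesgue)"
        unfolding integral_completion[OF m, symmetric]
        by (rule integral_cong_AE[OF ml mf]) (use e in auto)
    qed
    show ?thesis
      by (rule integral_cong_AE[OF meas_g completion.measurable_AE_cong[OF meas_g] ae])
        (use ae in \<open>auto elim: eventually_mono\<close>)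
  qed
  finally show ?thesis .
qed

declare fst_measurable_lebesgue [measurable] snd_measurable_lebesgue [measurable]

lemma measurable_fst_lebesgue:
  "u \<in> borel_measurable lebesgue \<Longrightarrow>
    (\<lambda>z :: 'a::euclidean_space \<times> 'b::euclidean_space. u (fst z)) \<in> borel_measurable lebesgue"
  by (rule measurable_compose[OF fst_measurable_lebesgue])

lemma measurable_snd_lebesgue:
  "u \<in> borel_measurable lebesgue \<Longrightarrow>
    (\<lambda>z :: 'a::euclidean_space \<times> 'b::euclidean_space. u (snd z)) \<in> borel_measurable lebesgue"
  by (rule measurable_compose[OF snd_measurable_lebesgue])

lemma nn_integral_lebesgue_prod:
  fixes f :: "'a::euclidean_space \<Rightarrow> ennreal" and g :: "'b::euclidean_space \<Rightarrow> ennreal"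
  assumes [measurable]: "f \<in> borel_measurable lebesgue" "g \<in> borel_measurable lebesgue"
  shows "(\<integral>\<^sup>+z. f (fst z) * g (snd z) \<partial>lebesgue) = (\<integral>\<^sup>+x. f x \<partial>lebesgue) * (\<integral>\<^sup>+y. g y \<partial>lebesgue)"
  by (subst nn_integral_lebesgue_pair) (simp_all add: nn_integral_cmult nn_integral_multc)

lemma AE_lebesgue_fst:
  assumes "AE x in lebesgue. P x"
  shows "AE z in (lebesgue :: ('a::euclidean_space \<times> 'b::euclidean_space) measure). P (fst z)"
proof -
  obtain N where N: "{x \<in> space lebesgue. \<not> P x} \<subseteq> N" "N \<in> null_sets lebesgue"
    using AE_E[OF assms] by (metis null_setsI)
  have [measurable]: "N \<in> sets lebesgue" using N by auto
  have "(\<integral>\<^sup>+z. indicator N (fst z) * (1 :: ennreal) \<partial>(lebesgue :: ('a \<times> 'b) measure)) = 0"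
    using N(2) by (subst nn_integral_lebesgue_prod[where g="\<lambda>_. 1"]) (auto simp: null_sets_def)
  then have "AE z in (lebesgue :: ('a \<times> 'b) measure). indicator N (fst z) * (1 :: ennreal) = 0"
    by (subst (asm) nn_integral_0_iff_AE) measurable
  then show ?thesis
    by eventually_elim (use N(1) in \<open>auto simp: indicator_def split: if_splits\<close>)
qed

lemma AE_lebesgue_swap:
  assumes "AE z in (lebesgue :: ('a::euclidean_space \<times> 'b::euclidean_space) measure). P z"
  shows "AE z in lebesgue. P (prod.swap z)"
  using assms
  by (subst (asm) lebesgue_distr_swap[symmetric]) (rule AE_distrD[OF swap_measurable_lebesgue])

lemma AE_lebesgue_snd:
  assumes "AE x in lebesgue. P x"
  shows "AE z in (lebesgue :: ('a::euclidean_space \<times> 'b::euclidean_space) measure). P (snd z)"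
  using AE_lebesgue_swap[OF AE_lebesgue_fst[OF assms, where 'b='a]] by simp

lemma integral_lebesgue_swap:
  fixes f :: "'a::euclidean_space \<times> 'b::euclidean_space \<Rightarrow> real"
  assumes "f \<in> borel_measurable lebesgue"
  shows "(\<integral>z. f (prod.swap z) \<partial>lebesgue) = (\<integral>z. f z \<partial>lebesgue)"
  using integral_distr[OF swap_measurable_lebesgue assms] by (simp add: lebesgue_distr_swap)

lemma integrable_lebesgue_swap:
  fixes f :: "'a::euclidean_space \<times> 'b::euclidean_space \<Rightarrow> real"
  assumes "integrable lebesgue f"
  shows "integrable lebesgue (\<lambda>z. f (prod.swap z))"
  using integrable_distr[OF swap_measurable_lebesgue, of f] assms by (simp add: lebesgue_distr_swap)

lemma AE_lebesgue_section_measurable: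
  fixes f :: "'a::euclidean_space \<times> 'b::euclidean_space \<Rightarrow> ennreal"
  assumes "f \<in> borel_measurable lebesgue"
  shows "AE x in lebesgue. (\<lambda>y. f (x, y)) \<in> borel_measurable lebesgue"
proof -
  obtain g where g: "g \<in> borel_measurable lborel" "AE z in lborel. f z = g z"
    using completion_ex_borel_measurable[OF assms] by blast
  have g': "g \<in> borel_measurable (lborel \<Otimes>\<^sub>M lborel)"
    using g(1) by (simp add: lborel_prod)
  have "AE x in lebesgue. AE y in lebesgue. f (x, y) = g (x, y)"
    using AE_lebesgue_pair[of "\<lambda>z. f z = g z"] g(2) by (simp add: AE_lebesgue_iff_lborel)
  then show ?thesis
  proof eventually_elim
    case (elim x)
    have "(\<lambda>y. g (x, y)) \<in> borel_measurable lborel" using g' by measurable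
    then have "(\<lambda>y. g (x, y)) \<in> borel_measurable lebesgue" by (rule measurable_completion)
    from completion.measurable_AE_cong[OF this _ elim] show ?case by simp
  qed
qed

lemma AE_lebesgue_off_diagonal:
  "AE z in (lebesgue :: ('a::euclidean_space \<times> 'a) measure). fst z \<noteq> snd z"
proof -
  have "closed {z :: 'a \<times> 'a. fst z = snd z}" by (intro closed_Collect_eq continuous_intros)
  from borel_closed[OF this] have m: "{z :: 'a \<times> 'a. fst z = snd z} \<in> sets lebesgue" by simp
  have "(\<integral>\<^sup>+z. indicator {z :: 'a \<times> 'a. fst z = snd z} z \<partial>lebesgue)
      = (\<integral>\<^sup>+x. (\<integral>\<^sup>+y. indicator {z :: 'a \<times> 'a. fst z = snd z} (x, y) \<partial>lebesgue) \<partial>lebesgue)"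
    by (rule nn_integral_lebesgue_pair[OF borel_measurable_indicator[OF m]])
  also have "\<dots> = (\<integral>\<^sup>+x. (\<integral>\<^sup>+y. indicator {x :: 'a} y \<partial>lebesgue) \<partial>lebesgue)"
    by (intro nn_integral_cong) (auto simp: indicator_def)
  also have "\<dots> = 0" by simp
  finally have "emeasure lebesgue {z :: 'a \<times> 'a. fst z = snd z} = 0" using m by simp
  then have "{z :: 'a \<times> 'a. fst z = snd z} \<in> null_sets lebesgue" using m by blast
  from AE_not_in[OF this] show ?thesis by simp
qed

lemma nn_integral_lebesgue_on_fst:
  fixes f :: "'a::euclidean_space \<times> 'b::euclidean_space \<Rightarrow> ennreal"
  assumes S: "S \<in> sets lebesgue" and f: "f \<in> borel_measurable lebesgue"
  shows "(\<integral>\<^sup>+x. (\<integral>\<^sup>+y. f (x, y) \<partial>lebesgue) \<partial>lebesgue_on S)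
    = (\<integral>\<^sup>+z. f z * indicator S (fst z) \<partial>lebesgue)"
proof -
  have "(\<integral>\<^sup>+x. (\<integral>\<^sup>+y. f (x, y) \<partial>lebesgue) \<partial>lebesgue_on S)
      = (\<integral>\<^sup>+x. (\<integral>\<^sup>+y. f (x, y) \<partial>lebesgue) * indicator S x \<partial>lebesgue)"
    using S by (subst nn_integral_restrict_space) auto
  also have "\<dots> = (\<integral>\<^sup>+x. (\<integral>\<^sup>+y. f (x, y) * indicator S (fst (x, y)) \<partial>lebesgue) \<partial>lebesgue)"
    by (intro nn_integral_cong) (simp add: indicator_def)
  also have "\<dots> = (\<integral>\<^sup>+z. f z * indicator S (fst z) \<partial>lebesgue)"
    by (rule nn_integral_lebesgue_pair[symmetric])
       (intro borel_measurable_times_ennreal f measurable_fst_lebesgue borel_measurable_indicator S)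
  finally show ?thesis .
qed

lemma lebesgue_Times_UNIV:
  fixes S :: "'a::euclidean_space set"
  assumes S: "S \<in> sets lebesgue"
  shows "S \<times> (UNIV :: 'b::euclidean_space set) \<in> sets lebesgue"
proof -
  have "fst -` S \<inter> space (lebesgue :: ('a \<times> 'b) measure) \<in> sets lebesgue"
    by (rule measurable_sets[OF fst_measurable_lebesgue S])
  moreover have "fst -` S \<inter> space (lebesgue :: ('a \<times> 'b) measure) = S \<times> UNIV" by auto
  ultimately show ?thesis by simp
qed

section \<open>Solvability of variational equations by continuity\<close>

text \<open>
  Elements of function spaces are functions, not classes of functions. The inner product is
  therefore only semidefinite, \<open>nrm\<close> is a seminorm, and equations between elements are replaced by
  distances 0. A bounded functional does not see the difference (\<open>functional_null\<close>).
\<close>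

locale function_inner_product_space =
  fixes S :: "('a \<Rightarrow> real) set" and ip :: "('a \<Rightarrow> real) \<Rightarrow> ('a \<Rightarrow> real) \<Rightarrow> real"
  assumes zero_mem: "(\<lambda>_. 0) \<in> S"
    and add_mem: "\<lbrakk>u \<in> S; v \<in> S\<rbrakk> \<Longrightarrow> (\<lambda>x. u x + v x) \<in> S"
    and scale_mem: "u \<in> S \<Longrightarrow> (\<lambda>x. c * u x) \<in> S"
    and ip_commute: "ip u v = ip v u"
    and ip_add_left: "\<lbrakk>u \<in> S; v \<in> S; w \<in> S\<rbrakk> \<Longrightarrow> ip (\<lambda>x. u x + v x) w = ip u w + ip v w"
    and ip_scale_left: "\<lbrakk>u \<in> S; w \<in> S\<rbrakk> \<Longrightarrow> ip (\<lambda>x. c * u x) w = c * ip u w"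
    and ip_nonneg: "u \<in> S \<Longrightarrow> 0 \<le> ip u u"
begin

definition nrm :: "('a \<Rightarrow> real) \<Rightarrow> real" where
  "nrm u = sqrt (ip u u)"

definition bounded_functional :: "(('a \<Rightarrow> real) \<Rightarrow> real) \<Rightarrow> bool" where
  "bounded_functional f \<longleftrightarrow>
     (\<forall>u\<in>S. \<forall>v\<in>S. f (\<lambda>x. u x + v x) = f u + f v) \<and>
     (\<forall>c. \<forall>u\<in>S. f (\<lambda>x. c * u x) = c * f u) \<and>
     (\<exists>M. \<forall>u\<in>S. \<bar>f u\<bar> \<le> M * nrm u)"

definition bounded_form :: "(('a \<Rightarrow> real) \<Rightarrow> ('a \<Rightarrow> real) \<Rightarrow> real) \<Rightarrow> bool" where
  "bounded_form B \<longleftrightarrow>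
     (\<forall>u\<in>S. \<forall>v\<in>S. \<forall>w\<in>S. B (\<lambda>x. u x + v x) w = B u w + B v w) \<and>
     (\<forall>u\<in>S. \<forall>v\<in>S. \<forall>w\<in>S. B w (\<lambda>x. u x + v x) = B w u + B w v) \<and>
     (\<forall>c. \<forall>u\<in>S. \<forall>w\<in>S. B (\<lambda>x. c * u x) w = c * B u w) \<and>
     (\<forall>c. \<forall>u\<in>S. \<forall>w\<in>S. B w (\<lambda>x. c * u x) = c * B w u) \<and>
     (\<exists>K. \<forall>u\<in>S. \<forall>v\<in>S. \<bar>B u v\<bar> \<le> K * nrm u * nrm v)"

lemma diff_mem: "\<lbrakk>u \<in> S; v \<in> S\<rbrakk> \<Longrightarrow> (\<lambda>x. u x - v x) \<in> S"
  using add_mem[of u "\<lambda>x. -1 * v x"] scale_mem[of v "-1"] by simp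

lemma nrm_nonneg [simp]: "u \<in> S \<Longrightarrow> 0 \<le> nrm u"
  by (simp add: nrm_def ip_nonneg)

lemma nrm_sq: "u \<in> S \<Longrightarrow> (nrm u)\<^sup>2 = ip u u"
  by (simp add: nrm_def ip_nonneg)

lemma ip_add_right: "\<lbrakk>u \<in> S; v \<in> S; w \<in> S\<rbrakk> \<Longrightarrow> ip w (\<lambda>x. u x + v x) = ip w u + ip w v"
  using ip_add_left ip_commute by metis

lemma ip_scale_right: "\<lbrakk>u \<in> S; w \<in> S\<rbrakk> \<Longrightarrow> ip w (\<lambda>x. c * u x) = c * ip w u"
  using ip_scale_left ip_commute by metis

lemma ip_diff_left: "\<lbrakk>u \<in> S; v \<in> S; w \<in> S\<rbrakk> \<Longrightarrow> ip (\<lambda>x. u x - v x) w = ip u w - ip v w"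
  using ip_add_left[of u "\<lambda>x. -1 * v x" w] ip_scale_left[of v w "-1"] scale_mem[of v "-1"] by simp

lemma ip_diff_right: "\<lbrakk>u \<in> S; v \<in> S; w \<in> S\<rbrakk> \<Longrightarrow> ip w (\<lambda>x. u x - v x) = ip w u - ip w v"
  using ip_diff_left ip_commute by metis

lemma ip_line:
  assumes "u \<in> S" "v \<in> S"
  shows "ip (\<lambda>x. u x + t * v x) (\<lambda>x. u x + t * v x) = ip u u + 2 * t * ip u v + t\<^sup>2 * ip v v"
  using assms
  by (simp add: ip_add_left ip_add_right ip_scale_left ip_scale_right add_mem scale_mem
      ip_commute[of v u] power2_eq_square algebra_simps)

lemma Cauchy_Schwarz:
  assumes u: "u \<in> S" and v: "v \<in> S"
  shows "\<bar>ip u v\<bar> \<le> nrm u * nrm v"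
proof -
  have *: "0 \<le> ip u u + 2 * t * ip u v + t\<^sup>2 * ip v v" for t
    using ip_nonneg[OF add_mem[OF u scale_mem[OF v, of t]]] ip_line[OF u v, of t] by simp
  have "(ip u v)\<^sup>2 \<le> ip u u * ip v v"
  proof (cases "ip v v = 0")
    case True
    have "ip u v = 0"
    proof (rule ccontr)
      assume nz: "ip u v \<noteq> 0"
      from *[of "- (ip u u + 1) / (2 * ip u v)"] show False
        using True nz by (simp add: field_simps)
    qed
    then show ?thesis using True by simp
  next
    case False
    then have pos: "ip v v > 0" using ip_nonneg[OF v] by simp
    from *[of "- ip u v / ip v v"] pos have "0 \<le> ip u u - (ip u v)\<^sup>2 / ip v v"
      by (simp add: field_simps power2_eq_square)
    then show ?thesis using pos by (simp add: field_simps)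
  qed
  then have "sqrt ((ip u v)\<^sup>2) \<le> sqrt (ip u u * ip v v)" by (rule real_sqrt_le_mono)
  then show ?thesis by (simp add: nrm_def real_sqrt_mult)
qed

lemma nrm_triangle:
  assumes u: "u \<in> S" and v: "v \<in> S"
  shows "nrm (\<lambda>x. u x + v x) \<le> nrm u + nrm v"
proof (rule power2_le_imp_le)
  have "(nrm (\<lambda>x. u x + v x))\<^sup>2 = ip u u + 2 * ip u v + ip v v"
    using ip_line[OF u v, of 1] nrm_sq[OF add_mem[OF u v]] by simp
  also have "\<dots> \<le> (nrm u + nrm v)\<^sup>2"
    using Cauchy_Schwarz[OF u v] by (simp add: power2_sum nrm_sq u v abs_le_iff)
  finally show "(nrm (\<lambda>x. u x + v x))\<^sup>2 \<le> (nrm u + nrm v)\<^sup>2" .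
qed (simp add: u v)

lemma nrm_scale: "u \<in> S \<Longrightarrow> nrm (\<lambda>x. c * u x) = \<bar>c\<bar> * nrm u"
  by (simp add: nrm_def ip_scale_left ip_scale_right scale_mem mult.assoc[symmetric]
      real_sqrt_mult real_sqrt_abs2)

lemma nrm_diff_commute: "\<lbrakk>u \<in> S; v \<in> S\<rbrakk> \<Longrightarrow> nrm (\<lambda>x. u x - v x) = nrm (\<lambda>x. v x - u x)"
  using nrm_scale[OF diff_mem, of u v "-1"] by simp

lemma nrm_triangle_diff:
  assumes "u \<in> S" "v \<in> S" "w \<in> S"
  shows "nrm (\<lambda>x. u x - w x) \<le> nrm (\<lambda>x. u x - v x) + nrm (\<lambda>x. v x - w x)"
  using nrm_triangle[OF diff_mem[OF assms(1,2)] diff_mem[OF assms(2,3)]] by simp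

end

locale function_hilbert_space = function_inner_product_space +
  assumes complete: "\<lbrakk>\<And>n. s n \<in> S;
        \<And>e. e > 0 \<Longrightarrow> \<exists>K. \<forall>m\<ge>K. \<forall>n\<ge>K. ip (\<lambda>x. s m x - s n x) (\<lambda>x. s m x - s n x) < e\<rbrakk>
      \<Longrightarrow> \<exists>l\<in>S. (\<lambda>n. ip (\<lambda>x. s n x - l x) (\<lambda>x. s n x - l x)) \<longlonglongrightarrow> (0 :: real)"
begin
lemma nrm_complete:
  assumes s: "\<And>n. s n \<in> S"
    and c: "\<And>e. e > 0 \<Longrightarrow> \<exists>K. \<forall>m\<ge>K. \<forall>n\<ge>K. nrm (\<lambda>x. s m x - s n x) < e"
  shows "\<exists>l\<in>S. (\<lambda>n. nrm (\<lambda>x. s n x - l x)) \<longlonglongrightarrow> 0"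
proof -
  have "\<exists>l\<in>S. (\<lambda>n. ip (\<lambda>x. s n x - l x) (\<lambda>x. s n x - l x)) \<longlonglongrightarrow> (0 :: real)"
  proof (rule complete[OF s])
    fix e :: real assume e: "e > 0"
    from c[of "sqrt e"] e obtain K where K: "\<forall>m\<ge>K. \<forall>n\<ge>K. nrm (\<lambda>x. s m x - s n x) < sqrt e" by auto
    then show "\<exists>K. \<forall>m\<ge>K. \<forall>n\<ge>K. ip (\<lambda>x. s m x - s n x) (\<lambda>x. s m x - s n x) < e"
      by (auto simp: nrm_def)
  qed
  then obtain l where "l \<in> S" and l: "(\<lambda>n. ip (\<lambda>x. s n x - l x) (\<lambda>x. s n x - l x)) \<longlonglongrightarrow> (0 :: real)"
    by blast
  then show ?thesis using tendsto_real_sqrt[OF l] by (auto simp: nrm_def)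
qed

lemma bounded_functional_diff:
  assumes "bounded_functional f" "u \<in> S" "v \<in> S"
  shows "f (\<lambda>x. u x - v x) = f u - f v"
proof -
  have add: "f (\<lambda>x. u x + w x) = f u + f w" if "w \<in> S" for w
    using assms that unfolding bounded_functional_def by blast
  have "f (\<lambda>x. (-1) * v x) = (-1) * f v"
    using assms unfolding bounded_functional_def by blast
  then show ?thesis using add[OF scale_mem[OF assms(3), of "-1"]] by simp
qed

lemma bounded_functional_bound:
  assumes "bounded_functional f"
  obtains M where "M \<ge> 0" "\<And>u. u \<in> S \<Longrightarrow> \<bar>f u\<bar> \<le> M * nrm u"
proof -
  obtain M where M: "\<forall>u\<in>S. \<bar>f u\<bar> \<le> M * nrm u"
    using assms unfolding bounded_functional_def by blast
  show thesis
  proof (rule that[of "\<bar>M\<bar>"])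
    fix u assume u: "u \<in> S"
    have "M * nrm u \<le> \<bar>M\<bar> * nrm u" using u by (intro mult_right_mono) auto
    then show "\<bar>f u\<bar> \<le> \<bar>M\<bar> * nrm u" using M u by force
  qed simp
qed

lemma functional_null:
  assumes f: "bounded_functional f" and u: "u \<in> S" and v: "v \<in> S" and 0: "nrm (\<lambda>x. u x - v x) = 0"
  shows "f u = f v"
proof -
  obtain M where "\<And>u. u \<in> S \<Longrightarrow> \<bar>f u\<bar> \<le> M * nrm u"
    using bounded_functional_bound[OF f] by blast
  from this[OF diff_mem[OF u v]] 0 bounded_functional_diff[OF f u v] show ?thesis by simp
qed

text \<open>
  The minimiser of \<open>J u = ip u u - 2 f u\<close> represents \<open>f\<close>: \<open>J\<close> is bounded below, minimising sequences
  are Cauchy by the parallelogram identity, and at the limit the first variation vanishes.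
\<close>

lemma Riesz_representation:
  assumes f: "bounded_functional f"
  shows "\<exists>u\<in>S. \<forall>w\<in>S. ip u w = f w"
proof -
  have f_add: "f (\<lambda>x. u x + v x) = f u + f v" if "u \<in> S" "v \<in> S" for u v
    using f that unfolding bounded_functional_def by blast
  have f_scale: "f (\<lambda>x. c * u x) = c * f u" if "u \<in> S" for c u
    using f that unfolding bounded_functional_def by blast
  obtain M where M0: "M \<ge> 0" and M: "\<And>u. u \<in> S \<Longrightarrow> \<bar>f u\<bar> \<le> M * nrm u"
    using bounded_functional_bound[OF f] by blast
  define J where "J u = ip u u - 2 * f u" for u
  have low: "- (M\<^sup>2) \<le> J u" if u: "u \<in> S" for u
  proof -
    have "0 \<le> (nrm u - M)\<^sup>2" by simp
    then have "2 * (M * nrm u) \<le> (nrm u)\<^sup>2 + M\<^sup>2" by (simp add: power2_diff algebra_simps)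
    then show ?thesis using M[OF u] by (simp add: J_def nrm_sq u)
  qed
  define d where "d = Inf (J ` S)"
  have bdd: "bdd_below (J ` S)" using low by (auto simp: bdd_below_def)
  have d_le: "d \<le> J u" if "u \<in> S" for u
    unfolding d_def using bdd that by (auto intro: cInf_lower)
  have "\<exists>u\<in>S. J u < d + e" if "e > 0" for e
    using cInf_lessD[of "J ` S" "d + e"] zero_mem that unfolding d_def by auto
  then have "\<forall>n. \<exists>u. u \<in> S \<and> J u < d + 1 / real (Suc n)" by (auto simp: Bex_def)
  then obtain s where s: "\<And>n. s n \<in> S" and Js: "\<And>n. J (s n) < d + 1 / real (Suc n)" by metis
  have line: "J (\<lambda>x. u x + t * v x) = J u + 2 * t * (ip u v - f v) + t\<^sup>2 * ip v v"
    if "u \<in> S" "v \<in> S" for u v t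
    unfolding J_def ip_line[OF that] using that
    by (simp add: f_add f_scale scale_mem algebra_simps)
  (* parallelogram identity: the midpoint of two near-minimisers also has J at least d *)
  have cauchy: "ip (\<lambda>x. u x - v x) (\<lambda>x. u x - v x) \<le> 2 * (J u - d) + 2 * (J v - d)"
    if uv: "u \<in> S" "v \<in> S" for u v
  proof -
    define w where "w = (\<lambda>x. v x - u x)"
    have w: "w \<in> S" unfolding w_def using uv by (intro diff_mem)
    define m where "m = (\<lambda>x. u x + (1/2) * w x)"
    have m: "m \<in> S" unfolding m_def using uv(1) w by (intro add_mem scale_mem)
    have 1: "J m = J u + (ip u w - f w) + 1/4 * ip w w"
      using line[OF uv(1) w, of "1/2"] by (simp add: power2_eq_square m_def)
    have 2: "J v = J u + 2 * (ip u w - f w) + ip w w"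
      using line[OF uv(1) w, of 1] by (simp add: w_def)
    have 3: "ip w w = ip (\<lambda>x. u x - v x) (\<lambda>x. u x - v x)"
      unfolding w_def using uv by (simp add: ip_diff_left ip_diff_right diff_mem)
    show ?thesis using 1 2 d_le[OF m] unfolding 3[symmetric] by (simp add: field_simps)
  qed
  have "\<exists>l\<in>S. (\<lambda>n. ip (\<lambda>x. s n x - l x) (\<lambda>x. s n x - l x)) \<longlonglongrightarrow> (0 :: real)"
  proof (rule complete[OF s])
    fix e :: real assume e: "e > 0"
    obtain K where K: "inverse (real (Suc K)) < e / 4" using reals_Archimedean[of "e/4"] e by auto
    have le: "1 / real (Suc m) < e / 4" if "m \<ge> K" for m
    proof -
      have "1 / real (Suc m) \<le> 1 / real (Suc K)" using that by (intro divide_left_mono) auto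
      then show ?thesis using K by (simp add: inverse_eq_divide)
    qed
    show "\<exists>K. \<forall>m\<ge>K. \<forall>n\<ge>K. ip (\<lambda>x. s m x - s n x) (\<lambda>x. s m x - s n x) < e"
    proof (intro exI allI impI)
      fix m n assume "K \<le> m" "K \<le> n"
      then have "J (s m) < d + e / 4" "J (s n) < d + e / 4"
        using Js[of m] Js[of n] add_strict_left_mono[OF le, of m d] add_strict_left_mono[OF le, of n d]
        by (meson less_trans)+
      then have *: "2 * (J (s m) - d) + 2 * (J (s n) - d) < e" by argo
      show "ip (\<lambda>x. s m x - s n x) (\<lambda>x. s m x - s n x) < e"
        by (rule le_less_trans[OF cauchy[OF s s] *])
    qed
  qed
  then obtain l where l: "l \<in> S"
    and lim: "(\<lambda>n. ip (\<lambda>x. s n x - l x) (\<lambda>x. s n x - l x)) \<longlonglongrightarrow> (0 :: real)" by blast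
  have lim': "(\<lambda>n. nrm (\<lambda>x. s n x - l x)) \<longlonglongrightarrow> 0"
    using tendsto_real_sqrt[OF lim] by (simp add: nrm_def)
  have Jl: "J l \<le> d"
  proof (rule tendsto_le[OF sequentially_bot])
    show "(\<lambda>n. d + 1 / real (Suc n) + 2 * (nrm l + M) * nrm (\<lambda>x. s n x - l x)) \<longlonglongrightarrow> d"
      using tendsto_add[OF tendsto_add[OF tendsto_const LIMSEQ_inverse_real_of_nat]
          tendsto_mult[OF tendsto_const lim'], of d "2 * (nrm l + M)"]
      by (simp add: inverse_eq_divide)
    show "\<forall>\<^sub>F n in sequentially. J l \<le> d + 1 / real (Suc n) + 2 * (nrm l + M) * nrm (\<lambda>x. s n x - l x)"
    proof (rule always_eventually, rule allI)
      fix n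
      have w: "(\<lambda>x. s n x - l x) \<in> S" using s l by (rule diff_mem)
      have "J (s n) = J l + 2 * (ip l (\<lambda>x. s n x - l x) - f (\<lambda>x. s n x - l x))
          + ip (\<lambda>x. s n x - l x) (\<lambda>x. s n x - l x)"
        using line[OF l w, of 1] by simp
      moreover have "\<bar>ip l (\<lambda>x. s n x - l x)\<bar> \<le> nrm l * nrm (\<lambda>x. s n x - l x)"
        by (rule Cauchy_Schwarz[OF l w])
      moreover have "\<bar>f (\<lambda>x. s n x - l x)\<bar> \<le> M * nrm (\<lambda>x. s n x - l x)" by (rule M[OF w])
      ultimately show "J l \<le> d + 1 / real (Suc n) + 2 * (nrm l + M) * nrm (\<lambda>x. s n x - l x)"
        using Js[of n] ip_nonneg[OF w] by (simp add: algebra_simps abs_le_iff)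
    qed
  qed auto
  show ?thesis
  proof (intro bexI[OF _ l] ballI)
    fix w assume w: "w \<in> S"
    have *: "0 \<le> 2 * t * (ip l w - f w) + t\<^sup>2 * ip w w" for t
      using d_le[OF add_mem[OF l scale_mem[OF w, of t]]] Jl line[OF l w, of t] by simp
    show "ip l w = f w"
    proof (rule ccontr)
      assume ne: "ip l w \<noteq> f w"
      define a where "a = ip l w - f w"
      define b where "b = ip w w + 1"
      have b: "b > 0" using ip_nonneg[OF w] by (simp add: b_def)
      have "0 \<le> 2 * (- a / b) * a + (- a / b)\<^sup>2 * ip w w" using * a_def by blast
      also have "\<dots> \<le> 2 * (- a / b) * a + (- a / b)\<^sup>2 * b"
        by (intro add_left_mono mult_left_mono) (auto simp: b_def)
      also have "\<dots> = - (a\<^sup>2 / b)" using b by (simp add: field_simps power2_eq_square)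
      finally show False using ne b by (simp add: a_def field_simps)
    qed
  qed
qed

text \<open>
  Banach's fixed point theorem for a seminorm; the fixed point property holds up to distance 0.
\<close>

lemma contraction_fixed_point:
  assumes G: "\<And>u. u \<in> S \<Longrightarrow> G u \<in> S"
    and contr: "\<And>u v. \<lbrakk>u \<in> S; v \<in> S\<rbrakk>
      \<Longrightarrow> nrm (\<lambda>x. G u x - G v x) \<le> 1/2 * nrm (\<lambda>x. u x - v x)"
  shows "\<exists>l\<in>S. nrm (\<lambda>x. G l x - l x) = 0"
proof -
  define s where "s n = (G ^^ n) (\<lambda>_. 0)" for n
  have s: "s n \<in> S" for n by (induction n) (auto simp: s_def zero_mem G)
  have s_Suc: "s (Suc n) = G (s n)" for n by (simp add: s_def)
  define a where "a = nrm (\<lambda>x. s 1 x - s 0 x)"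
  have a0: "a \<ge> 0" unfolding a_def by (intro nrm_nonneg diff_mem s)
  have step: "nrm (\<lambda>x. s (Suc n) x - s n x) \<le> a * (1/2)^n" for n
  proof (induction n)
    case 0 then show ?case by (simp add: a_def)
  next
    case (Suc n)
    have "nrm (\<lambda>x. s (Suc (Suc n)) x - s (Suc n) x) \<le> 1/2 * nrm (\<lambda>x. s (Suc n) x - s n x)"
      unfolding s_Suc[of "Suc n"] s_Suc[of n] using contr[OF G[OF s] s] .
    with Suc show ?case by simp
  qed
  have tail: "nrm (\<lambda>x. s (n + j) x - s n x) \<le> a * (1/2)^n * (2 - 2 * (1/2)^j)" for n j
  proof (induction j)
    case 0 show ?case by (simp add: nrm_def ip_scale_left[of "\<lambda>_. 0" "\<lambda>_. 0" 0, simplified] zero_mem)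
  next
    case (Suc j)
    have "nrm (\<lambda>x. s (n + Suc j) x - s n x)
        \<le> nrm (\<lambda>x. s (Suc (n + j)) x - s (n + j) x) + nrm (\<lambda>x. s (n + j) x - s n x)"
      using nrm_triangle_diff[OF s s s] by simp
    also have "\<dots> \<le> a * (1/2)^(n + j) + a * (1/2)^n * (2 - 2 * (1/2)^j)"
      by (intro add_mono step Suc)
    also have "\<dots> = a * (1/2)^n * (2 - 2 * (1/2)^Suc j)"
      by (simp add: power_add algebra_simps)
    finally show ?case .
  qed
  have tail': "nrm (\<lambda>x. s m x - s n x) \<le> 2 * a * (1/2)^n" if "n \<le> m" for m n
  proof -
    have "nrm (\<lambda>x. s m x - s n x) \<le> a * (1/2)^n * (2 - 2 * (1/2)^(m - n))"
      using tail[of n "m - n"] that by simp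
    also have "\<dots> \<le> a * (1/2)^n * 2" using a0 by (intro mult_left_mono) auto
    finally show ?thesis by simp
  qed
  have "\<exists>l\<in>S. (\<lambda>n. nrm (\<lambda>x. s n x - l x)) \<longlonglongrightarrow> 0"
  proof (rule nrm_complete[OF s])
    fix e :: real assume e: "e > 0"
    obtain K where K: "(1/2)^K < e / (4 * (a + 1))"
      using real_arch_pow_inv[of "e / (4 * (a + 1))" "1/2"] e a0 by auto
    have aK: "2 * a * (1/2)^K < e / 2"
    proof -
      have "2 * a * (1/2)^K \<le> 2 * (a + 1) * (1/2)^K" by (intro mult_right_mono) auto
      also have "\<dots> < 2 * (a + 1) * (e / (4 * (a + 1)))" using K a0 by (intro mult_strict_left_mono) auto
      also have "\<dots> = e / 2" using a0 by (simp add: field_simps)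
      finally show ?thesis .
    qed
    show "\<exists>K. \<forall>m\<ge>K. \<forall>n\<ge>K. nrm (\<lambda>x. s m x - s n x) < e"
    proof (intro exI allI impI)
      fix m n assume mn: "K \<le> m" "K \<le> n"
      have "nrm (\<lambda>x. s m x - s n x) \<le> nrm (\<lambda>x. s m x - s K x) + nrm (\<lambda>x. s n x - s K x)"
        using nrm_triangle_diff[of "s m" "s K" "s n", OF s s s] nrm_diff_commute[OF s s, of K n] by linarith
      also have "\<dots> < e" using tail'[OF mn(1)] tail'[OF mn(2)] aK by linarith
      finally show "nrm (\<lambda>x. s m x - s n x) < e" .
    qed
  qed
  then obtain l where l: "l \<in> S" and lim: "(\<lambda>n. nrm (\<lambda>x. s n x - l x)) \<longlonglongrightarrow> 0" by blast
  have "nrm (\<lambda>x. G l x - l x) \<le> 0"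
  proof (rule tendsto_lowerbound)
    show "(\<lambda>n. 1/2 * nrm (\<lambda>x. s n x - l x) + nrm (\<lambda>x. s (Suc n) x - l x)) \<longlonglongrightarrow> 0"
      using tendsto_add[OF tendsto_mult[OF tendsto_const lim, of "1/2"] LIMSEQ_Suc[OF lim]] by simp
    show "\<forall>\<^sub>F n in sequentially. nrm (\<lambda>x. G l x - l x)
        \<le> 1/2 * nrm (\<lambda>x. s n x - l x) + nrm (\<lambda>x. s (Suc n) x - l x)"
    proof (rule always_eventually, rule allI)
      fix n
      have "nrm (\<lambda>x. G l x - l x)
          \<le> nrm (\<lambda>x. G l x - s (Suc n) x) + nrm (\<lambda>x. s (Suc n) x - l x)"
        by (intro nrm_triangle_diff s l G)
      moreover have "nrm (\<lambda>x. G l x - s (Suc n) x) \<le> 1/2 * nrm (\<lambda>x. l x - s n x)"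
        unfolding s_Suc using contr[OF l s] .
      ultimately show "nrm (\<lambda>x. G l x - l x)
          \<le> 1/2 * nrm (\<lambda>x. s n x - l x) + nrm (\<lambda>x. s (Suc n) x - l x)"
        using nrm_diff_commute[OF l s, of n] by linarith
    qed
  qed simp
  then show ?thesis using l nrm_nonneg[OF diff_mem[OF G[OF l] l]] by (intro bexI[OF _ l]) linarith
qed

lemma bounded_form_right:
  assumes B: "bounded_form B" and v: "v \<in> S"
  shows "bounded_functional (\<lambda>u. B u v)"
proof -
  obtain K where "\<forall>u\<in>S. \<forall>v\<in>S. \<bar>B u v\<bar> \<le> K * nrm u * nrm v"
    using B unfolding bounded_form_def by blast
  then have "\<forall>u\<in>S. \<bar>B u v\<bar> \<le> (K * nrm v) * nrm u" using v by (simp add: mult_ac)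
  then show ?thesis using B v unfolding bounded_functional_def bounded_form_def by blast
qed

lemma bounded_form_left:
  assumes B: "bounded_form B" and v: "v \<in> S"
  shows "bounded_functional (B v)"
proof -
  obtain K where "\<forall>u\<in>S. \<forall>v\<in>S. \<bar>B u v\<bar> \<le> K * nrm u * nrm v"
    using B unfolding bounded_form_def by blast
  then have "\<forall>u\<in>S. \<bar>B v u\<bar> \<le> (K * nrm v) * nrm u" using v by blast
  then show ?thesis using B v unfolding bounded_functional_def bounded_form_def by blast
qed

lemma bounded_functional_lincomb:
  assumes f: "bounded_functional f" and g: "bounded_functional g"
  shows "bounded_functional (\<lambda>u. a * f u + b * g u)"
proof -
  obtain M where M: "\<And>u. u \<in> S \<Longrightarrow> \<bar>f u\<bar> \<le> M * nrm u"
    using bounded_functional_bound[OF f] by blast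
  obtain M' where M': "\<And>u. u \<in> S \<Longrightarrow> \<bar>g u\<bar> \<le> M' * nrm u"
    using bounded_functional_bound[OF g] by blast
  have "\<bar>a * f u + b * g u\<bar> \<le> (\<bar>a\<bar> * M + \<bar>b\<bar> * M') * nrm u" if u: "u \<in> S" for u
  proof -
    have "\<bar>a * f u + b * g u\<bar> \<le> \<bar>a\<bar> * \<bar>f u\<bar> + \<bar>b\<bar> * \<bar>g u\<bar>"
      using abs_triangle_ineq[of "a * f u" "b * g u"] by (simp add: abs_mult)
    also have "\<dots> \<le> \<bar>a\<bar> * (M * nrm u) + \<bar>b\<bar> * (M' * nrm u)"
      by (intro add_mono mult_left_mono M[OF u] M'[OF u]) auto
    finally show ?thesis by (simp add: algebra_simps)
  qed
  then have "\<exists>K. \<forall>u\<in>S. \<bar>a * f u + b * g u\<bar> \<le> K * nrm u" by blast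
  moreover have "\<forall>u\<in>S. \<forall>v\<in>S. a * f (\<lambda>x. u x + v x) + b * g (\<lambda>x. u x + v x)
      = a * f u + b * g u + (a * f v + b * g v)"
    using f g unfolding bounded_functional_def by (simp add: algebra_simps)
  moreover have "\<forall>c. \<forall>u\<in>S. a * f (\<lambda>x. c * u x) + b * g (\<lambda>x. c * u x) = c * (a * f u + b * g u)"
    using f g unfolding bounded_functional_def by (simp add: algebra_simps)
  ultimately show ?thesis unfolding bounded_functional_def by blast
qed

lemma bounded_form_ip: "bounded_form ip"
  unfolding bounded_form_def
  using ip_add_left ip_add_right ip_scale_left ip_scale_right Cauchy_Schwarz
  by (auto intro!: exI[of _ 1])

text \<open>
  Method of continuity for the adjoint equation. For \<open>t = 0\<close> it is the Riesz representation. If it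
  is solvable for some \<open>t\<close>, then for \<open>s\<close> near \<open>t\<close> it becomes a fixed point equation, which is a contraction
  as soon as \<open>\<bar>s - t\<bar> C K \<le> 1/2\<close> for the bound \<open>K\<close> of \<open>B\<close>; as \<open>C\<close> does not depend on \<open>t\<close>, finitely
  many steps reach \<open>t = 1\<close>.

  The equation itself follows by transposition. For uniqueness test it with the solution of
  the adjoint equation whose right-hand side is the inner product with \<open>u\<close>. For existence let \<open>T h\<close> be the
  adjoint solution with the inner product with \<open>h\<close> on the right; the functional \<open>h \<mapsto> f (T h)\<close> is
  represented by some \<open>u\<close>, and this \<open>u\<close> solves the equation because every test function is of the
  form \<open>T h\<close> up to distance 0.
\<close>

lemma inf_sup_solvability:
  assumes B: "bounded_form B"
    and est: "\<And>t v M. \<lbrakk>0 \<le> t; t \<le> 1; v \<in> S; M \<ge> 0;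
        \<And>\<phi>. \<phi> \<in> S \<Longrightarrow> \<bar>1/2 * ip \<phi> v + t * B \<phi> v\<bar> \<le> M * nrm \<phi>\<rbrakk> \<Longrightarrow> nrm v \<le> C * M"
  shows "(\<forall>f. bounded_functional f \<longrightarrow> (\<exists>u\<in>S. \<forall>\<phi>\<in>S. 1/2 * ip u \<phi> + B u \<phi> = f \<phi>)) \<and>
         (\<forall>u\<in>S. (\<forall>\<phi>\<in>S. 1/2 * ip u \<phi> + B u \<phi> = 0) \<longrightarrow> ip u u = 0)"
proof -
  define E where "E t \<phi> v = 1/2 * ip \<phi> v + t * B \<phi> v" for t \<phi> v
  have E_right: "bounded_functional (\<lambda>u. E t u v)" if "v \<in> S" for t v
    unfolding E_def by (intro bounded_functional_lincomb bounded_form_right B bounded_form_ip that)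
  have E_left: "bounded_functional (E t v)" if "v \<in> S" for t v
    unfolding E_def by (intro bounded_functional_lincomb bounded_form_left B bounded_form_ip that)
  define adj where "adj t \<longleftrightarrow> (\<forall>f. bounded_functional f \<longrightarrow> (\<exists>v\<in>S. \<forall>\<phi>\<in>S. E t \<phi> v = f \<phi>))" for t
  obtain K where K: "\<forall>u\<in>S. \<forall>v\<in>S. \<bar>B u v\<bar> \<le> K * nrm u * nrm v"
    using B unfolding bounded_form_def by blast
  define K' where "K' = \<bar>K\<bar>"
  have K': "\<bar>B u v\<bar> \<le> K' * nrm u * nrm v" if "u \<in> S" "v \<in> S" for u v
  proof -
    have "K * nrm u * nrm v \<le> K' * nrm u * nrm v"
      using that by (intro mult_right_mono) (auto simp: K'_def)
    then show ?thesis using K that by force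
  qed
  define C' where "C' = \<bar>C\<bar>"
  have est': "nrm v \<le> C' * M" if "0 \<le> t" "t \<le> 1" "v \<in> S" "M \<ge> 0"
        "\<And>\<phi>. \<phi> \<in> S \<Longrightarrow> \<bar>E t \<phi> v\<bar> \<le> M * nrm \<phi>" for t v M
  proof -
    have "nrm v \<le> C * M" using est[of t v M] that unfolding E_def by blast
    also have "\<dots> \<le> C' * M" using that(4) by (intro mult_right_mono) (auto simp: C'_def)
    finally show ?thesis .
  qed
  have adj0: "adj 0"
    unfolding adj_def
  proof (intro allI impI)
    fix f assume f: "bounded_functional f"
    obtain v where v: "v \<in> S" "\<forall>w\<in>S. ip v w = 2 * f w + 0 * f w"
      using Riesz_representation[OF bounded_functional_lincomb[OF f f, of 2 0]] by blast
    have "E 0 \<phi> v = f \<phi>" if "\<phi> \<in> S" for \<phi>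
      using v(2) that ip_commute[of \<phi> v] by (simp add: E_def)
    then show "\<exists>v\<in>S. \<forall>\<phi>\<in>S. E 0 \<phi> v = f \<phi>" using v(1) by blast
  qed
  have step: "adj s" if t: "0 \<le> t" "t \<le> 1" "adj t" and small: "\<bar>s - t\<bar> * (C' * K') \<le> 1/2" for s t
    unfolding adj_def
  proof (intro allI impI)
    fix f assume f: "bounded_functional f"
    define G where "G u = (SOME v. v \<in> S \<and> (\<forall>\<phi>\<in>S. E t \<phi> v = f \<phi> - (s - t) * B \<phi> u))" for u
    have G: "G u \<in> S \<and> (\<forall>\<phi>\<in>S. E t \<phi> (G u) = f \<phi> - (s - t) * B \<phi> u)" if u: "u \<in> S" for u
    proof -
      have "bounded_functional (\<lambda>\<phi>. f \<phi> - (s - t) * B \<phi> u)"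
        using bounded_functional_lincomb[OF f bounded_form_right[OF B u], of 1 "- (s - t)"]
        by (simp add: algebra_simps)
      then have "\<exists>v. v \<in> S \<and> (\<forall>\<phi>\<in>S. E t \<phi> v = f \<phi> - (s - t) * B \<phi> u)"
        using t(3) unfolding adj_def by blast
      then show ?thesis unfolding G_def by (rule someI_ex)
    qed
    have "\<exists>l\<in>S. nrm (\<lambda>x. G l x - l x) = 0"
    proof (rule contraction_fixed_point)
      show "G u \<in> S" if "u \<in> S" for u using G[OF that] by blast
      fix u v assume uv: "u \<in> S" "v \<in> S"
      have d: "(\<lambda>x. u x - v x) \<in> S" using uv by (rule diff_mem)
      have "nrm (\<lambda>x. G u x - G v x) \<le> C' * (\<bar>s - t\<bar> * K' * nrm (\<lambda>x. u x - v x))"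
      proof (rule est'[OF t(1,2)])
        show "(\<lambda>x. G u x - G v x) \<in> S" using G uv by (intro diff_mem) blast+
        show "0 \<le> \<bar>s - t\<bar> * K' * nrm (\<lambda>x. u x - v x)" using nrm_nonneg[OF d] by (simp add: K'_def)
        fix \<phi> assume \<phi>: "\<phi> \<in> S"
        have "E t \<phi> (\<lambda>x. G u x - G v x) = E t \<phi> (G u) - E t \<phi> (G v)"
          using G uv by (intro bounded_functional_diff E_left \<phi>) blast+
        also have "\<dots> = - (s - t) * (B \<phi> u - B \<phi> v)"
        proof -
          have "E t \<phi> (G u) = f \<phi> - (s - t) * B \<phi> u" "E t \<phi> (G v) = f \<phi> - (s - t) * B \<phi> v"
            using G uv \<phi> by blast+
          then show ?thesis by (simp only:) (simp add: algebra_simps)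
        qed
        also have "B \<phi> u - B \<phi> v = B \<phi> (\<lambda>x. u x - v x)"
          using bounded_functional_diff[OF bounded_form_left[OF B \<phi>] uv] by simp
        finally have "\<bar>E t \<phi> (\<lambda>x. G u x - G v x)\<bar> = \<bar>s - t\<bar> * \<bar>B \<phi> (\<lambda>x. u x - v x)\<bar>"
          by (simp add: abs_mult abs_minus_commute)
        also have "\<dots> \<le> \<bar>s - t\<bar> * (K' * nrm \<phi> * nrm (\<lambda>x. u x - v x))"
          by (intro mult_left_mono K'[OF \<phi> d]) auto
        finally show "\<bar>E t \<phi> (\<lambda>x. G u x - G v x)\<bar> \<le> \<bar>s - t\<bar> * K' * nrm (\<lambda>x. u x - v x) * nrm \<phi>"
          by (simp add: mult_ac)
      qed
      also have "\<dots> = \<bar>s - t\<bar> * (C' * K') * nrm (\<lambda>x. u x - v x)" by (simp add: mult_ac)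
      also have "\<dots> \<le> 1/2 * nrm (\<lambda>x. u x - v x)"
        by (intro mult_right_mono small nrm_nonneg d)
      finally show "nrm (\<lambda>x. G u x - G v x) \<le> 1/2 * nrm (\<lambda>x. u x - v x)" .
    qed
    then obtain l where l: "l \<in> S" and fix_l: "nrm (\<lambda>x. G l x - l x) = 0" by blast
    show "\<exists>v\<in>S. \<forall>\<phi>\<in>S. E s \<phi> v = f \<phi>"
    proof (intro bexI[OF _ l] ballI)
      fix \<phi> assume \<phi>: "\<phi> \<in> S"
      have "E t \<phi> (G l) = E t \<phi> l"
        by (rule functional_null[OF E_left[OF \<phi>] _ l fix_l]) (use G l in blast)
      then have "E t \<phi> l = f \<phi> - (s - t) * B \<phi> l" using G l \<phi> by simp
      then show "E s \<phi> l = f \<phi>" by (simp add: E_def algebra_simps)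
    qed
  qed
  obtain n :: nat where n: "2 * (C' * K') + 1 < real n" using reals_Archimedean2 by blast
  have CK: "C' * K' \<ge> 0" by (simp add: C'_def K'_def)
  then have n0: "n > 0" using n by (cases n) auto
  have adj_i: "adj (real i / real n)" if "i \<le> n" for i
    using that
  proof (induction i)
    case 0 then show ?case using adj0 by simp
  next
    case (Suc i)
    show ?case
    proof (rule step)
      show "0 \<le> real i / real n" by simp
      show "real i / real n \<le> 1" using Suc n0 by simp
      show "adj (real i / real n)" using Suc by simp
      have "\<bar>real (Suc i) / real n - real i / real n\<bar> = 1 / real n"
        by (simp add: diff_divide_distrib[symmetric])
      then show "\<bar>real (Suc i) / real n - real i / real n\<bar> * (C' * K') \<le> 1/2"
        using n n0 by (simp add: field_simps)
    qed
  qed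
  have adj1: "adj 1" using adj_i[of n] n0 by simp
  have E1: "1/2 * ip u \<phi> + B u \<phi> = E 1 u \<phi>" for u \<phi> by (simp add: E_def)
  have uniq: "ip u u = 0" if u: "u \<in> S" and 0: "\<forall>\<phi>\<in>S. E 1 u \<phi> = 0" for u
  proof -
    obtain v where "v \<in> S" "\<forall>\<phi>\<in>S. E 1 \<phi> v = ip \<phi> u"
      using adj1 bounded_form_right[OF bounded_form_ip u] unfolding adj_def by blast
    then show ?thesis using 0 u by force
  qed
  have ex: "\<exists>u\<in>S. \<forall>\<phi>\<in>S. E 1 u \<phi> = f \<phi>" if f: "bounded_functional f" for f
  proof -
    define T where "T h = (SOME v. v \<in> S \<and> (\<forall>\<phi>\<in>S. E 1 \<phi> v = ip \<phi> h))" for h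
    have T: "T h \<in> S \<and> (\<forall>\<phi>\<in>S. E 1 \<phi> (T h) = ip \<phi> h)" if h: "h \<in> S" for h
    proof -
      have "\<exists>v. v \<in> S \<and> (\<forall>\<phi>\<in>S. E 1 \<phi> v = ip \<phi> h)"
        using adj1 bounded_form_right[OF bounded_form_ip h] unfolding adj_def by blast
      then show ?thesis unfolding T_def by (rule someI_ex)
    qed
    (* the adjoint solution is unique up to null elements, which f does not see *)
    have T_unique: "f w = f (T h)" if "h \<in> S" "w \<in> S" "\<forall>\<phi>\<in>S. E 1 \<phi> w = ip \<phi> h" for h w
    proof (rule functional_null[OF f that(2)])
      show Th: "T h \<in> S" using T[OF that(1)] by blast
      have d: "(\<lambda>x. w x - T h x) \<in> S" using that(2) Th by (rule diff_mem)
      have "nrm (\<lambda>x. w x - T h x) \<le> C' * 0"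
      proof (rule est'[of 1])
        fix \<phi> assume \<phi>: "\<phi> \<in> S"
        have "E 1 \<phi> (\<lambda>x. w x - T h x) = E 1 \<phi> w - E 1 \<phi> (T h)"
          by (rule bounded_functional_diff[OF E_left[OF \<phi>] that(2) Th])
        then show "\<bar>E 1 \<phi> (\<lambda>x. w x - T h x)\<bar> \<le> 0 * nrm \<phi>"
          using that T[OF that(1)] \<phi> by simp
      qed (use d in auto)
      then show "nrm (\<lambda>x. w x - T h x) = 0" using nrm_nonneg[OF d] by simp
    qed
    obtain M where M0: "M \<ge> 0" and M: "\<And>u. u \<in> S \<Longrightarrow> \<bar>f u\<bar> \<le> M * nrm u"
      using bounded_functional_bound[OF f] by blast
    have "bounded_functional (\<lambda>h. f (T h))"
      unfolding bounded_functional_def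
    proof (intro conjI ballI allI exI)
      fix h k assume hk: "h \<in> S" "k \<in> S"
      have "f (\<lambda>x. T h x + T k x) = f (T (\<lambda>x. h x + k x))"
      proof (rule T_unique[OF add_mem[OF hk]])
        show "(\<lambda>x. T h x + T k x) \<in> S" using T hk by (intro add_mem) blast+
        show "\<forall>\<phi>\<in>S. E 1 \<phi> (\<lambda>x. T h x + T k x) = ip \<phi> (\<lambda>x. h x + k x)"
        proof
          fix \<phi> assume \<phi>: "\<phi> \<in> S"
          have "E 1 \<phi> (\<lambda>x. T h x + T k x) = E 1 \<phi> (T h) + E 1 \<phi> (T k)"
            using E_left[OF \<phi>, of 1] T hk unfolding bounded_functional_def by blast
          then show "E 1 \<phi> (\<lambda>x. T h x + T k x) = ip \<phi> (\<lambda>x. h x + k x)"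
            using T hk \<phi> by (simp add: ip_add_right)
        qed
      qed
      then show "f (T (\<lambda>x. h x + k x)) = f (T h) + f (T k)"
        using f T hk unfolding bounded_functional_def by metis
    next
      fix c h assume h: "h \<in> S"
      have "f (\<lambda>x. c * T h x) = f (T (\<lambda>x. c * h x))"
      proof (rule T_unique[OF scale_mem[OF h]])
        show "(\<lambda>x. c * T h x) \<in> S" using T h by (intro scale_mem) blast
        show "\<forall>\<phi>\<in>S. E 1 \<phi> (\<lambda>x. c * T h x) = ip \<phi> (\<lambda>x. c * h x)"
        proof
          fix \<phi> assume \<phi>: "\<phi> \<in> S"
          have "E 1 \<phi> (\<lambda>x. c * T h x) = c * E 1 \<phi> (T h)"
            using E_left[OF \<phi>, of 1] T h unfolding bounded_functional_def by blast
          then show "E 1 \<phi> (\<lambda>x. c * T h x) = ip \<phi> (\<lambda>x. c * h x)"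
            using T h \<phi> by (simp add: ip_scale_right)
        qed
      qed
      then show "f (T (\<lambda>x. c * h x)) = c * f (T h)"
        using f T h unfolding bounded_functional_def by metis
    next
      fix h assume h: "h \<in> S"
      have "nrm (T h) \<le> C' * nrm h"
      proof (rule est'[of 1])
        show "T h \<in> S" using T[OF h] by blast
        fix \<phi> assume \<phi>: "\<phi> \<in> S"
        show "\<bar>E 1 \<phi> (T h)\<bar> \<le> nrm h * nrm \<phi>"
          using T[OF h] \<phi> Cauchy_Schwarz[OF \<phi> h] by (simp add: mult.commute)
      qed (use h in auto)
      then have "M * nrm (T h) \<le> M * (C' * nrm h)" using M0 by (intro mult_left_mono)
      then show "\<bar>f (T h)\<bar> \<le> (M * C') * nrm h" using M[of "T h"] T[OF h] by (simp add: mult_ac)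
    qed
    from Riesz_representation[OF this] obtain u where u: "u \<in> S" "\<forall>h\<in>S. ip u h = f (T h)" by blast
    show ?thesis
    proof (intro bexI[OF _ u(1)] ballI)
      fix \<phi> assume \<phi>: "\<phi> \<in> S"
      obtain h where h: "h \<in> S" "\<forall>w\<in>S. ip h w = E 1 w \<phi>"
        using Riesz_representation[OF E_right[OF \<phi>, of 1]] by blast
      have "f \<phi> = f (T h)" by (rule T_unique[OF h(1) \<phi>]) (use h ip_commute in metis)
      then show "E 1 u \<phi> = f \<phi>" using u h ip_commute by metis
    qed
  qed
  show ?thesis unfolding E1 using uniq ex by blast
qed

end

section \<open>Square integrable functions\<close>

definition sq_integrable :: "'a measure \<Rightarrow> ('a \<Rightarrow> real) set" where
  "sq_integrable M = {f \<in> borel_measurable M. integrable M (\<lambda>x. (f x)\<^sup>2)}"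

lemma sq_integrable_measurable: "f \<in> sq_integrable M \<Longrightarrow> f \<in> borel_measurable M"
  by (simp add: sq_integrable_def)

lemma sq_integrable_iff_nn_integral:
  "f \<in> sq_integrable M \<longleftrightarrow> f \<in> borel_measurable M \<and> (\<integral>\<^sup>+x. ennreal ((f x)\<^sup>2) \<partial>M) < \<infinity>"
  by (auto simp: sq_integrable_def integrable_iff_bounded)

lemma sq_integrable_nn_integral:
  "f \<in> sq_integrable M \<Longrightarrow> (\<integral>\<^sup>+x. ennreal ((f x)\<^sup>2) \<partial>M) = ennreal (\<integral>x. (f x)\<^sup>2 \<partial>M)"
  by (simp add: sq_integrable_def nn_integral_eq_integral)

lemma integrable_mult_sq_integrable:
  assumes f: "f \<in> sq_integrable M" and g: "g \<in> sq_integrable M"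
  shows "integrable M (\<lambda>x. f x * g x)"
proof (rule Bochner_Integration.integrable_bound)
  show "integrable M (\<lambda>x. (f x)\<^sup>2 + (g x)\<^sup>2)" using f g by (simp add: sq_integrable_def)
  show "(\<lambda>x. f x * g x) \<in> borel_measurable M"
    using f g by (intro borel_measurable_times) (auto simp: sq_integrable_def)
  have "\<bar>p * q\<bar> \<le> p\<^sup>2 + q\<^sup>2" for p q :: real
  proof -
    have "0 \<le> (\<bar>p\<bar> - \<bar>q\<bar>)\<^sup>2" by simp
    then have "2 * (\<bar>p\<bar> * \<bar>q\<bar>) \<le> p\<^sup>2 + q\<^sup>2" by (simp add: power2_diff)
    moreover have "0 \<le> \<bar>p\<bar> * \<bar>q\<bar>" by simp
    ultimately show ?thesis by (simp only: abs_mult)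
  qed
  then show "AE x in M. norm (f x * g x) \<le> norm ((f x)\<^sup>2 + (g x)\<^sup>2)" by simp
qed

lemma sq_integrable_add:
  assumes f: "f \<in> sq_integrable M" and g: "g \<in> sq_integrable M"
  shows "(\<lambda>x. f x + g x) \<in> sq_integrable M"
  using f g integrable_mult_sq_integrable[OF f g]
  by (auto simp: sq_integrable_def power2_sum mult.assoc)

lemma sq_integrable_scale: "f \<in> sq_integrable M \<Longrightarrow> (\<lambda>x. c * f x) \<in> sq_integrable M"
  by (auto simp: sq_integrable_def power_mult_distrib)

lemma sq_integrable_bound:
  assumes f: "f \<in> sq_integrable M" and g: "g \<in> borel_measurable M" and le: "AE x in M. \<bar>g x\<bar> \<le> C * \<bar>f x\<bar>"
  shows "g \<in> sq_integrable M"
proof -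
  have "integrable M (\<lambda>x. (g x)\<^sup>2)"
  proof (rule Bochner_Integration.integrable_bound)
    show "integrable M (\<lambda>x. C\<^sup>2 * (f x)\<^sup>2)" using f by (simp add: sq_integrable_def)
    show "AE x in M. norm ((g x)\<^sup>2) \<le> norm (C\<^sup>2 * (f x)\<^sup>2)"
      using le
    proof eventually_elim
      case (elim x)
      then have "\<bar>g x\<bar>\<^sup>2 \<le> (C * \<bar>f x\<bar>)\<^sup>2" by (intro power_mono) auto
      then show ?case by (simp add: power_mult_distrib)
    qed
  qed (use g in measurable)
  then show ?thesis using g by (simp add: sq_integrable_def)
qed

interpretation L2: function_inner_product_space "sq_integrable M" "\<lambda>f g. \<integral>x. f x * g x \<partial>M" for M
proof
  show "(\<lambda>_. 0) \<in> sq_integrable M" by (simp add: sq_integrable_def)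
next
  fix u v w :: "'a \<Rightarrow> real" assume "u \<in> sq_integrable M" "v \<in> sq_integrable M" "w \<in> sq_integrable M"
  then show "(\<integral>x. (u x + v x) * w x \<partial>M) = (\<integral>x. u x * w x \<partial>M) + (\<integral>x. v x * w x \<partial>M)"
    by (simp add: distrib_right integrable_mult_sq_integrable)
next
  fix u w :: "'a \<Rightarrow> real" and c assume "u \<in> sq_integrable M" "w \<in> sq_integrable M"
  show "(\<integral>x. (c * u x) * w x \<partial>M) = c * (\<integral>x. u x * w x \<partial>M)" by (simp add: mult.assoc)
qed (auto simp: sq_integrable_add sq_integrable_scale mult.commute)

lemma L2_Cauchy_Schwarz:
  assumes "f \<in> sq_integrable M" "g \<in> sq_integrable M"
  shows "\<bar>\<integral>x. f x * g x \<partial>M\<bar> \<le> sqrt (\<integral>x. (f x)\<^sup>2 \<partial>M) * sqrt (\<integral>x. (g x)\<^sup>2 \<partial>M)"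
  using L2.Cauchy_Schwarz[OF assms] by (simp add: L2.nrm_def power2_eq_square)

text \<open>
  Fatou's lemma; it makes the norms involved lower semicontinuous under almost everywhere convergence.
\<close>

lemma square_integral_limit_le:
  fixes f :: "nat \<Rightarrow> 'a \<Rightarrow> real"
  assumes f: "\<And>k. f k \<in> borel_measurable M"
    and lim: "AE x in M. (\<lambda>k. f k x) \<longlonglongrightarrow> g x"
    and le: "\<forall>\<^sub>F k in sequentially. (\<integral>\<^sup>+x. ennreal ((f k x)\<^sup>2) \<partial>M) \<le> e"
  shows "(\<integral>\<^sup>+x. ennreal ((g x)\<^sup>2) \<partial>M) \<le> e"
proof -
  have "(\<integral>\<^sup>+x. ennreal ((g x)\<^sup>2) \<partial>M) = (\<integral>\<^sup>+x. liminf (\<lambda>k. ennreal ((f k x)\<^sup>2)) \<partial>M)"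
  proof (rule nn_integral_cong_AE, use lim in eventually_elim)
    fix x assume "(\<lambda>k. f k x) \<longlonglongrightarrow> g x"
    then have "(\<lambda>k. ennreal ((f k x)\<^sup>2)) \<longlonglongrightarrow> ennreal ((g x)\<^sup>2)"
      by (intro tendsto_ennrealI tendsto_power)
    then show "ennreal ((g x)\<^sup>2) = liminf (\<lambda>k. ennreal ((f k x)\<^sup>2))"
      by (metis lim_imp_Liminf sequentially_bot)
  qed
  also have "\<dots> \<le> liminf (\<lambda>k. \<integral>\<^sup>+x. ennreal ((f k x)\<^sup>2) \<partial>M)"
    by (rule nn_integral_liminf) (use f in measurable)
  also have "\<dots> \<le> limsup (\<lambda>k. \<integral>\<^sup>+x. ennreal ((f k x)\<^sup>2) \<partial>M)"
    by (rule Liminf_le_Limsup) simp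
  also have "\<dots> \<le> e" by (rule Limsup_bounded[OF le])
  finally show ?thesis .
qed

text \<open>
  The squares of \<open>2^k (f (Suc k) - f k)\<close> still have a finite sum of integrals, hence a finite sum almost
  everywhere. So at almost every point the differences are dominated by a geometric series.
\<close>

lemma AE_convergent_of_summable_squares:
  fixes f :: "nat \<Rightarrow> 'a \<Rightarrow> real"
  assumes f: "\<And>k. f k \<in> borel_measurable M"
    and le: "\<And>k. (\<integral>\<^sup>+x. ennreal ((f (Suc k) x - f k x)\<^sup>2) \<partial>M) \<le> ennreal (C * (1/16)^k)"
    and C: "C \<ge> 0"
  shows "AE x in M. convergent (\<lambda>k. f k x)"
proof -
  define w where "w k x = 2^k * (f (Suc k) x - f k x)" for k x
  have wm [measurable]: "w k \<in> borel_measurable M" for k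
    unfolding w_def using f by measurable
  have "(\<integral>\<^sup>+x. ennreal ((w k x)\<^sup>2) \<partial>M) \<le> ennreal (C * (1/4)^k)" for k
  proof -
    have p4: "((2::real)^k)\<^sup>2 = 4^k" by (simp add: power2_eq_square power_mult_distrib[symmetric])
    have "(\<integral>\<^sup>+x. ennreal ((w k x)\<^sup>2) \<partial>M)
        = (\<integral>\<^sup>+x. ennreal (4^k) * ennreal ((f (Suc k) x - f k x)\<^sup>2) \<partial>M)"
      by (simp add: w_def power_mult_distrib p4 ennreal_mult)
    also have "\<dots> = ennreal (4^k) * (\<integral>\<^sup>+x. ennreal ((f (Suc k) x - f k x)\<^sup>2) \<partial>M)"
      by (rule nn_integral_cmult) (use f in measurable)
    also have "\<dots> \<le> ennreal (4^k) * ennreal (C * (1/16)^k)" by (rule mult_left_mono[OF le]) simp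
    also have "\<dots> = ennreal (4^k * (C * (1/16)^k))" by (subst ennreal_mult) (use C in auto)
    also have "4^k * (C * (1/16)^k) = C * (4 * (1/16))^k"
      unfolding power_mult_distrib by (simp only: mult_ac)
    also have "4 * (1/16) = (1/4 :: real)" by simp
    finally show ?thesis .
  qed
  then have "(\<integral>\<^sup>+x. (\<Sum>k. ennreal ((w k x)\<^sup>2)) \<partial>M) \<le> (\<Sum>k. ennreal (C * (1/4)^k))"
    by (subst nn_integral_suminf) (auto intro!: suminf_le)
  also have "\<dots> < \<infinity>"
    using C by (subst suminf_ennreal2) (auto intro!: summable_mult summable_geometric simp: ennreal_less_top)
  finally have "(\<integral>\<^sup>+x. (\<Sum>k. ennreal ((w k x)\<^sup>2)) \<partial>M) \<noteq> \<infinity>" by simp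
  then have "AE x in M. (\<Sum>k. ennreal ((w k x)\<^sup>2)) \<noteq> \<infinity>"
    by (intro nn_integral_PInf_AE) auto
  then show ?thesis
  proof eventually_elim
    case (elim x)
    then have "(\<Sum>k. ennreal ((w k x)\<^sup>2)) = ennreal (enn2real (\<Sum>k. ennreal ((w k x)\<^sup>2)))"
      by (simp only: ennreal_enn2real_if if_False infinity_ennreal_def)
    then obtain m where m: "(\<Sum>k. ennreal ((w k x)\<^sup>2)) = ennreal m" "m \<ge> 0"
      using enn2real_nonneg by blast
    have wb: "\<bar>w k x\<bar> \<le> sqrt m" for k
    proof -
      have "(\<Sum>i\<in>{k}. ennreal ((w i x)\<^sup>2)) \<le> (\<Sum>k. ennreal ((w k x)\<^sup>2))"
        by (intro sum_le_suminf summableI) auto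
      then have "ennreal ((w k x)\<^sup>2) \<le> ennreal m" unfolding m(1) by simp
      then have "(w k x)\<^sup>2 \<le> m" using ennreal_le_iff[OF m(2)] by blast
      then show ?thesis using real_le_rsqrt[of "\<bar>w k x\<bar>" m] by simp
    qed
    have bnd: "norm (f (Suc k) x - f k x) \<le> sqrt m * (1/2)^k" for k
    proof -
      have "2^k * \<bar>f (Suc k) x - f k x\<bar> \<le> sqrt m" using wb[of k] by (simp add: w_def abs_mult)
      then have "\<bar>f (Suc k) x - f k x\<bar> \<le> sqrt m / 2^k"
        by (subst pos_le_divide_eq) (simp_all add: mult.commute)
      then show ?thesis by (simp add: power_one_over)
    qed
    have "summable (\<lambda>k. sqrt m * (1/2)^k)" by (intro summable_mult summable_geometric) simp
    then have "summable (\<lambda>k. f (Suc k) x - f k x)"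
      using bnd by (rule summable_comparison_test')
    then have "convergent (\<lambda>n. \<Sum>k<n. f (Suc k) x - f k x)"
      by (simp add: summable_iff_convergent)
    then have "convergent (\<lambda>n. f n x - f 0 x)"
      by (simp add: sum_lessThan_telescope[of "\<lambda>k. f k x"])
    from convergent_add[OF this convergent_const[of "f 0 x"]] show ?case by simp
  qed
qed

lemma sq_integral_add_le:
  assumes "f \<in> sq_integrable M" "g \<in> sq_integrable M"
  shows "(\<integral>x. (f x + g x)\<^sup>2 \<partial>M) \<le> 2 * (\<integral>x. (f x)\<^sup>2 \<partial>M) + 2 * (\<integral>x. (g x)\<^sup>2 \<partial>M)"
proof -
  have i: "integrable M (\<lambda>x. (f x)\<^sup>2)" "integrable M (\<lambda>x. (g x)\<^sup>2)" "integrable M (\<lambda>x. (f x + g x)\<^sup>2)"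
    using assms sq_integrable_add[OF assms] by (auto simp: sq_integrable_def)
  have "(\<integral>x. (f x + g x)\<^sup>2 \<partial>M) \<le> (\<integral>x. 2 * (f x)\<^sup>2 + 2 * (g x)\<^sup>2 \<partial>M)"
  proof (rule integral_mono[OF i(3)])
    fix x
    have "0 \<le> (f x - g x)\<^sup>2" by simp
    then show "(f x + g x)\<^sup>2 \<le> 2 * (f x)\<^sup>2 + 2 * (g x)\<^sup>2" by (simp add: power2_diff power2_sum)
  qed (use i in auto)
  then show ?thesis using i by simp
qed

section \<open>Two pointwise inequalities\<close>

text \<open>
  The integrand of the symmetrised adjoint form with test function \<open>v\<^sup>+ / (v\<^sup>+ + \<epsilon>)\<close>, at a pair of points
  where \<open>v\<close> is \<open>x\<close> and \<open>y\<close>, the symmetric kernel is \<open>j\<close> and the antisymmetric one is \<open>b\<close>. If both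
  values are positive, \<open>x + y = \<bar>x - y\<bar> + 2 min x y\<close>. The first part is absorbed by \<open>j\<close> since
  \<open>\<bar>b\<bar> \<le> (1 - \<theta>) j\<close>. In the second one \<open>(min x y)\<^sup>2 \<le> (x + \<epsilon>) (y + \<epsilon>)\<close>, so that Young's inequality
  leaves a loss \<open>b\<^sup>2 / j\<close> with a factor that carries the same power of \<open>\<epsilon>\<close> as the main term. If one
  value is not positive, then \<open>j \<plusminus> t b \<ge> 0\<close> shows that it contributes with the right sign.
\<close>

lemma quotient_pointwise_bound:
  fixes x y j b \<theta> t \<epsilon> :: real
  assumes \<theta>: "0 < \<theta>" "\<theta> \<le> 1" and j: "0 \<le> j" and b: "\<bar>b\<bar> \<le> (1 - \<theta>) * j" and t: "0 \<le> t" "t \<le> 1"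
    and \<epsilon>: "0 < \<epsilon>"
  defines "p \<equiv> max x 0" and "q \<equiv> max y 0"
  shows "\<epsilon> * (\<theta> / 2 * ((p - q)\<^sup>2 / ((p + \<epsilon>) * (q + \<epsilon>))) * j - 2 / \<theta> * (if x > 0 then b\<^sup>2 / j else 0))
    \<le> (p / (p + \<epsilon>) - q / (q + \<epsilon>)) * ((x - y) * j + t * (x + y) * b)"
proof -
  have tb: "\<bar>t * b\<bar> \<le> \<bar>b\<bar>" using t mult_right_mono[of t 1 "\<bar>b\<bar>"] by (simp add: abs_mult)
  have bj: "\<theta> * j \<le> j - \<bar>b\<bar>" using b by (simp add: algebra_simps)
  have \<theta>j: "0 \<le> \<theta> * j" using \<theta> j by simp
  (* the case where exactly one of the two values is positive; there is no loss term *)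
  have one: "\<epsilon> * (\<theta> / 2 * (r\<^sup>2 / ((r + \<epsilon>) * \<epsilon>)) * j) \<le> r / (r + \<epsilon>) * ((r + s) * j + (r - s) * b')"
    if r: "r > 0" and s: "s \<ge> 0" and b': "\<bar>b'\<bar> \<le> \<bar>b\<bar>" for r s b'
  proof -
    have "r * (\<theta> * j) \<le> r * (j + b')" using r bj b' by (intro mult_left_mono) auto
    also have "\<dots> \<le> r * (j + b') + s * (j - b')"
    proof -
      have "0 \<le> j - b'" using bj b' \<theta>j by linarith
      then show ?thesis using s by simp
    qed
    also have "\<dots> = (r + s) * j + (r - s) * b'" by (simp add: algebra_simps)
    finally have 1: "r * (\<theta> * j) \<le> (r + s) * j + (r - s) * b'" .
    have "0 \<le> r * (\<theta> * j)" using r \<theta>j by simp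
    then have "r * (\<theta> * j) / 2 \<le> (r + s) * j + (r - s) * b'" using 1 by linarith
    then have "r / (r + \<epsilon>) * (r * (\<theta> * j) / 2) \<le> r / (r + \<epsilon>) * ((r + s) * j + (r - s) * b')"
      using r \<epsilon> by (intro mult_left_mono) auto
    moreover have "\<epsilon> * (\<theta> / 2 * (r\<^sup>2 / ((r + \<epsilon>) * \<epsilon>)) * j) = r / (r + \<epsilon>) * (r * (\<theta> * j) / 2)"
    proof -
      have "r + \<epsilon> \<noteq> 0" "\<epsilon> \<noteq> 0" using r \<epsilon> by auto
      then show ?thesis by (simp add: divide_simps power2_eq_square)
    qed
    ultimately show ?thesis by simp
  qed
  consider "x \<le> 0" "y \<le> 0" | "x > 0" "y \<le> 0" | "x \<le> 0" "y > 0" | "x > 0" "y > 0" by linarith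
  then show ?thesis
  proof cases
    case 1 then show ?thesis by (simp add: p_def q_def)
  next
    case 2
    have "0 \<le> 2 / \<theta> * (b\<^sup>2 / j)" using \<theta> j by simp
    then have "\<epsilon> * (\<theta> / 2 * ((p - q)\<^sup>2 / ((p + \<epsilon>) * (q + \<epsilon>))) * j - 2 / \<theta> * (if x > 0 then b\<^sup>2 / j else 0))
        \<le> \<epsilon> * (\<theta> / 2 * (x\<^sup>2 / ((x + \<epsilon>) * \<epsilon>)) * j)"
      using 2 \<epsilon> by (intro mult_left_mono) (auto simp: p_def q_def)
    also have "\<dots> \<le> x / (x + \<epsilon>) * ((x + - y) * j + (x - - y) * (t * b))"
      using 2 tb by (intro one) auto
    finally show ?thesis using 2 by (simp add: p_def q_def mult_ac)
  next
    case 3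
    have "\<epsilon> * (\<theta> / 2 * (y\<^sup>2 / ((y + \<epsilon>) * \<epsilon>)) * j)
        \<le> y / (y + \<epsilon>) * ((y + - x) * j + (y - - x) * (- (t * b)))"
      using 3 tb by (intro one) auto
    also have "\<dots> = (p / (p + \<epsilon>) - q / (q + \<epsilon>)) * ((x - y) * j + t * (x + y) * b)"
    proof -
      define W where "W = (x - y) * j + t * (x + y) * b"
      have "(y + - x) * j + (y - - x) * (- (t * b)) = - W"
        by (simp add: W_def algebra_simps)
      moreover have "p = 0" "q = y" using 3 by (simp_all add: p_def q_def)
      ultimately show ?thesis unfolding W_def[symmetric] by simp
    qed
    finally show ?thesis using 3 by (simp add: p_def q_def mult.commute)
  next
    case 4
    show ?thesis
    proof (cases "j = 0")
      case True
      then show ?thesis using b by simp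
    next
      case False
      then have jp: "j > 0" using j by simp
      define d where "d = (x + \<epsilon>) * (y + \<epsilon>)"
      have d: "d > 0" using 4 \<epsilon> by (simp add: d_def)
      define e where "e = \<bar>x - y\<bar>"
      define m where "m = min x y"
      have sum: "x + y = e + 2 * m" by (simp add: e_def m_def abs_if min_def)
      have m0: "0 \<le> m" using 4 by (simp add: m_def)
      have "m\<^sup>2 \<le> x * y"
        unfolding power2_eq_square m_def using 4 by (intro mult_mono) auto
      also have "\<dots> \<le> d" unfolding d_def using 4 \<epsilon> by (intro mult_mono) auto
      finally have md: "m\<^sup>2 \<le> d" .
      have e2: "e\<^sup>2 = (x - y)\<^sup>2" "0 \<le> e" by (simp_all add: e_def)
      have "\<bar>t * ((x - y) * (x + y)) * b\<bar> = \<bar>t * b\<bar> * (e * (x + y))"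
        using 4 by (simp add: abs_mult e_def)
      also have "\<dots> \<le> \<bar>b\<bar> * (e * (e + 2 * m))"
        using tb e2 m0 unfolding sum by (intro mult_right_mono) auto
      also have "\<dots> = e\<^sup>2 * \<bar>b\<bar> + 2 * e * m * \<bar>b\<bar>" by (simp add: power2_eq_square algebra_simps)
      finally have drift: "- (e\<^sup>2 * \<bar>b\<bar> + 2 * e * m * \<bar>b\<bar>) \<le> t * ((x - y) * (x + y)) * b" by linarith
      (* Young's inequality *)
      have young: "2 * e * m * \<bar>b\<bar> \<le> \<theta> / 2 * e\<^sup>2 * j + 2 / \<theta> * (m\<^sup>2 * (b\<^sup>2 / j))"
      proof -
        have "0 \<le> (\<theta> * e * j - 2 * m * \<bar>b\<bar>)\<^sup>2" by simp
        then have "4 * (\<theta> * e * j * (m * \<bar>b\<bar>)) \<le> \<theta>\<^sup>2 * e\<^sup>2 * j\<^sup>2 + 4 * m\<^sup>2 * b\<^sup>2"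
          by (simp add: power2_diff power_mult_distrib)
        then have "4 * (\<theta> * e * j * (m * \<bar>b\<bar>)) / (2 * \<theta> * j) \<le> (\<theta>\<^sup>2 * e\<^sup>2 * j\<^sup>2 + 4 * m\<^sup>2 * b\<^sup>2) / (2 * \<theta> * j)"
          using \<theta> jp by (intro divide_right_mono) auto
        moreover have "4 * (\<theta> * e * j * (m * \<bar>b\<bar>)) / (2 * \<theta> * j) = 2 * e * m * \<bar>b\<bar>"
          using \<theta> jp by (simp add: field_simps)
        moreover have "(\<theta>\<^sup>2 * e\<^sup>2 * j\<^sup>2 + 4 * m\<^sup>2 * b\<^sup>2) / (2 * \<theta> * j)
            = \<theta> / 2 * e\<^sup>2 * j + 2 / \<theta> * (m\<^sup>2 * (b\<^sup>2 / j))"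
          using \<theta> jp by (simp add: field_simps power2_eq_square)
        ultimately show ?thesis by simp
      qed
      have "2 / \<theta> * (m\<^sup>2 * (b\<^sup>2 / j)) \<le> 2 / \<theta> * (d * (b\<^sup>2 / j))"
        using \<theta> jp md by (intro mult_left_mono mult_right_mono) auto
      moreover have "e\<^sup>2 * (\<theta> * j) \<le> e\<^sup>2 * (j - \<bar>b\<bar>)" by (rule mult_left_mono[OF bj]) simp
      ultimately have "\<theta> / 2 * e\<^sup>2 * j - 2 / \<theta> * (d * (b\<^sup>2 / j))
          \<le> e\<^sup>2 * j + t * ((x - y) * (x + y)) * b"
        using drift young by (simp add: algebra_simps)
      also have "\<dots> = (x - y) * ((x - y) * j + t * (x + y) * b)"
        unfolding e2 by (simp add: power2_eq_square algebra_simps)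
      finally have main: "\<theta> / 2 * e\<^sup>2 * j - 2 / \<theta> * (d * (b\<^sup>2 / j))
          \<le> (x - y) * ((x - y) * j + t * (x + y) * b)" .
      have "\<epsilon> * (\<theta> / 2 * ((p - q)\<^sup>2 / ((p + \<epsilon>) * (q + \<epsilon>))) * j - 2 / \<theta> * (if x > 0 then b\<^sup>2 / j else 0))
          = \<epsilon> / d * (\<theta> / 2 * e\<^sup>2 * j - 2 / \<theta> * (d * (b\<^sup>2 / j)))"
      proof -
        have "\<epsilon> / d * (\<theta> / 2 * e\<^sup>2 * j - 2 / \<theta> * (d * (b\<^sup>2 / j)))
            = \<epsilon> * (\<theta> / 2 * (e\<^sup>2 / d) * j - 2 / \<theta> * (b\<^sup>2 / j))"
          using d by (simp add: right_diff_distrib)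
        then show ?thesis using 4 by (simp add: p_def q_def e2 d_def)
      qed
      also have "\<dots> \<le> \<epsilon> / d * ((x - y) * ((x - y) * j + t * (x + y) * b))"
        using \<epsilon> d by (intro mult_left_mono[OF main]) auto
      also have "\<dots> = (\<epsilon> * (x - y) / d) * ((x - y) * j + t * (x + y) * b)" by simp
      also have "\<epsilon> * (x - y) / d = p / (p + \<epsilon>) - q / (q + \<epsilon>)"
      proof -
        have "x / (x + \<epsilon>) - y / (y + \<epsilon>) = (x * (y + \<epsilon>) - y * (x + \<epsilon>)) / d"
          unfolding d_def using 4 \<epsilon> by (intro diff_frac_eq) auto
        then show ?thesis using 4 by (simp add: p_def q_def algebra_simps)
      qed
      finally show ?thesis .
    qed
  qed
qed

text \<open>
  This is \<open>2 ln s \<le> s - 1 / s\<close> for \<open>s = sqrt (x / y) \<ge> 1\<close>. It bounds increments of the logarithm by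
  the quotient that appears in \<open>quotient_pointwise_bound\<close>.
\<close>

lemma ln_diff_sq_le:
  fixes x y :: real
  assumes "x > 0" "y > 0"
  shows "(ln x - ln y)\<^sup>2 \<le> (x - y)\<^sup>2 / (x * y)"
proof -
  have main: "(ln x - ln y)\<^sup>2 \<le> (x - y)\<^sup>2 / (x * y)" if "0 < y" "y \<le> x" for x y :: real
  proof -
    define s where "s = sqrt (x / y)"
    have s: "1 \<le> s" using that by (simp add: s_def)
    define f where "f s = s - 1 / s - 2 * ln s" for s :: real
    have "f 1 \<le> f s"
    proof (rule DERIV_nonneg_imp_nondecreasing[OF s])
      fix r :: real assume r: "1 \<le> r" "r \<le> s"
      have "(f has_real_derivative (1 + 1 / r\<^sup>2 - 2 / r)) (at r)"
        unfolding f_def using r by (auto intro!: derivative_eq_intros simp: power2_eq_square)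
      moreover have "1 + 1 / r\<^sup>2 - 2 / r = (1 - 1 / r)\<^sup>2"
        by (simp add: power2_diff power_divide)
      ultimately show "\<exists>D. (f has_real_derivative D) (at r) \<and> 0 \<le> D" by auto
    qed
    then have le: "2 * ln s \<le> s - 1 / s" by (simp add: f_def)
    have s2: "s\<^sup>2 = x / y" using that by (simp add: s_def)
    have "2 * ln s = ln (x / y)"
      using s ln_realpow[of s 2] by (simp add: s2)
    then have l: "2 * ln s = ln x - ln y" using that by (simp add: ln_div)
    have "(ln x - ln y)\<^sup>2 \<le> (s - 1 / s)\<^sup>2"
      unfolding l[symmetric] using le s by (intro power_mono) auto
    also have "\<dots> = s\<^sup>2 - 2 + 1 / s\<^sup>2" using s by (simp add: power2_diff power_divide)
    also have "\<dots> = (x - y)\<^sup>2 / (x * y)"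
      unfolding s2 using that by (simp add: field_simps power2_eq_square)
    finally show ?thesis .
  qed
  show ?thesis
    using main[of x y] main[of y x] assms
    by (cases "x \<le> y") (auto simp: power2_commute mult.commute)
qed

section \<open>The energy space of a nonlocal kernel\<close>

definition incr :: "('a \<Rightarrow> real) \<Rightarrow> 'a \<times> 'a \<Rightarrow> real" where
  "incr u z = u (fst z) - u (snd z)"

lemma incr_measurable [measurable (raw)]:
  fixes u :: "'a::euclidean_space \<Rightarrow> real"
  shows "u \<in> borel_measurable lebesgue \<Longrightarrow> incr u \<in> borel_measurable lebesgue"
  unfolding incr_def[abs_def]
  by (intro borel_measurable_diff measurable_fst_lebesgue measurable_snd_lebesgue)

lemma frac_measurable:
  fixes u :: "'a::euclidean_space \<Rightarrow> real"
  assumes "u \<in> borel_measurable lebesgue"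
  shows "(\<lambda>z. ennreal ((incr u z)\<^sup>2 / norm (fst z - snd z) powr e)) \<in> borel_measurable lebesgue"
proof -
  have 1: "(\<lambda>z :: 'a \<times> 'a. norm (fst z - snd z)) \<in> borel_measurable borel"
    by (intro borel_measurable_continuous_onI continuous_intros)
  have "(\<lambda>z :: 'a \<times> 'a. norm (fst z - snd z)) \<in> borel_measurable lborel"
    using 1 by simp
  then have 2: "(\<lambda>z :: 'a \<times> 'a. norm (fst z - snd z)) \<in> borel_measurable lebesgue"
    by (rule measurable_completion)
  show ?thesis
    by (intro measurable_compose[OF _ measurable_ennreal] borel_measurable_divide borel_measurable_power
        incr_measurable assms powr_real_measurable 2 borel_measurable_const)
qed

lemma ennreal_lincomb:
  assumes "0 \<le> a" "0 \<le> b" "0 \<le> s" "0 \<le> t"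
  shows "ennreal a * ennreal s + ennreal b * ennreal t = ennreal (a * s + b * t)"
  using assms by (simp only: ennreal_plus ennreal_mult mult_nonneg_nonneg)

text \<open>
  Here \<open>J\<close> and \<open>a\<close> are the symmetric and the antisymmetric part of a kernel as real functions of a pair
  of points, \<open>1 - \<theta>\<close> is the constant \<open>1 / D\<close>, and \<open>c\<close> collects the constants of the fractional lower
  bound. The bound on \<open>\<integral> a\<^sup>2 / J dy\<close> that is uniform in \<open>x\<close> is stated after integration against \<open>h\<^sup>2\<close>, which
  is how it is used.
\<close>

locale nonlocal_kernel =
  fixes \<Omega> :: "'a::euclidean_space set" and J a :: "'a \<times> 'a \<Rightarrow> real" and A \<theta> \<alpha> c :: real
  assumes open_\<Omega>: "open \<Omega>" and bounded_\<Omega>: "bounded \<Omega>"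
    and J_measurable [measurable]: "J \<in> borel_measurable lebesgue"
    and J_nonneg: "0 \<le> J z" and J_swap: "J (prod.swap z) = J z"
    and a_measurable [measurable]: "a \<in> borel_measurable lebesgue"
    and a_swap: "a (prod.swap z) = - a z"
    and \<theta>: "0 < \<theta>" "\<theta> \<le> 1"
    and a_dominated: "AE z in lebesgue. \<bar>a z\<bar> \<le> (1 - \<theta>) * J z"
    and A_nonneg: "0 \<le> A"
    and a_bound: "h \<in> borel_measurable lebesgue \<Longrightarrow>
      (\<integral>\<^sup>+z. ennreal ((h (fst z))\<^sup>2 * ((a z)\<^sup>2 / J z)) \<partial>lebesgue) \<le> ennreal A * (\<integral>\<^sup>+x. ennreal ((h x)\<^sup>2) \<partial>lebesgue)"
    and \<alpha>_pos: "0 < \<alpha>" and c_pos: "0 < c"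
    and fractional: "u \<in> sq_integrable lebesgue \<Longrightarrow>
      ennreal c * (\<integral>\<^sup>+z. ennreal ((incr u z)\<^sup>2 / norm (fst z - snd z) powr (real DIM('a) + \<alpha>)) \<partial>lebesgue)
        \<le> (\<integral>\<^sup>+z. ennreal ((incr u z)\<^sup>2 * J z) \<partial>lebesgue)"
begin

text \<open>
  With the weight \<open>sqrt J\<close> the energy becomes the inner product of \<open>L\<^sup>2\<close> of the product space.
\<close>

definition weighted_incr :: "('a \<Rightarrow> real) \<Rightarrow> 'a \<times> 'a \<Rightarrow> real" where
  "weighted_incr u z = incr u z * sqrt (J z)"

definition zero_space :: "('a \<Rightarrow> real) set" where
  "zero_space = {u \<in> sq_integrable lebesgue. weighted_incr u \<in> sq_integrable lebesgue \<and>
     (AE x in lebesgue. x \<notin> \<Omega> \<longrightarrow> u x = 0)}"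

definition energy :: "('a \<Rightarrow> real) \<Rightarrow> ('a \<Rightarrow> real) \<Rightarrow> real" where
  "energy u v = (\<integral>z. weighted_incr u z * weighted_incr v z \<partial>lebesgue)"

lemma weighted_incr_measurable [measurable (raw)]:
  "u \<in> borel_measurable lebesgue \<Longrightarrow> weighted_incr u \<in> borel_measurable lebesgue"
  unfolding weighted_incr_def[abs_def]
  by (intro borel_measurable_times incr_measurable measurable_compose[OF J_measurable borel_measurable_sqrt])

lemma weighted_incr_add: "weighted_incr (\<lambda>x. u x + v x) z = weighted_incr u z + weighted_incr v z"
  by (simp add: weighted_incr_def incr_def algebra_simps)

lemma weighted_incr_scale: "weighted_incr (\<lambda>x. k * u x) z = k * weighted_incr u z"
  by (simp add: weighted_incr_def incr_def algebra_simps)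

lemma weighted_incr_sq: "(weighted_incr u z)\<^sup>2 = (incr u z)\<^sup>2 * J z"
  by (simp add: weighted_incr_def power_mult_distrib J_nonneg)

lemma zero_space_measurable: "u \<in> zero_space \<Longrightarrow> u \<in> borel_measurable lebesgue"
  by (simp add: zero_space_def sq_integrable_def)

lemma energy_sq: "energy u u = (\<integral>z. (weighted_incr u z)\<^sup>2 \<partial>lebesgue)"
  by (simp add: energy_def power2_eq_square)

sublocale function_inner_product_space zero_space energy
proof
  show "(\<lambda>_. 0) \<in> zero_space" by (simp add: zero_space_def sq_integrable_def weighted_incr_def[abs_def] incr_def)
next
  fix u v assume "u \<in> zero_space" "v \<in> zero_space"
  then show "(\<lambda>x. u x + v x) \<in> zero_space"
    by (auto simp: zero_space_def weighted_incr_add[abs_def] sq_integrable_add elim: eventually_elim2)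
next
  fix u k assume "u \<in> zero_space"
  then show "(\<lambda>x. k * u x) \<in> zero_space"
    by (auto simp: zero_space_def weighted_incr_scale[abs_def] sq_integrable_scale elim: eventually_mono)
next
  fix u v w assume "u \<in> zero_space" "v \<in> zero_space" "w \<in> zero_space"
  then show "energy (\<lambda>x. u x + v x) w = energy u w + energy v w"
    unfolding energy_def weighted_incr_add by (intro L2.ip_add_left) (auto simp: zero_space_def)
next
  fix u w k assume "u \<in> zero_space" "w \<in> zero_space"
  show "energy (\<lambda>x. k * u x) w = k * energy u w"
    unfolding energy_def weighted_incr_scale by (simp add: mult.assoc)
qed (auto simp: energy_def mult.commute)

section \<open>Poincare inequality, small sets and completeness\<close>

lemma fractional_energy:
  assumes u: "u \<in> zero_space"
  shows "ennreal c * (\<integral>\<^sup>+z. ennreal ((incr u z)\<^sup>2 / norm (fst z - snd z) powr (real DIM('a) + \<alpha>)) \<partial>lebesgue)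
    \<le> ennreal (energy u u)"
  using fractional[of u] u sq_integrable_nn_integral[of "weighted_incr u" lebesgue]
  by (simp add: zero_space_def energy_sq weighted_incr_sq)

lemma ennreal_scaled_le:
  assumes "k * x \<le> y * z" "ennreal c * z \<le> ennreal E" "y < \<infinity>"
  shows "ennreal c * k * x \<le> y * ennreal E"
proof -
  have "ennreal c * k * x = ennreal c * (k * x)" by (simp add: mult.assoc)
  also have "\<dots> \<le> ennreal c * (y * z)" by (rule mult_left_mono[OF assms(1)]) simp
  also have "\<dots> = y * (ennreal c * z)" by (simp add: mult_ac)
  also have "\<dots> \<le> y * ennreal E" by (rule mult_left_mono[OF assms(2)]) simp
  finally show ?thesis .
qed

text \<open>
  Let \<open>B\<close> be a ball that is disjoint from \<open>\<Omega>\<close>. If \<open>u\<close> vanishes outside \<open>\<Omega>\<close>, then \<open>u x\<close> is the increment of \<open>u\<close> between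
  \<open>x \<in> \<Omega>\<close> and any point of \<open>B\<close>. Integrate over \<open>\<Omega> \<times> B\<close>, where the distance of the two points is
  bounded, and compare with the fractional energy.
\<close>

lemma Poincare:
  obtains C where "C > 0" "\<And>u. u \<in> zero_space \<Longrightarrow> (\<integral>x. (u x)\<^sup>2 \<partial>lebesgue) \<le> C * energy u u"
proof -
  obtain R where R: "R > 0" "\<And>x. x \<in> \<Omega> \<Longrightarrow> norm x < R"
    using bounded_\<Omega> bounded_pos_less by blast
  obtain p :: 'a where p: "norm p = R + 1" using vector_choose_size[of "R + 1"] R by auto
  define B where "B = ball p 1"
  define \<rho> where "\<rho> = 2 * R + 2"
  define e where "e = real DIM('a) + \<alpha>"
  have e: "e > 0" using \<alpha>_pos by (simp add: e_def add_nonneg_pos)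
  define b where "b = measure lebesgue B"
  have b: "b > 0" by (simp add: b_def B_def)
  have Bm [measurable]: "B \<in> sets lebesgue" by (simp add: B_def)
  have emB: "emeasure lebesgue B = ennreal b"
    unfolding b_def B_def by (rule emeasure_eq_ennreal_measure[OF fmeasurableD2[OF lmeasurable_ball]])
  have B_norm: "R < norm y" "norm y < R + 2" if "y \<in> B" for y
  proof -
    have "norm (p - y) < 1" using that by (simp add: B_def dist_norm)
    then show "R < norm y" "norm y < R + 2" using p norm_triangle_ineq2[of p y] norm_triangle_ineq2[of y p]
      by (auto simp: norm_minus_commute)
  qed
  have key: "c * b * (\<integral>x. (u x)\<^sup>2 \<partial>lebesgue) \<le> \<rho> powr e * energy u u" if u: "u \<in> zero_space" for u
  proof -
    note [measurable] = zero_space_measurable[OF u]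
    have sq: "u \<in> sq_integrable lebesgue" using u by (simp add: zero_space_def)
    have ae: "AE x in lebesgue. x \<notin> \<Omega> \<longrightarrow> u x = 0" using u by (simp add: zero_space_def)
    have "emeasure lebesgue B * (\<integral>\<^sup>+x. ennreal ((u x)\<^sup>2) \<partial>lebesgue)
        = (\<integral>\<^sup>+z. ennreal ((u (fst z))\<^sup>2) * indicator B (snd z) \<partial>(lebesgue :: ('a \<times> 'a) measure))"
      by (subst nn_integral_lebesgue_prod) (auto simp: mult.commute)
    also have "\<dots> \<le> (\<integral>\<^sup>+z. ennreal (\<rho> powr e) * ennreal ((incr u z)\<^sup>2 / norm (fst z - snd z) powr e)
        \<partial>lebesgue)"
    proof (rule nn_integral_mono_AE)
      show "AE z in (lebesgue :: ('a \<times> 'a) measure). ennreal ((u (fst z))\<^sup>2) * indicator B (snd z)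
        \<le> ennreal (\<rho> powr e) * ennreal ((incr u z)\<^sup>2 / norm (fst z - snd z) powr e)"
        using AE_lebesgue_fst[OF ae, where 'b='a] AE_lebesgue_snd[OF ae, where 'a='a]
      proof eventually_elim
        case (elim z)
        show ?case
        proof (cases "fst z \<in> \<Omega> \<and> snd z \<in> B")
          case True
          then have n: "norm (fst z) < R" "R < norm (snd z)" "norm (snd z) < R + 2"
            using R(2) B_norm by auto
          then have "snd z \<notin> \<Omega>" using R(2)[of "snd z"] by auto
          then have uz: "u (snd z) = 0" using elim by blast
          have pos: "0 < norm (fst z - snd z)" using n by auto
          have "norm (fst z - snd z) \<le> \<rho>"
            using norm_triangle_ineq4[of "fst z" "snd z"] n by (simp add: \<rho>_def)
          then have le: "norm (fst z - snd z) powr e \<le> \<rho> powr e"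
            using e by (intro powr_mono2) auto
          have "(u (fst z))\<^sup>2 * norm (fst z - snd z) powr e \<le> (u (fst z))\<^sup>2 * \<rho> powr e"
            by (rule mult_left_mono[OF le]) simp
          then have "(u (fst z))\<^sup>2 \<le> \<rho> powr e * ((incr u z)\<^sup>2 / norm (fst z - snd z) powr e)"
            using pos uz by (simp add: incr_def field_simps)
          then show ?thesis using True by (simp add: ennreal_mult[symmetric])
        next
          case False
          then show ?thesis using elim by (auto simp: indicator_def)
        qed
      qed
    qed
    also have "\<dots> = ennreal (\<rho> powr e) * (\<integral>\<^sup>+z. ennreal ((incr u z)\<^sup>2 / norm (fst z - snd z) powr e) \<partial>lebesgue)"
      by (intro nn_integral_cmult frac_measurable zero_space_measurable u)
    finally have "ennreal c * emeasure lebesgue B * (\<integral>\<^sup>+x. ennreal ((u x)\<^sup>2) \<partial>lebesgue)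
        \<le> ennreal (\<rho> powr e) * ennreal (energy u u)"
      by (rule ennreal_scaled_le[OF _ fractional_energy[OF u, folded e_def]]) simp
    then have "ennreal (c * b * (\<integral>x. (u x)\<^sup>2 \<partial>lebesgue)) \<le> ennreal (\<rho> powr e * energy u u)"
      using c_pos b by (simp add: emB sq_integrable_nn_integral[OF sq] ennreal_mult ip_nonneg[OF u])
    then show ?thesis
      by (subst (asm) ennreal_le_iff) (simp_all add: ip_nonneg[OF u])
  qed
  show thesis
  proof (rule that)
    show "\<rho> powr e / (c * b) > 0" using c_pos b R by (simp add: \<rho>_def)
    fix u assume "u \<in> zero_space"
    from key[OF this] show "(\<integral>x. (u x)\<^sup>2 \<partial>lebesgue) \<le> \<rho> powr e / (c * b) * energy u u"
      using c_pos b by (simp add: field_simps)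
  qed
qed

text \<open>
  Functions of bounded energy do not concentrate on small sets. Average \<open>u(x)\<^sup>2 \<le> 2 (u(x) - u(y))\<^sup>2 + 2 u(y)\<^sup>2\<close> over the \<open>y\<close> in a ball of
  radius \<open>r\<close> about \<open>x\<close> and integrate over \<open>x \<in> T\<close>. The first term is at most a multiple of \<open>r powr \<alpha>\<close> times the
  energy, the second one a multiple of the measure of \<open>T\<close> divided by \<open>r ^ DIM('a)\<close> times
  \<open>\<integral> u\<^sup>2\<close>, which the Poincare inequality bounds by the energy. Choose \<open>r\<close> first, then \<open>\<tau>\<close>.
\<close>

lemma energy_small_sets:
  assumes \<delta>: "\<delta> > 0"
  obtains \<tau> where "\<tau> > 0"
    "\<And>u T. \<lbrakk>u \<in> zero_space; T \<in> sets lebesgue; emeasure lebesgue T \<le> ennreal \<tau>\<rbrakk>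
      \<Longrightarrow> (\<integral>x. indicator T x * (u x)\<^sup>2 \<partial>lebesgue) \<le> \<delta> * energy u u"
proof -
  obtain CP where CP: "CP > 0" "\<And>u. u \<in> zero_space \<Longrightarrow> (\<integral>x. (u x)\<^sup>2 \<partial>lebesgue) \<le> CP * energy u u"
    using Poincare by blast
  define e where "e = real DIM('a) + \<alpha>"
  have e: "e > 0" using \<alpha>_pos by (simp add: e_def add_nonneg_pos)
  define \<kappa> where "\<kappa> = unit_ball_vol (real DIM('a))"
  have \<kappa>: "\<kappa> > 0" by (simp add: \<kappa>_def)
  define r where "r = (\<delta> * c * \<kappa> / 4) powr (1 / \<alpha>)"
  have r: "r > 0" using \<delta> c_pos \<kappa> by (simp add: r_def)
  have r\<alpha>: "r powr \<alpha> = \<delta> * c * \<kappa> / 4" using \<delta> c_pos \<kappa> \<alpha>_pos by (simp add: r_def powr_powr)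
  define b where "b = \<kappa> * r ^ DIM('a)"
  have b: "b > 0" using \<kappa> r by (simp add: b_def)
  have re: "r powr e = \<delta> * c * b / 4"
    using r by (simp add: e_def b_def powr_add r\<alpha> powr_realpow)
  define \<tau> where "\<tau> = \<delta> * b / (4 * CP)"
  have \<tau>: "\<tau> > 0" using \<delta> b CP(1) by (simp add: \<tau>_def)
  show thesis
  proof (rule that[OF \<tau>])
    fix u and T :: "'a set" assume u: "u \<in> zero_space" and T [measurable]: "T \<in> sets lebesgue"
      and emT: "emeasure lebesgue T \<le> ennreal \<tau>"
    note um [measurable] = zero_space_measurable[OF u]
    have sq: "u \<in> sq_integrable lebesgue" using u by (simp add: zero_space_def)
    define U where "U = (\<integral>x. (u x)\<^sup>2 \<partial>lebesgue)"
    have U: "0 \<le> U" "U \<le> CP * energy u u" using CP(2)[OF u] by (simp_all add: U_def)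
    have intT: "integrable lebesgue (\<lambda>x. indicator T x * (u x)\<^sup>2)"
      using integrable_mult_indicator[OF T, of "\<lambda>x. (u x)\<^sup>2"] sq by (simp add: sq_integrable_def)
    define I where "I = (\<integral>x. indicator T x * (u x)\<^sup>2 \<partial>lebesgue)"
    have I0: "0 \<le> I" unfolding I_def by (intro integral_nonneg_AE) auto
    have nnI: "(\<integral>\<^sup>+x. ennreal (indicator T x * (u x)\<^sup>2) \<partial>lebesgue) = ennreal I"
      unfolding I_def by (rule nn_integral_eq_integral[OF intT]) auto
    define N where "N z = (indicator {z. dist (fst z) (snd z) < r} z :: ennreal)" for z :: "'a \<times> 'a"
    have Nm [measurable]: "N \<in> borel_measurable lebesgue"
    proof -
      have "open {z :: 'a \<times> 'a. dist (fst z) (snd z) < r}"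
        by (intro open_Collect_less continuous_intros)
      from borel_open[OF this]
      have "{z :: 'a \<times> 'a. dist (fst z) (snd z) < r} \<in> sets lebesgue" by simp
      then show ?thesis unfolding N_def[abs_def] by measurable
    qed
    define F where "F z = ennreal ((incr u z)\<^sup>2 / norm (fst z - snd z) powr e)" for z
    have Fm: "F \<in> borel_measurable lebesgue"
      unfolding F_def[abs_def] by (rule frac_measurable[OF um])
    define h where "h x = ennreal (indicator T x * (u x)\<^sup>2)" for x
    have hm: "h \<in> borel_measurable lebesgue" unfolding h_def[abs_def] by measurable
    define k where "k z = ennreal (indicator T (fst z)) * ennreal ((u (snd z))\<^sup>2)" for z :: "'a \<times> 'a"
    have km: "k \<in> borel_measurable lebesgue"
      unfolding k_def[abs_def]
      by (intro borel_measurable_times_ennreal measurable_fst_lebesgue[where u="\<lambda>x. ennreal (indicator T x)"]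
          measurable_snd_lebesgue[where u="\<lambda>x. ennreal ((u x)\<^sup>2)"]) measurable
    have ball: "(\<integral>\<^sup>+y. N (x, y) \<partial>lebesgue) = ennreal b" for x
    proof -
      have "(\<integral>\<^sup>+y. N (x, y) \<partial>lebesgue) = (\<integral>\<^sup>+y. indicator (ball x r) y \<partial>lebesgue)"
        by (intro nn_integral_cong) (simp add: N_def indicator_def)
      also have "\<dots> = emeasure lborel (ball x r)" by simp
      also have "\<dots> = ennreal b" using emeasure_ball[of r x] r by (simp add: b_def \<kappa>_def)
      finally show ?thesis .
    qed
    have "ennreal I * ennreal b = (\<integral>\<^sup>+x. h x * (\<integral>\<^sup>+y. N (x, y) \<partial>lebesgue) \<partial>lebesgue)"
      unfolding ball using hm nnI by (simp add: nn_integral_multc h_def)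
    also have "\<dots> \<le> (\<integral>\<^sup>+x. (\<integral>\<^sup>+y. h x * N (x, y) \<partial>lebesgue) \<partial>lebesgue)"
    proof (rule nn_integral_mono)
      fix x :: 'a
      have "(\<lambda>y. N (x, y)) = indicator (ball x r)" by (auto simp: N_def indicator_def)
      then have "(\<lambda>y. N (x, y)) \<in> borel_measurable lebesgue"
        using borel_measurable_indicator[OF fmeasurableD[OF lmeasurable_ball]] by metis
      then show "h x * (\<integral>\<^sup>+y. N (x, y) \<partial>lebesgue) \<le> (\<integral>\<^sup>+y. h x * N (x, y) \<partial>lebesgue)"
        by (simp add: nn_integral_cmult)
    qed
    also have "\<dots> = (\<integral>\<^sup>+z. h (fst z) * N z \<partial>lebesgue)"
      using nn_integral_lebesgue_pair[OF borel_measurable_times_ennreal[OF measurable_fst_lebesgue[OF hm] Nm]]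
      by simp
    (* points at distance less than r: compare u at the two points *)
    also have "\<dots> \<le> (\<integral>\<^sup>+z. ennreal (2 * r powr e) * F z + 2 * k z \<partial>lebesgue)"
    proof (rule nn_integral_mono)
      fix z :: "'a \<times> 'a"
      show "h (fst z) * N z \<le> ennreal (2 * r powr e) * F z + 2 * k z"
      proof (cases "fst z \<in> T \<and> dist (fst z) (snd z) < r")
        case True
        have "incr u z = 0 \<or> 0 < norm (fst z - snd z)" by (auto simp: incr_def)
        then have 1: "(incr u z)\<^sup>2 \<le> r powr e * ((incr u z)\<^sup>2 / norm (fst z - snd z) powr e)"
        proof
          assume pos: "0 < norm (fst z - snd z)"
          have "norm (fst z - snd z) powr e \<le> r powr e"
            using True e by (intro powr_mono2) (auto simp: dist_norm)
          then have "(incr u z)\<^sup>2 * norm (fst z - snd z) powr e \<le> (incr u z)\<^sup>2 * r powr e"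
            by (intro mult_left_mono) auto
          then show ?thesis using pos by (simp add: field_simps)
        qed simp
        have "0 \<le> (u (fst z) - 2 * u (snd z))\<^sup>2" by simp
        then have "(u (fst z))\<^sup>2 \<le> 2 * (incr u z)\<^sup>2 + 2 * (u (snd z))\<^sup>2"
          by (simp add: incr_def power2_diff power_mult_distrib)
        then have "(u (fst z))\<^sup>2
            \<le> 2 * r powr e * ((incr u z)\<^sup>2 / norm (fst z - snd z) powr e) + 2 * (u (snd z))\<^sup>2"
          using 1 by linarith
        then have "ennreal ((u (fst z))\<^sup>2)
            \<le> ennreal (2 * r powr e * ((incr u z)\<^sup>2 / norm (fst z - snd z) powr e) + 2 * (u (snd z))\<^sup>2)"
          by (rule ennreal_leI)
        also have "\<dots> = ennreal (2 * r powr e) * F z + ennreal 2 * ennreal ((u (snd z))\<^sup>2)"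
          unfolding F_def by (subst ennreal_plus) (simp_all only: ennreal_mult mult_nonneg_nonneg
              zero_le_numeral powr_ge_zero zero_le_power2 divide_nonneg_nonneg)
        finally show ?thesis using True unfolding h_def N_def k_def by simp
      next
        case False
        then show ?thesis by (auto simp: h_def N_def)
      qed
    qed
    also have "\<dots> = ennreal (2 * r powr e) * (\<integral>\<^sup>+z. F z \<partial>lebesgue) + 2 * (\<integral>\<^sup>+z. k z \<partial>lebesgue)"
      using Fm km by (simp add: nn_integral_add nn_integral_cmult)
    also have "(\<integral>\<^sup>+z. k z \<partial>lebesgue) = emeasure lebesgue T * ennreal U"
      unfolding k_def
      by (subst nn_integral_lebesgue_prod[of "\<lambda>x. ennreal (indicator T x)" "\<lambda>x. ennreal ((u x)\<^sup>2)"])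
         (simp_all add: sq_integrable_nn_integral[OF sq] U_def ennreal_indicator)
    also have "ennreal (2 * r powr e) * (\<integral>\<^sup>+z. F z \<partial>lebesgue) + 2 * (emeasure lebesgue T * ennreal U)
        \<le> ennreal (2 * r powr e) * ennreal (energy u u / c) + 2 * (ennreal \<tau> * ennreal U)"
    proof (intro add_mono mult_left_mono mult_right_mono emT)
      have "(\<integral>\<^sup>+z. F z \<partial>lebesgue) = ennreal (1 / c) * (ennreal c * (\<integral>\<^sup>+z. F z \<partial>lebesgue))"
        using c_pos by (simp add: mult.assoc[symmetric] ennreal_mult[symmetric])
      also have "\<dots> \<le> ennreal (1 / c) * ennreal (energy u u)"
        using fractional_energy[OF u] by (intro mult_left_mono) (simp_all add: F_def e_def)
      also have "\<dots> = ennreal (energy u u / c)"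
        using c_pos ip_nonneg[OF u] by (simp add: ennreal_mult[symmetric])
      finally show "(\<integral>\<^sup>+z. F z \<partial>lebesgue) \<le> ennreal (energy u u / c)" .
    qed auto
    also have "2 * (ennreal \<tau> * ennreal U) = ennreal 2 * ennreal (\<tau> * U)"
      using \<tau> by (simp add: ennreal_mult')
    also have "ennreal (2 * r powr e) * ennreal (energy u u / c) + ennreal 2 * ennreal (\<tau> * U)
        = ennreal (2 * r powr e * (energy u u / c) + 2 * (\<tau> * U))"
      using c_pos ip_nonneg[OF u] U \<tau> by (intro ennreal_lincomb) auto
    finally have "ennreal (I * b) \<le> ennreal (2 * r powr e * (energy u u / c) + 2 * (\<tau> * U))"
      using I0 b by (simp add: ennreal_mult)
    then have "I * b \<le> 2 * r powr e * (energy u u / c) + 2 * (\<tau> * U)"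
      using c_pos ip_nonneg[OF u] U \<tau> by (subst (asm) ennreal_le_iff) auto
    also have "\<dots> \<le> 2 * r powr e * (energy u u / c) + 2 * (\<tau> * (CP * energy u u))"
      using U \<tau> by (intro add_left_mono mult_left_mono) auto
    also have "\<dots> = \<delta> * energy u u * b"
      using c_pos CP(1) by (simp add: re \<tau>_def field_simps)
    finally have "I \<le> \<delta> * energy u u" using b by simp
    then show "(\<integral>x. indicator T x * (u x)\<^sup>2 \<partial>lebesgue) \<le> \<delta> * energy u u" by (simp add: I_def)
  qed
qed

text \<open>
  By the Poincare inequality a Cauchy sequence for the energy is also one in \<open>L\<^sup>2\<close>, so a rapidly
  converging subsequence converges almost everywhere. Fatou's lemma transfers the Cauchy property to the distance
  from the limit, in both norms.
\<close>

lemma zero_space_complete: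
  assumes s: "\<And>n. s n \<in> zero_space"
    and cauchy: "\<And>e. e > 0 \<Longrightarrow> \<exists>K. \<forall>m\<ge>K. \<forall>n\<ge>K. energy (\<lambda>x. s m x - s n x) (\<lambda>x. s m x - s n x) < e"
  shows "\<exists>l\<in>zero_space. (\<lambda>n. energy (\<lambda>x. s n x - l x) (\<lambda>x. s n x - l x)) \<longlonglongrightarrow> 0"
proof -
  define D where "D m n = energy (\<lambda>x. s m x - s n x) (\<lambda>x. s m x - s n x)" for m n
  obtain CP where CP: "CP > 0" "\<And>u. u \<in> zero_space \<Longrightarrow> (\<integral>x. (u x)\<^sup>2 \<partial>lebesgue) \<le> CP * energy u u"
    using Poincare by blast
  note sm [measurable] = zero_space_measurable[OF s]
  have d: "(\<lambda>x. s m x - s n x) \<in> zero_space" for m n by (intro diff_mem s)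
  have L2: "(\<integral>\<^sup>+x. ennreal ((s m x - s n x)\<^sup>2) \<partial>lebesgue) \<le> ennreal (CP * D m n)" for m n
  proof -
    have "(\<lambda>x. s m x - s n x) \<in> sq_integrable lebesgue" using d by (simp add: zero_space_def)
    then show ?thesis
      using CP(2)[OF d, of m n] by (simp add: sq_integrable_nn_integral D_def ennreal_leI)
  qed
  have en: "(\<integral>\<^sup>+z. ennreal ((weighted_incr (\<lambda>x. s m x - s n x) z)\<^sup>2) \<partial>lebesgue) = ennreal (D m n)" for m n
    using d[of m n] by (simp add: sq_integrable_nn_integral D_def energy_sq zero_space_def)
  have "\<exists>K. \<forall>m\<ge>K. \<forall>n\<ge>K. D m n < (1/16)^k" for k
    using cauchy[of "(1/16)^k"] by (simp add: D_def)
  then obtain \<kappa> where \<kappa>: "\<And>k m n. \<lbrakk>m \<ge> \<kappa> k; n \<ge> \<kappa> k\<rbrakk> \<Longrightarrow> D m n < (1/16)^k" by metis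
  (* a nondecreasing choice of indices that also tends to infinity *)
  define r where "r k = Max (\<kappa> ` {..k}) + k" for k
  have r_ge: "\<kappa> k \<le> r k" "k \<le> r k" for k
    using Max_ge[of "\<kappa> ` {..k}" "\<kappa> k"] unfolding r_def by (simp_all add: trans_le_add1)
  have r_Suc: "r k \<le> r (Suc k)" for k
    unfolding r_def by (intro add_mono Max_mono) auto
  have "AE x in lebesgue. convergent (\<lambda>k. s (r k) x)"
  proof (rule AE_convergent_of_summable_squares[where C=CP])
    fix k
    have "D (r (Suc k)) (r k) < (1/16)^k" using r_ge[of k] r_Suc[of k] by (intro \<kappa>) auto
    then have "CP * D (r (Suc k)) (r k) \<le> CP * (1/16)^k" using CP(1) by (intro mult_left_mono) auto
    then show "(\<integral>\<^sup>+x. ennreal ((s (r (Suc k)) x - s (r k) x)\<^sup>2) \<partial>lebesgue) \<le> ennreal (CP * (1/16)^k)"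
      using L2[of "r (Suc k)" "r k"] by (meson ennreal_leI order_trans)
  qed (use CP in auto)
  define l where "l x = lim (\<lambda>k. s (r k) x)" for x
  have lm [measurable]: "l \<in> borel_measurable lebesgue"
    unfolding l_def[abs_def] by (intro borel_measurable_lim_metric sm)
  have lim: "AE x in lebesgue. (\<lambda>k. s (r k) x) \<longlonglongrightarrow> l x"
    using \<open>AE x in lebesgue. convergent (\<lambda>k. s (r k) x)\<close>
    by eventually_elim (simp add: l_def convergent_LIMSEQ_iff)
  have near: "(\<lambda>x. s n x - l x) \<in> zero_space \<and> energy (\<lambda>x. s n x - l x) (\<lambda>x. s n x - l x) \<le> e"
    if e: "e > 0" and K: "\<forall>m\<ge>K. \<forall>n\<ge>K. D m n < e" and n: "n \<ge> K" for e K n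
  proof -
    have ev: "\<forall>\<^sub>F k in sequentially. D n (r k) \<le> e"
      using eventually_ge_at_top[of K]
    proof eventually_elim
      case (elim k)
      then show ?case using K n r_ge(2)[of k] by (meson less_imp_le order_trans)
    qed
    have 1: "(\<integral>\<^sup>+x. ennreal ((s n x - l x)\<^sup>2) \<partial>lebesgue) \<le> ennreal (CP * e)"
    proof (rule square_integral_limit_le[where f="\<lambda>k x. s n x - s (r k) x"])
      show "AE x in lebesgue. (\<lambda>k. s n x - s (r k) x) \<longlonglongrightarrow> s n x - l x"
        using lim by eventually_elim (intro tendsto_intros)
      show "\<forall>\<^sub>F k in sequentially. (\<integral>\<^sup>+x. ennreal ((s n x - s (r k) x)\<^sup>2) \<partial>lebesgue) \<le> ennreal (CP * e)"
        using ev
      proof eventually_elim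
        case (elim k)
        then have "CP * D n (r k) \<le> CP * e" using CP(1) by (intro mult_left_mono) auto
        then show ?case using L2[of n "r k"] by (meson ennreal_leI order_trans)
      qed
    qed measurable
    have 2: "(\<integral>\<^sup>+z. ennreal ((weighted_incr (\<lambda>x. s n x - l x) z)\<^sup>2) \<partial>lebesgue) \<le> ennreal e"
    proof (rule square_integral_limit_le[where f="\<lambda>k. weighted_incr (\<lambda>x. s n x - s (r k) x)"])
      show "AE z in lebesgue. (\<lambda>k. weighted_incr (\<lambda>x. s n x - s (r k) x) z) \<longlonglongrightarrow> weighted_incr (\<lambda>x. s n x - l x) z"
        using AE_lebesgue_fst[OF lim, where 'b='a] AE_lebesgue_snd[OF lim, where 'a='a]
        by eventually_elim (unfold weighted_incr_def incr_def, intro tendsto_intros)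
      show "\<forall>\<^sub>F k in sequentially. (\<integral>\<^sup>+z. ennreal ((weighted_incr (\<lambda>x. s n x - s (r k) x) z)\<^sup>2) \<partial>lebesgue) \<le> ennreal e"
        using ev unfolding en by eventually_elim (rule ennreal_leI)
    qed (intro weighted_incr_measurable borel_measurable_diff sm)
    have zero: "AE x in lebesgue. x \<notin> \<Omega> \<longrightarrow> s n x - l x = 0"
    proof -
      have "AE x in lebesgue. \<forall>k. x \<notin> \<Omega> \<longrightarrow> s k x = 0"
        using s by (subst AE_all_countable) (auto simp: zero_space_def)
      then show ?thesis
        using lim
      proof eventually_elim
        case (elim x)
        show ?case
        proof
          assume "x \<notin> \<Omega>"
          then have "s n x = 0" "(\<lambda>k. s (r k) x) = (\<lambda>_. 0)" using elim by auto
          moreover from this(2) elim(2) have "(\<lambda>_ :: nat. 0) \<longlonglongrightarrow> l x" by simp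
          from LIMSEQ_unique[OF this tendsto_const] have "l x = 0" .
          ultimately show "s n x - l x = 0" by simp
        qed
      qed
    qed
    have "(\<lambda>x. s n x - l x) \<in> sq_integrable lebesgue"
      using 1 by (auto simp: sq_integrable_iff_nn_integral intro: le_less_trans)
    moreover have w: "weighted_incr (\<lambda>x. s n x - l x) \<in> sq_integrable lebesgue"
      using 2 weighted_incr_measurable[of "\<lambda>x. s n x - l x"]
      by (auto simp: sq_integrable_iff_nn_integral intro: le_less_trans)
    moreover have "energy (\<lambda>x. s n x - l x) (\<lambda>x. s n x - l x) \<le> e"
      using 2 e by (simp add: sq_integrable_nn_integral[OF w] energy_sq ennreal_le_iff)
    ultimately show ?thesis using zero by (simp add: zero_space_def)
  qed
  obtain K where "\<forall>m\<ge>K. \<forall>n\<ge>K. D m n < 1" using cauchy[of 1] by (auto simp: D_def)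
  then have "(\<lambda>x. s K x - l x) \<in> zero_space" using near[of 1 K K] by simp
  then have "(\<lambda>x. s K x - (s K x - l x)) \<in> zero_space" by (rule diff_mem[OF s])
  then have l: "l \<in> zero_space" by simp
  have "(\<lambda>n. energy (\<lambda>x. s n x - l x) (\<lambda>x. s n x - l x)) \<longlonglongrightarrow> 0"
  proof (rule LIMSEQ_I)
    fix e :: real assume e: "e > 0"
    obtain K where K: "\<forall>m\<ge>K. \<forall>n\<ge>K. D m n < e / 2" using cauchy[of "e/2"] e by (auto simp: D_def)
    show "\<exists>no. \<forall>n\<ge>no. norm (energy (\<lambda>x. s n x - l x) (\<lambda>x. s n x - l x) - 0) < e"
    proof (intro exI allI impI)
      fix n assume "K \<le> n"
      have "energy (\<lambda>x. s n x - l x) (\<lambda>x. s n x - l x) \<le> e / 2"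
        using near[OF half_gt_zero[OF e] K \<open>K \<le> n\<close>] by blast
      moreover have "0 \<le> energy (\<lambda>x. s n x - l x) (\<lambda>x. s n x - l x)"
        by (rule ip_nonneg[OF diff_mem[OF s l]])
      ultimately show "norm (energy (\<lambda>x. s n x - l x) (\<lambda>x. s n x - l x) - 0) < e" using e by simp
    qed
  qed
  then show ?thesis using l by blast
qed

sublocale function_hilbert_space zero_space energy
  by unfold_locales (rule zero_space_complete)

section \<open>The drift form\<close>

definition drift :: "('a \<Rightarrow> real) \<Rightarrow> ('a \<Rightarrow> real) \<Rightarrow> real" where
  "drift u v = (\<integral>z. incr u z * v (fst z) * a z \<partial>lebesgue)"

text \<open>
  The factor that remains of the drift integrand when \<open>weighted_incr\<close> is split off. Where \<open>J = 0\<close> the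
  quotient is 0 by convention, in accordance with \<open>a = 0\<close> there.
\<close>

definition weighted_drift :: "('a \<Rightarrow> real) \<Rightarrow> 'a \<times> 'a \<Rightarrow> real" where
  "weighted_drift v z = v (fst z) * (a z / sqrt (J z))"

lemma weighted_drift_measurable: "v \<in> borel_measurable lebesgue \<Longrightarrow> weighted_drift v \<in> borel_measurable lebesgue"
  unfolding weighted_drift_def[abs_def]
  by (intro borel_measurable_times borel_measurable_divide measurable_fst_lebesgue a_measurable
      measurable_compose[OF J_measurable borel_measurable_sqrt])

lemma weighted_drift_sq: "(weighted_drift v z)\<^sup>2 = (v (fst z))\<^sup>2 * ((a z)\<^sup>2 / J z)"
  by (simp add: weighted_drift_def power_mult_distrib power_divide J_nonneg)

lemma weighted_drift_sq_integrable:
  assumes v: "v \<in> sq_integrable lebesgue"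
  shows "weighted_drift v \<in> sq_integrable lebesgue"
    and "(\<integral>z. (weighted_drift v z)\<^sup>2 \<partial>lebesgue) \<le> A * (\<integral>x. (v x)\<^sup>2 \<partial>lebesgue)"
proof -
  have vm: "v \<in> borel_measurable lebesgue" using v by (simp add: sq_integrable_def)
  have le: "(\<integral>\<^sup>+z. ennreal ((weighted_drift v z)\<^sup>2) \<partial>lebesgue) \<le> ennreal (A * (\<integral>x. (v x)\<^sup>2 \<partial>lebesgue))"
    using a_bound[OF vm] A_nonneg by (simp add: weighted_drift_sq sq_integrable_nn_integral[OF v] ennreal_mult)
  then show *: "weighted_drift v \<in> sq_integrable lebesgue"
    using weighted_drift_measurable[OF vm] by (auto simp: sq_integrable_iff_nn_integral intro: le_less_trans)
  show "(\<integral>z. (weighted_drift v z)\<^sup>2 \<partial>lebesgue) \<le> A * (\<integral>x. (v x)\<^sup>2 \<partial>lebesgue)"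
    using le A_nonneg by (simp add: sq_integrable_nn_integral[OF *])
qed

lemma AE_a_factor: "AE z in lebesgue. a z = sqrt (J z) * (a z / sqrt (J z))"
  using a_dominated by eventually_elim auto

lemma AE_drift_factor: "AE z in lebesgue. incr u z * v (fst z) * a z = weighted_incr u z * weighted_drift v z"
  using AE_a_factor
proof eventually_elim
  case (elim z)
  have "incr u z * v (fst z) * a z = incr u z * v (fst z) * (sqrt (J z) * (a z / sqrt (J z)))"
    using elim by (rule arg_cong)
  also have "\<dots> = weighted_incr u z * weighted_drift v z" by (simp only: weighted_incr_def weighted_drift_def mult_ac)
  finally show ?case .
qed

lemma drift_integrand_measurable:
  assumes "u \<in> borel_measurable lebesgue" "v \<in> borel_measurable lebesgue"
  shows "(\<lambda>z. incr u z * v (fst z) * a z) \<in> borel_measurable lebesgue"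
  by (intro borel_measurable_times incr_measurable measurable_fst_lebesgue a_measurable assms)

lemma drift_eq:
  assumes "u \<in> borel_measurable lebesgue" "v \<in> borel_measurable lebesgue"
  shows "drift u v = (\<integral>z. weighted_incr u z * weighted_drift v z \<partial>lebesgue)"
  unfolding drift_def
  by (intro integral_cong_AE AE_drift_factor drift_integrand_measurable borel_measurable_times
      weighted_incr_measurable weighted_drift_measurable assms)

lemma drift_integrable:
  assumes "u \<in> zero_space" "v \<in> zero_space"
  shows "integrable lebesgue (\<lambda>z. incr u z * v (fst z) * a z)"
proof -
  have m: "u \<in> borel_measurable lebesgue" "v \<in> borel_measurable lebesgue"
    using assms by (auto intro: zero_space_measurable)
  have i: "integrable lebesgue (\<lambda>z. weighted_incr u z * weighted_drift v z)"
    using assms by (intro integrable_mult_sq_integrable weighted_drift_sq_integrable) (auto simp: zero_space_def)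
  then show ?thesis
    using integrable_cong_AE[OF drift_integrand_measurable[OF m] _ AE_drift_factor] by blast
qed

lemma drift_bound:
  assumes "u \<in> zero_space" "v \<in> zero_space"
  shows "\<bar>drift u v\<bar> \<le> nrm u * sqrt (A * (\<integral>x. (v x)\<^sup>2 \<partial>lebesgue))"
proof -
  have s: "weighted_incr u \<in> sq_integrable lebesgue" "v \<in> sq_integrable lebesgue"
    using assms by (auto simp: zero_space_def)
  have "\<bar>drift u v\<bar> \<le> sqrt (\<integral>z. (weighted_incr u z)\<^sup>2 \<partial>lebesgue) * sqrt (\<integral>z. (weighted_drift v z)\<^sup>2 \<partial>lebesgue)"
    using assms by (subst drift_eq)
      (auto intro: zero_space_measurable L2_Cauchy_Schwarz s weighted_drift_sq_integrable)
  also have "\<dots> \<le> nrm u * sqrt (A * (\<integral>x. (v x)\<^sup>2 \<partial>lebesgue))"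
    unfolding nrm_def energy_sq
    by (intro mult_left_mono real_sqrt_le_mono weighted_drift_sq_integrable s) simp
  finally show ?thesis .
qed

lemma bounded_form_drift: "bounded_form drift"
proof -
  obtain CP where CP: "CP > 0" "\<And>u. u \<in> zero_space \<Longrightarrow> (\<integral>x. (u x)\<^sup>2 \<partial>lebesgue) \<le> CP * energy u u"
    using Poincare by blast
  have "\<bar>drift u v\<bar> \<le> sqrt (A * CP) * nrm u * nrm v" if "u \<in> zero_space" "v \<in> zero_space" for u v
  proof -
    have "A * (\<integral>x. (v x)\<^sup>2 \<partial>lebesgue) \<le> A * (CP * energy v v)"
      by (intro mult_left_mono CP A_nonneg that)
    then have "sqrt (A * (\<integral>x. (v x)\<^sup>2 \<partial>lebesgue)) \<le> sqrt (A * CP) * nrm v"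
      by (simp add: nrm_def real_sqrt_mult[symmetric] mult.assoc)
    from mult_left_mono[OF this, of "nrm u"] drift_bound[OF that] that show ?thesis
      by (simp add: mult_ac)
  qed
  moreover have "drift (\<lambda>x. u x + v x) w = drift u w + drift v w"
    if "u \<in> zero_space" "v \<in> zero_space" "w \<in> zero_space" for u v w
  proof -
    have "drift (\<lambda>x. u x + v x) w = (\<integral>z. incr u z * w (fst z) * a z + incr v z * w (fst z) * a z \<partial>lebesgue)"
      unfolding drift_def by (simp add: incr_def algebra_simps)
    also have "\<dots> = drift u w + drift v w"
      unfolding drift_def by (intro Bochner_Integration.integral_add drift_integrable that)
    finally show ?thesis .
  qed
  moreover have "drift w (\<lambda>x. u x + v x) = drift w u + drift w v"
    if "u \<in> zero_space" "v \<in> zero_space" "w \<in> zero_space" for u v w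
  proof -
    have "drift w (\<lambda>x. u x + v x) = (\<integral>z. incr w z * u (fst z) * a z + incr w z * v (fst z) * a z \<partial>lebesgue)"
      unfolding drift_def by (simp add: algebra_simps)
    also have "\<dots> = drift w u + drift w v"
      unfolding drift_def by (intro Bochner_Integration.integral_add drift_integrable that)
    finally show ?thesis .
  qed
  moreover have "drift (\<lambda>x. k * u x) w = k * drift u w" for k u w
  proof -
    have "drift (\<lambda>x. k * u x) w = (\<integral>z. k * (incr u z * w (fst z) * a z) \<partial>lebesgue)"
      unfolding drift_def by (simp add: incr_def algebra_simps)
    then show ?thesis by (simp add: drift_def)
  qed
  moreover have "drift w (\<lambda>x. k * u x) = k * drift w u" for k u w
  proof -
    have "drift w (\<lambda>x. k * u x) = (\<integral>z. k * (incr w z * u (fst z) * a z) \<partial>lebesgue)"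
      unfolding drift_def by (simp add: algebra_simps)
    then show ?thesis by (simp add: drift_def)
  qed
  ultimately show ?thesis unfolding bounded_form_def by blast
qed

lemma weighted_incr_mult: "weighted_incr u z * weighted_incr v z = incr u z * incr v z * J z"
proof -
  have "weighted_incr u z * weighted_incr v z = incr u z * incr v z * (sqrt (J z) * sqrt (J z))"
    unfolding weighted_incr_def by (simp only: mult_ac)
  then show ?thesis using J_nonneg by simp
qed

lemma energy_eq: "energy u v = (\<integral>z. incr u z * incr v z * J z \<partial>lebesgue)"
  by (simp add: energy_def weighted_incr_mult)

lemma energy_integrable:
  assumes "u \<in> zero_space" "v \<in> zero_space"
  shows "integrable lebesgue (\<lambda>z. incr u z * incr v z * J z)"
  unfolding weighted_incr_mult[symmetric]
  using assms by (intro integrable_mult_sq_integrable) (auto simp: zero_space_def)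

text \<open>
  Exchanging the two points maps \<open>incr \<phi> z * v (fst z) * a z\<close> to \<open>incr \<phi> z * v (snd z) * a z\<close>, because both
  the increment and \<open>a\<close> change sign. So the drift is half the integral with the sum of the two values of \<open>v\<close>.
\<close>

lemma symmetrised_form:
  assumes \<phi>: "\<phi> \<in> zero_space" and v: "v \<in> zero_space"
  shows "integrable lebesgue (\<lambda>z. incr \<phi> z * (incr v z * J z + t * (v (fst z) + v (snd z)) * a z))"
    and "1/2 * energy \<phi> v + t * drift \<phi> v
      = 1/2 * (\<integral>z. incr \<phi> z * (incr v z * J z + t * (v (fst z) + v (snd z)) * a z) \<partial>lebesgue)"
proof -
  define h where "h z = incr \<phi> z * v (fst z) * a z" for z
  have hi: "integrable lebesgue h" unfolding h_def[abs_def] by (rule drift_integrable[OF \<phi> v])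
  have hs: "h (prod.swap z) = incr \<phi> z * v (snd z) * a z" for z
    unfolding h_def by (simp add: a_swap incr_def algebra_simps)
  have hsi: "integrable lebesgue (\<lambda>z. h (prod.swap z))" by (rule integrable_lebesgue_swap[OF hi])
  have ei: "integrable lebesgue (\<lambda>z. incr \<phi> z * incr v z * J z)" by (rule energy_integrable[OF \<phi> v])
  have eq: "incr \<phi> z * (incr v z * J z + t * (v (fst z) + v (snd z)) * a z)
      = incr \<phi> z * incr v z * J z + (t * h z + t * h (prod.swap z))" for z
    unfolding hs unfolding h_def by (simp add: algebra_simps)
  show "integrable lebesgue (\<lambda>z. incr \<phi> z * (incr v z * J z + t * (v (fst z) + v (snd z)) * a z))"
    unfolding eq
    by (intro Bochner_Integration.integrable_add ei integrable_mult_right hi hsi)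
  have "(\<integral>z. incr \<phi> z * (incr v z * J z + t * (v (fst z) + v (snd z)) * a z) \<partial>lebesgue)
      = energy \<phi> v + (t * (\<integral>z. h z \<partial>lebesgue) + t * (\<integral>z. h (prod.swap z) \<partial>lebesgue))"
    unfolding eq energy_eq using ei hi hsi by simp
  also have "(\<integral>z. h (prod.swap z) \<partial>lebesgue) = (\<integral>z. h z \<partial>lebesgue)"
    by (rule integral_lebesgue_swap) (use hi in auto)
  also have "(\<integral>z. h z \<partial>lebesgue) = drift \<phi> v" by (simp add: drift_def h_def)
  finally show "1/2 * energy \<phi> v + t * drift \<phi> v
      = 1/2 * (\<integral>z. incr \<phi> z * (incr v z * J z + t * (v (fst z) + v (snd z)) * a z) \<partial>lebesgue)"
    by (simp add: algebra_simps)
qed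

lemma zero_space_compose:
  assumes v: "v \<in> zero_space" and G: "G \<in> borel_measurable borel" and G0: "G 0 = 0"
    and lip: "\<And>r s. \<bar>G r - G s\<bar> \<le> L * \<bar>r - s\<bar>"
  shows "(\<lambda>x. G (v x)) \<in> zero_space"
proof -
  have vm: "v \<in> borel_measurable lebesgue" by (rule zero_space_measurable[OF v])
  have m: "(\<lambda>x. G (v x)) \<in> borel_measurable lebesgue" by (rule measurable_compose[OF vm G])
  have vs: "v \<in> sq_integrable lebesgue" using v by (simp add: zero_space_def)
  have "\<bar>G (v x)\<bar> \<le> L * \<bar>v x\<bar>" for x using lip[of "v x" 0] unfolding G0 by simp
  then have "(\<lambda>x. G (v x)) \<in> sq_integrable lebesgue"
    by (intro sq_integrable_bound[OF vs m] AE_I2)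
  moreover have "weighted_incr (\<lambda>x. G (v x)) \<in> sq_integrable lebesgue"
  proof (rule sq_integrable_bound[of "weighted_incr v" _ _ L])
    show "weighted_incr v \<in> sq_integrable lebesgue" using v by (simp add: zero_space_def)
    have "\<bar>weighted_incr (\<lambda>x. G (v x)) z\<bar> \<le> L * \<bar>weighted_incr v z\<bar>" for z
    proof -
      have "\<bar>G (v (fst z)) - G (v (snd z))\<bar> * sqrt (J z) \<le> L * \<bar>v (fst z) - v (snd z)\<bar> * sqrt (J z)"
        by (intro mult_right_mono lip) (simp add: J_nonneg)
      then show ?thesis by (simp add: weighted_incr_def incr_def abs_mult J_nonneg mult.assoc)
    qed
    then show "AE z in lebesgue. \<bar>weighted_incr (\<lambda>x. G (v x)) z\<bar> \<le> L * \<bar>weighted_incr v z\<bar>" by simp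
  qed (rule weighted_incr_measurable[OF m])
  moreover have "AE x in lebesgue. x \<notin> \<Omega> \<longrightarrow> G (v x) = 0"
    using v G0 by (auto simp: zero_space_def elim: eventually_mono)
  ultimately show ?thesis by (simp add: zero_space_def)
qed

definition vol :: real where "vol = measure lebesgue \<Omega>"

lemma \<Omega>_lebesgue [measurable]: "\<Omega> \<in> sets lebesgue"
  using borel_open[OF open_\<Omega>] by simp

lemma emeasure_\<Omega>: "emeasure lebesgue \<Omega> = ennreal vol"
  unfolding vol_def using bounded_\<Omega>
  by (intro emeasure_eq_ennreal_measure fmeasurableD2 bounded_set_imp_lmeasurable \<Omega>_lebesgue)

lemma vol_nonneg: "0 \<le> vol" by (simp add: vol_def)

text \<open>
  Test with \<open>\<phi> = v\<^sup>+ / (v\<^sup>+ + M)\<close>. By \<open>quotient_pointwise_bound\<close> the form is at least a multiple of \<open>M X\<close>, where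
  \<open>X\<close> is the integral of \<open>(p(x) - p(y))\<^sup>2 J / ((p(x) + M) (p(y) + M))\<close> for \<open>p = v\<^sup>+\<close>, up to a loss of
  order \<open>M A vol\<close>. The energy of \<open>\<phi>\<close> is at most \<open>X\<close>, so the assumption bounds the form by
  \<open>M sqrt X\<close>. Taking the bound \<open>M\<close> itself as the regularising constant makes \<open>M\<close> cancel, and \<open>X\<close> is
  bounded by a constant. The logarithm has energy at most \<open>X\<close> by \<open>ln_diff_sq_le\<close>.
\<close>

lemma log_estimate:
  assumes t: "0 \<le> t" "t \<le> 1" and v: "v \<in> zero_space" and M: "M > 0"
    and adj: "\<And>\<phi>. \<phi> \<in> zero_space \<Longrightarrow> 1/2 * energy \<phi> v + t * drift \<phi> v \<le> M * nrm \<phi>"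
  defines "lg \<equiv> (\<lambda>x. ln (1 + max (v x) 0 / M))"
  shows "lg \<in> zero_space" and "energy lg lg \<le> (8 * A * vol + 16) / \<theta>\<^sup>2"
proof -
  define p where "p x = max (v x) 0" for x
  define D where "D z = (p (fst z) + M) * (p (snd z) + M)" for z
  define Q where "Q z = (p (fst z) - p (snd z))\<^sup>2 / D z" for z
  define \<phi> where "\<phi> x = p x / (p x + M)" for x
  have vm [measurable]: "v \<in> borel_measurable lebesgue" by (rule zero_space_measurable[OF v])
  have pm: "p \<in> borel_measurable lebesgue" unfolding p_def[abs_def] by measurable
  have p0: "0 \<le> p x" for x by (simp add: p_def)
  have D: "M\<^sup>2 \<le> D z" for z
    unfolding D_def power2_eq_square using p0[of "fst z"] p0[of "snd z"] M by (intro mult_mono) auto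
  have D0: "0 < D z" for z using D[of z] M by (metis less_le_trans zero_less_power)
  have Q0: "0 \<le> Q z" for z using D0[of z] by (simp add: Q_def)
  have p_lip: "\<bar>max r 0 - max s 0\<bar> \<le> \<bar>r - s\<bar>" for r s :: real by (auto simp: max_def)
  have lip\<phi>: "\<bar>max r 0 / (max r 0 + M) - max s 0 / (max s 0 + M)\<bar> \<le> (1 / M) * \<bar>r - s\<bar>" for r s
  proof -
    define r' where "r' = max r 0"
    define s' where "s' = max s 0"
    have n: "0 \<le> r'" "0 \<le> s'" by (simp_all add: r'_def s'_def)
    have "r' / (r' + M) - s' / (s' + M) = M * (r' - s') / ((r' + M) * (s' + M))"
      using n M by (subst diff_frac_eq) (auto simp: algebra_simps)
    then have "\<bar>r' / (r' + M) - s' / (s' + M)\<bar> = M * \<bar>r' - s'\<bar> / ((r' + M) * (s' + M))"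
      using n M by (simp add: abs_mult)
    also have "\<dots> \<le> M * \<bar>r' - s'\<bar> / (M * M)"
      using n M by (intro divide_left_mono mult_mono mult_pos_pos mult_nonneg_nonneg) auto
    also have "\<dots> = (1 / M) * \<bar>r' - s'\<bar>" using M by simp
    also have "\<dots> \<le> (1 / M) * \<bar>r - s\<bar>"
      using M p_lip[of r s] unfolding r'_def s'_def by (intro mult_left_mono) auto
    finally show ?thesis unfolding r'_def s'_def .
  qed
  have \<phi>: "\<phi> \<in> zero_space"
  proof -
    have "(\<lambda>x. (\<lambda>r. max r 0 / (max r 0 + M)) (v x)) \<in> zero_space"
    proof (rule zero_space_compose[OF v _ _ lip\<phi>])
      show "(\<lambda>r. max r 0 / (max r 0 + M)) \<in> borel_measurable borel" by measurable
    qed simp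
    then show ?thesis by (simp add: \<phi>_def[abs_def] p_def)
  qed
  have Qm: "Q \<in> borel_measurable lebesgue"
    unfolding Q_def[abs_def] D_def
    by (intro borel_measurable_divide borel_measurable_power borel_measurable_diff borel_measurable_times
        borel_measurable_add measurable_fst_lebesgue[OF pm] measurable_snd_lebesgue[OF pm]
        borel_measurable_const)
  have Q_le: "Q z \<le> (incr v z)\<^sup>2 / M\<^sup>2" for z
  proof -
    have "(p (fst z) - p (snd z))\<^sup>2 \<le> (incr v z)\<^sup>2"
      using p_lip[of "v (fst z)" "v (snd z)"] by (simp add: p_def incr_def abs_le_square_iff)
    then show ?thesis unfolding Q_def using D[of z] M by (intro frac_le) auto
  qed
  have QJ: "integrable lebesgue (\<lambda>z. Q z * J z)"
  proof (rule Bochner_Integration.integrable_bound)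
    show "integrable lebesgue (\<lambda>z. 1 / M\<^sup>2 * (weighted_incr v z)\<^sup>2)"
      using v by (intro integrable_mult_right) (simp add: zero_space_def sq_integrable_def)
    show "(\<lambda>z. Q z * J z) \<in> borel_measurable lebesgue" by (intro borel_measurable_times Qm J_measurable)
    have "Q z * J z \<le> 1 / M\<^sup>2 * (weighted_incr v z)\<^sup>2" for z
      using mult_right_mono[OF Q_le[of z] J_nonneg[of z]] by (simp add: weighted_incr_sq)
    then show "AE z in lebesgue. norm (Q z * J z) \<le> norm (1 / M\<^sup>2 * (weighted_incr v z)\<^sup>2)"
      using Q0 J_nonneg by simp
  qed
  define X where "X = (\<integral>z. Q z * J z \<partial>lebesgue)"
  have X0: "0 \<le> X" unfolding X_def by (intro integral_nonneg_AE) (simp add: Q0 J_nonneg)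
  have energy_le_X: "energy w w \<le> X"
    if "w \<in> zero_space" and le: "\<And>z. (incr w z)\<^sup>2 \<le> Q z" for w
  proof -
    have "integrable lebesgue (\<lambda>z. (incr w z)\<^sup>2 * J z)"
      using that by (simp add: zero_space_def sq_integrable_def weighted_incr_sq)
    then show ?thesis
      unfolding energy_sq weighted_incr_sq X_def
      by (rule integral_mono[OF _ QJ]) (intro mult_right_mono le J_nonneg)
  qed
  have "energy \<phi> \<phi> \<le> X"
  proof (rule energy_le_X[OF \<phi>])
    fix z
    have "incr \<phi> z = M * (p (fst z) - p (snd z)) / D z"
      unfolding incr_def \<phi>_def D_def using M p0[of "fst z"] p0[of "snd z"]
      by (subst diff_frac_eq) (auto simp: algebra_simps)
    then have "(incr \<phi> z)\<^sup>2 = (M\<^sup>2 / D z) * Q z"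
      by (simp add: Q_def power_mult_distrib power_divide power2_eq_square[of "D z"])
    also have "\<dots> \<le> 1 * Q z" using D[of z] D0[of z] Q0 by (intro mult_right_mono) auto
    finally show "(incr \<phi> z)\<^sup>2 \<le> Q z" by simp
  qed
  then have nrm\<phi>: "nrm \<phi> \<le> sqrt X" by (simp add: nrm_def)
  define h where "h x = (if v x > 0 then 1 else 0 :: real)" for x
  have hm: "h \<in> borel_measurable lebesgue" unfolding h_def[abs_def] by measurable
  have h_nn: "(\<integral>\<^sup>+x. ennreal ((h x)\<^sup>2) \<partial>lebesgue) \<le> ennreal vol"
  proof -
    have ae: "AE x in lebesgue. x \<notin> \<Omega> \<longrightarrow> v x = 0" using v by (simp add: zero_space_def)
    have "(\<integral>\<^sup>+x. ennreal ((h x)\<^sup>2) \<partial>lebesgue) \<le> (\<integral>\<^sup>+x. indicator \<Omega> x \<partial>lebesgue)"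
      by (rule nn_integral_mono_AE, use ae in eventually_elim) (auto simp: h_def indicator_def)
    then show ?thesis by (simp add: emeasure_\<Omega>)
  qed
  have hs: "h \<in> sq_integrable lebesgue"
    using h_nn hm by (auto simp: sq_integrable_iff_nn_integral intro: le_less_trans)
  have h_int: "(\<integral>x. (h x)\<^sup>2 \<partial>lebesgue) \<le> vol"
    using h_nn vol_nonneg by (simp add: sq_integrable_nn_integral[OF hs])
  define Y where "Y = (\<integral>z. (weighted_drift h z)\<^sup>2 \<partial>lebesgue)"
  have Yi: "integrable lebesgue (\<lambda>z. (weighted_drift h z)\<^sup>2)"
    using weighted_drift_sq_integrable(1)[OF hs] by (simp add: sq_integrable_def)
  have Y: "Y \<le> A * vol"
    using weighted_drift_sq_integrable(2)[OF hs] mult_left_mono[OF h_int A_nonneg] by (simp add: Y_def)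
  define B where "B = (\<integral>z. incr \<phi> z * (incr v z * J z + t * (v (fst z) + v (snd z)) * a z) \<partial>lebesgue)"
  have "M * (\<theta> / 2 * X - 2 / \<theta> * Y) = (\<integral>z. M * (\<theta> / 2 * (Q z * J z) - 2 / \<theta> * (weighted_drift h z)\<^sup>2) \<partial>lebesgue)"
    using QJ Yi by (simp add: X_def Y_def)
  also have "\<dots> \<le> B"
    unfolding B_def
  proof (rule integral_mono_AE)
    show "integrable lebesgue (\<lambda>z. M * (\<theta> / 2 * (Q z * J z) - 2 / \<theta> * (weighted_drift h z)\<^sup>2))"
      using QJ Yi by simp
    show "integrable lebesgue (\<lambda>z. incr \<phi> z * (incr v z * J z + t * (v (fst z) + v (snd z)) * a z))"
      by (rule symmetrised_form(1)[OF \<phi> v])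
    show "AE z in lebesgue. M * (\<theta> / 2 * (Q z * J z) - 2 / \<theta> * (weighted_drift h z)\<^sup>2)
        \<le> incr \<phi> z * (incr v z * J z + t * (v (fst z) + v (snd z)) * a z)"
      using a_dominated
    proof eventually_elim
      case (elim z)
      have eq: "(weighted_drift h z)\<^sup>2 = (if v (fst z) > 0 then (a z)\<^sup>2 / J z else 0)"
        by (simp add: weighted_drift_sq h_def)
      from quotient_pointwise_bound[OF \<theta> J_nonneg elim t M, of "v (fst z)" "v (snd z)"]
      show ?case unfolding eq by (simp add: Q_def D_def \<phi>_def p_def incr_def mult.assoc)
    qed
  qed
  also have "B = 2 * (1/2 * energy \<phi> v + t * drift \<phi> v)"
    using symmetrised_form(2)[OF \<phi> v, of t] by (simp add: B_def)
  also have "\<dots> \<le> 2 * (M * nrm \<phi>)" using adj[OF \<phi>] by simp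
  also have "\<dots> \<le> M * (2 * sqrt X)" using nrm\<phi> M by simp
  finally have "\<theta> / 2 * X - 2 / \<theta> * Y \<le> 2 * sqrt X" using M by simp
  moreover have "2 * sqrt X \<le> \<theta> / 4 * X + 4 / \<theta>"
  proof -
    have "0 \<le> (\<theta> * sqrt X - 4)\<^sup>2" by simp
    then have "8 * \<theta> * sqrt X \<le> \<theta>\<^sup>2 * X + 16" using X0 by (simp add: power2_diff power_mult_distrib)
    then have "8 * \<theta> * sqrt X / (4 * \<theta>) \<le> (\<theta>\<^sup>2 * X + 16) / (4 * \<theta>)"
      using \<theta> by (intro divide_right_mono) auto
    then show ?thesis using \<theta> by (simp add: add_divide_distrib power2_eq_square)
  qed
  moreover have "2 / \<theta> * Y \<le> 2 / \<theta> * (A * vol)" using \<theta> Y by (intro mult_left_mono) auto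
  ultimately have "\<theta> / 4 * X \<le> 2 / \<theta> * (A * vol) + 4 / \<theta>" by linarith
  then have *: "4 / \<theta> * (\<theta> / 4 * X) \<le> 4 / \<theta> * (2 / \<theta> * (A * vol) + 4 / \<theta>)"
    using \<theta> by (intro mult_left_mono) auto
  have "X = 4 / \<theta> * (\<theta> / 4 * X)" using \<theta> by simp
  also note *
  also have "4 / \<theta> * (2 / \<theta> * (A * vol) + 4 / \<theta>) = (8 * A * vol + 16) / \<theta>\<^sup>2"
    using \<theta> by (simp add: field_simps power2_eq_square)
  finally have X_le: "X \<le> (8 * A * vol + 16) / \<theta>\<^sup>2" .
  have ln_le: "(ln (1 + max r 0 / M) - ln (1 + max s 0 / M))\<^sup>2
      \<le> (max r 0 - max s 0)\<^sup>2 / ((max r 0 + M) * (max s 0 + M))" for r s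
  proof -
    define r' where "r' = max r 0"
    define s' where "s' = max s 0"
    have n: "0 \<le> r'" "0 \<le> s'" by (simp_all add: r'_def s'_def)
    have e: "ln (1 + w / M) = ln (w + M) - ln M" if "0 \<le> w" for w
    proof -
      have "1 + w / M = (w + M) / M" using M by (simp add: field_simps)
      then show ?thesis using M that by (simp add: ln_div)
    qed
    show ?thesis
      using ln_diff_sq_le[of "r' + M" "s' + M"] n M e[OF n(1)] e[OF n(2)]
      by (simp add: r'_def s'_def)
  qed
  have lipl: "\<bar>ln (1 + max r 0 / M) - ln (1 + max s 0 / M)\<bar> \<le> (1 / M) * \<bar>r - s\<bar>" for r s
  proof (rule power2_le_imp_le)
    have "(max r 0 - max s 0)\<^sup>2 / ((max r 0 + M) * (max s 0 + M)) \<le> (r - s)\<^sup>2 / (M * M)"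
      using M p_lip[of r s] by (intro frac_le mult_mono) (auto simp: abs_le_square_iff)
    with ln_le[of r s] show "\<bar>ln (1 + max r 0 / M) - ln (1 + max s 0 / M)\<bar>\<^sup>2 \<le> ((1 / M) * \<bar>r - s\<bar>)\<^sup>2"
      by (simp add: power_mult_distrib power_divide power2_eq_square[of M])
  qed (use M in simp)
  show l: "lg \<in> zero_space"
    unfolding lg_def
  proof (rule zero_space_compose[OF v _ _ lipl])
    show "(\<lambda>r. ln (1 + max r 0 / M)) \<in> borel_measurable borel" by measurable
  qed simp
  have "energy lg lg \<le> X"
    by (rule energy_le_X[OF l]) (use ln_le in \<open>simp add: incr_def lg_def Q_def D_def p_def\<close>)
  then show "energy lg lg \<le> (8 * A * vol + 16) / \<theta>\<^sup>2" using X_le by simp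
qed

text \<open>
  Chebyshev's inequality for the logarithm, whose \<open>L\<^sup>2\<close> norm is bounded by the Poincare inequality.
\<close>

lemma superlevel_measure:
  assumes CP: "\<And>u. u \<in> zero_space \<Longrightarrow> (\<integral>x. (u x)\<^sup>2 \<partial>lebesgue) \<le> CP * energy u u" "CP > 0"
    and t: "0 \<le> t" "t \<le> 1" and v: "v \<in> zero_space" and M: "M > 0" and T: "T > 0"
    and adj: "\<And>\<phi>. \<phi> \<in> zero_space \<Longrightarrow> 1/2 * energy \<phi> v + t * drift \<phi> v \<le> M * nrm \<phi>"
  shows "emeasure lebesgue {x. v x > M * T} \<le> ennreal (CP * ((8 * A * vol + 16) / \<theta>\<^sup>2) / (ln (1 + T))\<^sup>2)"
proof -
  define l where "l x = ln (1 + max (v x) 0 / M)" for x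
  have l: "l \<in> zero_space" and el: "energy l l \<le> (8 * A * vol + 16) / \<theta>\<^sup>2"
    using log_estimate[OF t v M adj] by (simp_all add: l_def[abs_def])
  have vm [measurable]: "v \<in> borel_measurable lebesgue" by (rule zero_space_measurable[OF v])
  have ls: "l \<in> sq_integrable lebesgue" using l by (simp add: zero_space_def)
  have lT: "0 < ln (1 + T)" using T by simp
  define k where "k = 1 / (ln (1 + T))\<^sup>2"
  have k: "0 \<le> k" by (simp add: k_def)
  have "emeasure lebesgue {x. v x > M * T} = (\<integral>\<^sup>+x. indicator {x. v x > M * T} x \<partial>lebesgue)"
  proof -
    have "{x \<in> space lebesgue. v x > M * T} \<in> sets lebesgue" by measurable
    then show ?thesis by simp
  qed
  also have "\<dots> \<le> (\<integral>\<^sup>+x. ennreal (k * (l x)\<^sup>2) \<partial>lebesgue)"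
  proof (rule nn_integral_mono)
    fix x
    show "indicator {x. v x > M * T} x \<le> ennreal (k * (l x)\<^sup>2)"
    proof (cases "v x > M * T")
      case True
      then have "T \<le> max (v x) 0 / M" using M by (simp add: field_simps max_def)
      then have "ln (1 + T) \<le> l x" unfolding l_def using T by (subst ln_le_cancel_iff) auto
      then have "(ln (1 + T))\<^sup>2 \<le> (l x)\<^sup>2" using lT by (intro power_mono) auto
      then have "1 \<le> k * (l x)\<^sup>2" using lT by (simp add: k_def)
      then show ?thesis using True by simp
    qed simp
  qed
  also have "\<dots> = ennreal (k * (\<integral>x. (l x)\<^sup>2 \<partial>lebesgue))"
    using ls k by (subst nn_integral_eq_integral) (auto simp: sq_integrable_def)
  also have "\<dots> \<le> ennreal (k * (CP * ((8 * A * vol + 16) / \<theta>\<^sup>2)))"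
    using CP(1)[OF l] mult_left_mono[OF el, of CP] CP(2) k by (intro ennreal_leI mult_left_mono) auto
  also have "k * (CP * ((8 * A * vol + 16) / \<theta>\<^sup>2)) = CP * ((8 * A * vol + 16) / \<theta>\<^sup>2) / (ln (1 + T))\<^sup>2"
    by (simp add: k_def)
  finally show ?thesis .
qed

text \<open>
  Apply \<open>superlevel_measure\<close> to \<open>v\<close> and to \<open>-v\<close> and choose \<open>T\<close> so large that \<open>\<bar>v\<bar> > M T\<close> holds only
  on a set to which \<open>energy_small_sets\<close> applies with a small factor \<open>\<delta>\<close>. Off this set \<open>v\<^sup>2\<close> is at most \<open>(M T)\<^sup>2\<close>,
  hence \<open>\<integral> v\<^sup>2 \<le> \<delta> energy v v + (M T)\<^sup>2 vol\<close>. Testing with \<open>v\<close> bounds the energy by multiples of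
  \<open>M\<^sup>2\<close> and of \<open>A \<integral> v\<^sup>2\<close>, and \<open>\<delta>\<close> is chosen such that the energy on the right can be absorbed.
\<close>

lemma adjoint_estimate:
  obtains C where "\<And>t v M. \<lbrakk>0 \<le> t; t \<le> 1; v \<in> zero_space; M \<ge> 0;
      \<And>\<phi>. \<phi> \<in> zero_space \<Longrightarrow> \<bar>1/2 * energy \<phi> v + t * drift \<phi> v\<bar> \<le> M * nrm \<phi>\<rbrakk> \<Longrightarrow> nrm v \<le> C * M"
proof -
  obtain CP where CP: "CP > 0" "\<And>u. u \<in> zero_space \<Longrightarrow> (\<integral>x. (u x)\<^sup>2 \<partial>lebesgue) \<le> CP * energy u u"
    using Poincare by blast
  (* the factor that makes 8 A \<delta> at most 1/2 in the absorption at the end *)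
  define \<delta> where "\<delta> = 1 / (16 * (A + 1))"
  have \<delta>: "\<delta> > 0" using A_nonneg by (simp add: \<delta>_def)
  have A\<delta>: "8 * A * \<delta> \<le> 1/2" using A_nonneg by (simp add: \<delta>_def field_simps)
  obtain \<tau> where \<tau>: "\<tau> > 0" and small: "\<And>u T. \<lbrakk>u \<in> zero_space; T \<in> sets lebesgue; emeasure lebesgue T \<le> ennreal \<tau>\<rbrakk>
      \<Longrightarrow> (\<integral>x. indicator T x * (u x)\<^sup>2 \<partial>lebesgue) \<le> \<delta> * energy u u"
    using energy_small_sets[OF \<delta>] by blast
  define K where "K = CP * ((8 * A * vol + 16) / \<theta>\<^sup>2)"
  have K: "0 \<le> K" using CP(1) A_nonneg vol_nonneg by (simp add: K_def)
  (* T is such that K / (ln (1 + T))^2, the bound on each of the two level sets, is at most \<tau> / 2;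
     the summand 1 keeps T positive if K = 0 *)
  define T where "T = exp (sqrt (2 * K / \<tau>) + 1) - 1"
  have lnT: "ln (1 + T) = sqrt (2 * K / \<tau>) + 1" by (simp add: T_def)
  have "0 < sqrt (2 * K / \<tau>) + 1" using K \<tau> by (simp add: add_nonneg_pos)
  then have T: "T > 0" by (simp add: T_def)
  have K\<tau>: "K / (ln (1 + T))\<^sup>2 \<le> \<tau> / 2"
  proof -
    have s: "0 \<le> sqrt (2 * K / \<tau>)" using K \<tau> by simp
    have "2 * K / \<tau> = (sqrt (2 * K / \<tau>))\<^sup>2" using K \<tau> by simp
    also have "\<dots> \<le> (ln (1 + T))\<^sup>2" unfolding lnT using s by (intro power_mono) auto
    finally have "2 * K / \<tau> \<le> (ln (1 + T))\<^sup>2" .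
    moreover have "0 < (ln (1 + T))\<^sup>2" using T by simp
    ultimately show ?thesis using \<tau> by (simp add: field_simps)
  qed
  define C where "C = 4 * sqrt (1 + A * (T\<^sup>2 * vol))"
  have AV: "0 \<le> A * (T\<^sup>2 * vol)" using A_nonneg vol_nonneg by simp
  have C0: "0 \<le> C" using AV by (simp add: C_def)
  have pos: "nrm v \<le> C * M"
    if t: "0 \<le> t" "t \<le> 1" and v: "v \<in> zero_space" and M: "M > 0"
      and adj: "\<And>\<phi>. \<phi> \<in> zero_space \<Longrightarrow> \<bar>1/2 * energy \<phi> v + t * drift \<phi> v\<bar> \<le> M * nrm \<phi>" for t v M
  proof -
    have vm [measurable]: "v \<in> borel_measurable lebesgue" by (rule zero_space_measurable[OF v])
    have vs: "v \<in> sq_integrable lebesgue" using v by (simp add: zero_space_def)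
    define v' where "v' x = (-1) * v x" for x
    have v': "v' \<in> zero_space" unfolding v'_def[abs_def] by (rule scale_mem[OF v])
    have v'm [measurable]: "v' \<in> borel_measurable lebesgue" by (rule zero_space_measurable[OF v'])
    have "1/2 * energy \<phi> v' + t * drift \<phi> v' = - (1/2 * energy \<phi> v + t * drift \<phi> v)" if "\<phi> \<in> zero_space" for \<phi>
    proof -
      have "energy \<phi> v' = (-1) * energy \<phi> v" unfolding v'_def[abs_def] by (rule ip_scale_right[OF v that])
      moreover have "drift \<phi> v' = (-1) * drift \<phi> v"
        unfolding v'_def[abs_def] using bounded_form_drift v that unfolding bounded_form_def by blast
      ultimately show ?thesis by simp
    qed
    then have adj': "1/2 * energy \<phi> v' + t * drift \<phi> v' \<le> M * nrm \<phi>" if "\<phi> \<in> zero_space" for \<phi>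
      using adj[OF that] that by simp
    have adj1: "1/2 * energy \<phi> v + t * drift \<phi> v \<le> M * nrm \<phi>" if "\<phi> \<in> zero_space" for \<phi>
      using adj[OF that] by linarith
    define U where "U = {x. v x > M * T} \<union> {x. v' x > M * T}"
    have Us: "{x. v x > M * T} \<in> sets lebesgue" "{x. v' x > M * T} \<in> sets lebesgue"
    proof -
      have "{x \<in> space lebesgue. v x > M * T} \<in> sets lebesgue" "{x \<in> space lebesgue. v' x > M * T} \<in> sets lebesgue"
        by measurable
      then show "{x. v x > M * T} \<in> sets lebesgue" "{x. v' x > M * T} \<in> sets lebesgue" by simp_all
    qed
    then have U [measurable]: "U \<in> sets lebesgue" unfolding U_def by blast
    have "emeasure lebesgue U \<le> emeasure lebesgue {x. v x > M * T} + emeasure lebesgue {x. v' x > M * T}"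
      unfolding U_def by (rule emeasure_subadditive[OF Us])
    also have "\<dots> \<le> ennreal (\<tau> / 2) + ennreal (\<tau> / 2)"
    proof (rule add_mono)
      show "emeasure lebesgue {x. v x > M * T} \<le> ennreal (\<tau> / 2)"
        using superlevel_measure[OF CP(2,1) t v M T adj1] ennreal_leI[OF K\<tau>]
        unfolding K_def by (rule order_trans)
      show "emeasure lebesgue {x. v' x > M * T} \<le> ennreal (\<tau> / 2)"
        using superlevel_measure[OF CP(2,1) t v' M T adj'] ennreal_leI[OF K\<tau>]
        unfolding K_def by (rule order_trans)
    qed
    also have "\<dots> = ennreal \<tau>" using \<tau> by (simp add: ennreal_plus[symmetric])
    finally have U_small: "(\<integral>x. indicator U x * (v x)\<^sup>2 \<partial>lebesgue) \<le> \<delta> * energy v v"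
      by (rule small[OF v U])
    define m where "m = (\<integral>x. (v x)\<^sup>2 \<partial>lebesgue)"
    have m0: "0 \<le> m" by (simp add: m_def)
    have v2i: "integrable lebesgue (\<lambda>x. (v x)\<^sup>2)" using vs by (simp add: sq_integrable_def)
    have Ui: "integrable lebesgue (\<lambda>x. indicator U x * (v x)\<^sup>2)"
      using integrable_mult_indicator[OF U v2i] by simp
    have \<Omega>i: "integrable lebesgue (\<lambda>x. (M * T)\<^sup>2 * indicator \<Omega> x)"
      using emeasure_\<Omega> by (intro integrable_mult_right) (simp add: integrable_indicator_iff)
    have "m \<le> (\<integral>x. indicator U x * (v x)\<^sup>2 + (M * T)\<^sup>2 * indicator \<Omega> x \<partial>lebesgue)"
      unfolding m_def
    proof (rule integral_mono_AE[OF v2i Bochner_Integration.integrable_add[OF Ui \<Omega>i]])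
      have ae: "AE x in lebesgue. x \<notin> \<Omega> \<longrightarrow> v x = 0" using v by (simp add: zero_space_def)
      then show "AE x in lebesgue. (v x)\<^sup>2 \<le> indicator U x * (v x)\<^sup>2 + (M * T)\<^sup>2 * indicator \<Omega> x"
      proof eventually_elim
        case (elim x)
        show ?case
        proof (cases "x \<in> U \<or> x \<notin> \<Omega>")
          case True then show ?thesis using elim by (auto simp: indicator_def)
        next
          case False
          then have "\<bar>v x\<bar> \<le> M * T" by (auto simp: U_def v'_def)
          then have "(v x)\<^sup>2 \<le> (M * T)\<^sup>2" using abs_le_square_iff[of "v x" "M * T"] by linarith
          then show ?thesis using False by (simp add: indicator_def)
        qed
      qed
    qed
    also have "\<dots> = (\<integral>x. indicator U x * (v x)\<^sup>2 \<partial>lebesgue) + (M * T)\<^sup>2 * vol"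
      using Ui \<Omega>i by (simp add: vol_def)
    also have "\<dots> \<le> \<delta> * energy v v + (M * T)\<^sup>2 * vol" using U_small by simp
    finally have m_le: "m \<le> \<delta> * energy v v + (M * T)\<^sup>2 * vol" .
    define e where "e = nrm v"
    have e0: "0 \<le> e" using v by (simp add: e_def)
    have e2: "e\<^sup>2 = energy v v" unfolding e_def by (rule nrm_sq[OF v])
    have "1/2 * e\<^sup>2 \<le> M * e + e * sqrt (A * m)"
    proof -
      have "\<bar>t * drift v v\<bar> \<le> \<bar>drift v v\<bar>"
        using t mult_right_mono[of t 1 "\<bar>drift v v\<bar>"] by (simp add: abs_mult)
      also have "\<dots> \<le> e * sqrt (A * m)" using drift_bound[OF v v] by (simp add: e_def m_def)
      finally show ?thesis using adj1[OF v] unfolding e2 by (simp add: e_def)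
    qed
    then have "e * e \<le> e * (2 * (M + sqrt (A * m)))" by (simp add: power2_eq_square algebra_simps)
    then have "e \<le> 2 * (M + sqrt (A * m))"
    proof (cases "e = 0")
      case True
      have "0 \<le> sqrt (A * m)" using A_nonneg m0 by simp
      then show ?thesis using True M by simp
    next
      case False
      then show ?thesis using e0 \<open>e * e \<le> _\<close> by (simp add: mult_le_cancel_left)
    qed
    then have "e\<^sup>2 \<le> (2 * (M + sqrt (A * m)))\<^sup>2" using e0 by (intro power_mono)
    also have "\<dots> \<le> 8 * M\<^sup>2 + 8 * (A * m)"
    proof -
      have "0 \<le> (M - sqrt (A * m))\<^sup>2" by simp
      then show ?thesis using A_nonneg m0 by (simp add: power2_diff power2_sum power_mult_distrib)
    qed
    also have "8 * (A * m) \<le> 8 * (A * (\<delta> * energy v v + (M * T)\<^sup>2 * vol))"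
      by (intro mult_left_mono m_le A_nonneg) simp
    also have "\<dots> = (8 * A * \<delta>) * e\<^sup>2 + 8 * (A * (T\<^sup>2 * vol)) * M\<^sup>2"
      by (simp add: e2 power_mult_distrib algebra_simps)
    also have "(8 * A * \<delta>) * e\<^sup>2 \<le> 1/2 * e\<^sup>2" by (rule mult_right_mono[OF A\<delta>]) simp
    finally have "e\<^sup>2 \<le> 16 * (1 + A * (T\<^sup>2 * vol)) * M\<^sup>2" by (simp add: algebra_simps)
    also have "\<dots> = (C * M)\<^sup>2" using AV by (simp add: C_def power_mult_distrib)
    finally have le: "e\<^sup>2 \<le> (C * M)\<^sup>2" .
    have "e \<le> C * M" by (rule power2_le_imp_le[OF le]) (use C0 M in simp)
    then show ?thesis by (simp add: e_def)
  qed
  show thesis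
  proof (rule that)
    fix t v M
    assume t: "0 \<le> t" "t \<le> 1" and v: "v \<in> zero_space" and M: "M \<ge> (0::real)"
      and adj: "\<And>\<phi>. \<phi> \<in> zero_space \<Longrightarrow> \<bar>1/2 * energy \<phi> v + t * drift \<phi> v\<bar> \<le> M * nrm \<phi>"
    (* the case M = 0 is a limit of positive M *)
    have le: "nrm v \<le> C * (M + e)" if "e > 0" for e
    proof (rule pos[OF t v])
      fix \<phi> assume "\<phi> \<in> zero_space"
      then have "M * nrm \<phi> \<le> (M + e) * nrm \<phi>" using that by (intro mult_right_mono) auto
      then show "\<bar>1/2 * energy \<phi> v + t * drift \<phi> v\<bar> \<le> (M + e) * nrm \<phi>"
        using adj[OF \<open>\<phi> \<in> zero_space\<close>] by linarith
    qed (use M that in simp)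
    show "nrm v \<le> C * M"
    proof (rule field_le_epsilon)
      fix e :: real assume e: "e > 0"
      have "nrm v \<le> C * (M + e / (C + 1))" using C0 e by (intro le) simp
      also have "\<dots> = C * M + C / (C + 1) * e" by (simp add: algebra_simps)
      also have "C / (C + 1) * e \<le> 1 * e" using C0 e by (intro mult_right_mono) auto
      finally show "nrm v \<le> C * M + e" by simp
    qed
  qed
qed

lemma solvability:
  "bounded_functional f \<Longrightarrow> \<exists>u\<in>zero_space. \<forall>\<phi>\<in>zero_space. 1/2 * energy u \<phi> + drift u \<phi> = f \<phi>"
  "\<lbrakk>u \<in> zero_space; \<And>\<phi>. \<phi> \<in> zero_space \<Longrightarrow> 1/2 * energy u \<phi> + drift u \<phi> = 0\<rbrakk> \<Longrightarrow> energy u u = 0"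
proof -
  obtain C where C: "\<And>t v M. \<lbrakk>0 \<le> t; t \<le> 1; v \<in> zero_space; M \<ge> 0;
      \<And>\<phi>. \<phi> \<in> zero_space \<Longrightarrow> \<bar>1/2 * energy \<phi> v + t * drift \<phi> v\<bar> \<le> M * nrm \<phi>\<rbrakk> \<Longrightarrow> nrm v \<le> C * M"
    using adjoint_estimate by blast
  have *: "(\<forall>f. bounded_functional f \<longrightarrow> (\<exists>u\<in>zero_space. \<forall>\<phi>\<in>zero_space. 1/2 * energy u \<phi> + drift u \<phi> = f \<phi>)) \<and>
         (\<forall>u\<in>zero_space. (\<forall>\<phi>\<in>zero_space. 1/2 * energy u \<phi> + drift u \<phi> = 0) \<longrightarrow> energy u u = 0)"
    by (rule inf_sup_solvability[OF bounded_form_drift C])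
  show "\<exists>u\<in>zero_space. \<forall>\<phi>\<in>zero_space. 1/2 * energy u \<phi> + drift u \<phi> = f \<phi>" if "bounded_functional f"
    using conjunct1[OF *] that by (elim allE impE)
  show "energy u u = 0" if "u \<in> zero_space" "\<And>\<phi>. \<phi> \<in> zero_space \<Longrightarrow> 1/2 * energy u \<phi> + drift u \<phi> = 0"
    using bspec[OF conjunct2[OF *] that(1)] that(2) by simp
qed

section \<open>Existence, uniqueness and estimate of weak solutions\<close>

text \<open>
  The norm of \<open>V(\<Omega>; k)\<close> controls the increments whose first end lies in \<open>\<Omega>\<close>, and by symmetry of \<open>J\<close> those
  with at least one end in \<open>\<Omega>\<close>, collected in \<open>touching_incr\<close>. Increments of functions in \<open>zero_space\<close>
  vanish between two points outside \<open>\<Omega>\<close>. Therefore energy and drift are defined, and bounded, for a first argument in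
  \<open>data_space\<close> and a second one in \<open>zero_space\<close>.
\<close>

definition inner_incr :: "('a \<Rightarrow> real) \<Rightarrow> 'a \<times> 'a \<Rightarrow> real" where
  "inner_incr u z = indicator \<Omega> (fst z) * weighted_incr u z"

definition data_space :: "('a \<Rightarrow> real) set" where
  "data_space = {u \<in> borel_measurable lebesgue.
     (\<lambda>x. indicator \<Omega> x * u x) \<in> sq_integrable lebesgue \<and> inner_incr u \<in> sq_integrable lebesgue}"

definition inner_energy :: "('a \<Rightarrow> real) \<Rightarrow> real" where
  "inner_energy u = (\<integral>z. (inner_incr u z)\<^sup>2 \<partial>lebesgue)"

definition touching_incr :: "('a \<Rightarrow> real) \<Rightarrow> 'a \<times> 'a \<Rightarrow> real" where
  "touching_incr u z = (if fst z \<in> \<Omega> \<or> snd z \<in> \<Omega> then weighted_incr u z else 0)"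

lemma weighted_incr_swap: "weighted_incr u (prod.swap z) = - weighted_incr u z"
  by (simp add: weighted_incr_def incr_def J_swap algebra_simps)

lemma indicator_\<Omega>_measurable: "(indicator \<Omega> :: 'a \<Rightarrow> real) \<in> borel_measurable lebesgue"
  by (rule borel_measurable_indicator[OF \<Omega>_lebesgue])

lemma inner_incr_measurable: "u \<in> borel_measurable lebesgue \<Longrightarrow> inner_incr u \<in> borel_measurable lebesgue"
  unfolding inner_incr_def[abs_def]
  by (intro borel_measurable_times measurable_fst_lebesgue indicator_\<Omega>_measurable weighted_incr_measurable)

lemma touching_incr_measurable: 
  assumes u: "u \<in> borel_measurable lebesgue"
  shows "touching_incr u \<in> borel_measurable lebesgue"
proof -
  have eq: "touching_incr u = (\<lambda>z. (indicator \<Omega> (fst z) + indicator \<Omega> (snd z)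
      - indicator \<Omega> (fst z) * indicator \<Omega> (snd z)) * weighted_incr u z)"
    by (auto simp: touching_incr_def indicator_def)
  show ?thesis unfolding eq
    by (intro borel_measurable_times borel_measurable_diff borel_measurable_add measurable_fst_lebesgue
        measurable_snd_lebesgue indicator_\<Omega>_measurable weighted_incr_measurable u)
qed

lemma touching_incr_sq_integrable:
  assumes u: "u \<in> data_space"
  shows "touching_incr u \<in> sq_integrable lebesgue" "(\<integral>z. (touching_incr u z)\<^sup>2 \<partial>lebesgue) \<le> 2 * inner_energy u"
proof -
  have um: "u \<in> borel_measurable lebesgue" using u by (simp add: data_space_def)
  have i: "integrable lebesgue (\<lambda>z. (inner_incr u z)\<^sup>2)" using u by (simp add: data_space_def sq_integrable_def)
  note i' = integrable_lebesgue_swap[OF i]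
  have le: "(touching_incr u z)\<^sup>2 \<le> (inner_incr u z)\<^sup>2 + (inner_incr u (prod.swap z))\<^sup>2" for z
    by (auto simp: touching_incr_def inner_incr_def weighted_incr_swap indicator_def)
  have ci: "integrable lebesgue (\<lambda>z. (touching_incr u z)\<^sup>2)"
    by (rule Bochner_Integration.integrable_bound[OF Bochner_Integration.integrable_add[OF i i']])
       (use le touching_incr_measurable[OF um] in auto)
  then show "touching_incr u \<in> sq_integrable lebesgue" using touching_incr_measurable[OF um] by (simp add: sq_integrable_def)
  have "(\<integral>z. (touching_incr u z)\<^sup>2 \<partial>lebesgue) \<le> (\<integral>z. (inner_incr u z)\<^sup>2 + (inner_incr u (prod.swap z))\<^sup>2 \<partial>lebesgue)"
    by (rule integral_mono[OF ci Bochner_Integration.integrable_add[OF i i'] le])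
  also have "\<dots> = 2 * inner_energy u"
    using i i' integral_lebesgue_swap[OF borel_measurable_integrable[OF i]] by (simp add: inner_energy_def)
  finally show "(\<integral>z. (touching_incr u z)\<^sup>2 \<partial>lebesgue) \<le> 2 * inner_energy u" .
qed

lemma AE_energy_data_space:
  assumes \<phi>: "\<phi> \<in> zero_space"
  shows "AE z in lebesgue. incr u z * incr \<phi> z * J z = touching_incr u z * weighted_incr \<phi> z"
proof -
  have ae: "AE x in lebesgue. x \<notin> \<Omega> \<longrightarrow> \<phi> x = 0" using \<phi> by (simp add: zero_space_def)
  show ?thesis
    using AE_lebesgue_fst[OF ae, where 'b='a] AE_lebesgue_snd[OF ae, where 'a='a]
  proof eventually_elim
    case (elim z)
    then show ?case
      by (cases "fst z \<in> \<Omega> \<or> snd z \<in> \<Omega>") (auto simp: weighted_incr_mult[symmetric] touching_incr_def, simp add: weighted_incr_def incr_def)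
  qed
qed

lemma AE_drift_data_space:
  assumes \<phi>: "\<phi> \<in> zero_space"
  shows "AE z in lebesgue. incr u z * \<phi> (fst z) * a z = inner_incr u z * weighted_drift \<phi> z"
proof -
  have ae: "AE x in lebesgue. x \<notin> \<Omega> \<longrightarrow> \<phi> x = 0" using \<phi> by (simp add: zero_space_def)
  show ?thesis
    using AE_lebesgue_fst[OF ae, where 'b='a] AE_drift_factor[of u \<phi>]
  proof eventually_elim
    case (elim z)
    then show ?case by (cases "fst z \<in> \<Omega>") (auto simp: inner_incr_def weighted_drift_def)
  qed
qed

lemma energy_data_space:
  assumes u: "u \<in> data_space" and \<phi>: "\<phi> \<in> zero_space"
  shows "integrable lebesgue (\<lambda>z. incr u z * incr \<phi> z * J z)"
    and "\<bar>energy u \<phi>\<bar> \<le> sqrt (2 * inner_energy u) * nrm \<phi>"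
proof -
  have um: "u \<in> borel_measurable lebesgue" using u by (simp add: data_space_def)
  have \<phi>m: "\<phi> \<in> borel_measurable lebesgue" by (rule zero_space_measurable[OF \<phi>])
  have \<phi>s: "weighted_incr \<phi> \<in> sq_integrable lebesgue" using \<phi> by (simp add: zero_space_def)
  have m: "(\<lambda>z. incr u z * incr \<phi> z * J z) \<in> borel_measurable lebesgue"
    by (intro borel_measurable_times incr_measurable um \<phi>m J_measurable)
  have i: "integrable lebesgue (\<lambda>z. touching_incr u z * weighted_incr \<phi> z)"
    by (rule integrable_mult_sq_integrable[OF touching_incr_sq_integrable(1)[OF u] \<phi>s])
  show "integrable lebesgue (\<lambda>z. incr u z * incr \<phi> z * J z)"
    using integrable_cong_AE[OF m borel_measurable_integrable[OF i] AE_energy_data_space[OF \<phi>]] i by blast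
  have "energy u \<phi> = (\<integral>z. touching_incr u z * weighted_incr \<phi> z \<partial>lebesgue)"
    unfolding energy_eq by (rule integral_cong_AE[OF m borel_measurable_integrable[OF i] AE_energy_data_space[OF \<phi>]])
  also have "\<bar>\<dots>\<bar> \<le> sqrt (\<integral>z. (touching_incr u z)\<^sup>2 \<partial>lebesgue) * nrm \<phi>"
    using L2_Cauchy_Schwarz[OF touching_incr_sq_integrable(1)[OF u] \<phi>s] by (simp add: nrm_def energy_sq)
  also have "\<dots> \<le> sqrt (2 * inner_energy u) * nrm \<phi>"
    using \<phi> by (intro mult_right_mono real_sqrt_le_mono touching_incr_sq_integrable u) simp
  finally show "\<bar>energy u \<phi>\<bar> \<le> sqrt (2 * inner_energy u) * nrm \<phi>" .
qed

lemma drift_data_space: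
  assumes u: "u \<in> data_space" and \<phi>: "\<phi> \<in> zero_space"
  shows "integrable lebesgue (\<lambda>z. incr u z * \<phi> (fst z) * a z)"
    and "\<bar>drift u \<phi>\<bar> \<le> sqrt (inner_energy u) * sqrt (A * (\<integral>x. (\<phi> x)\<^sup>2 \<partial>lebesgue))"
proof -
  have um: "u \<in> borel_measurable lebesgue" using u by (simp add: data_space_def)
  have us: "inner_incr u \<in> sq_integrable lebesgue" using u by (simp add: data_space_def)
  have \<phi>m: "\<phi> \<in> borel_measurable lebesgue" by (rule zero_space_measurable[OF \<phi>])
  have \<phi>s: "\<phi> \<in> sq_integrable lebesgue" using \<phi> by (simp add: zero_space_def)
  note m = drift_integrand_measurable[OF um \<phi>m]
  have i: "integrable lebesgue (\<lambda>z. inner_incr u z * weighted_drift \<phi> z)"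
    by (rule integrable_mult_sq_integrable[OF us weighted_drift_sq_integrable(1)[OF \<phi>s]])
  show "integrable lebesgue (\<lambda>z. incr u z * \<phi> (fst z) * a z)"
    using integrable_cong_AE[OF m borel_measurable_integrable[OF i] AE_drift_data_space[OF \<phi>]] i by blast
  have "drift u \<phi> = (\<integral>z. inner_incr u z * weighted_drift \<phi> z \<partial>lebesgue)"
    unfolding drift_def by (rule integral_cong_AE[OF m borel_measurable_integrable[OF i] AE_drift_data_space[OF \<phi>]])
  also have "\<bar>\<dots>\<bar> \<le> sqrt (inner_energy u) * sqrt (\<integral>z. (weighted_drift \<phi> z)\<^sup>2 \<partial>lebesgue)"
    using L2_Cauchy_Schwarz[OF us weighted_drift_sq_integrable(1)[OF \<phi>s]] by (simp add: inner_energy_def)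
  also have "\<dots> \<le> sqrt (inner_energy u) * sqrt (A * (\<integral>x. (\<phi> x)\<^sup>2 \<partial>lebesgue))"
    by (intro mult_left_mono real_sqrt_le_mono weighted_drift_sq_integrable \<phi>s) (simp add: inner_energy_def)
  finally show "\<bar>drift u \<phi>\<bar> \<le> sqrt (inner_energy u) * sqrt (A * (\<integral>x. (\<phi> x)\<^sup>2 \<partial>lebesgue))" .
qed

definition weak_form :: "('a \<Rightarrow> real) \<Rightarrow> ('a \<Rightarrow> real) \<Rightarrow> real" where
  "weak_form u v = 1/2 * energy u v + drift u v"

lemma weak_form_add_left:
  assumes u: "u \<in> data_space" and v: "v \<in> data_space" and \<phi>: "\<phi> \<in> zero_space"
  shows "weak_form (\<lambda>x. u x + v x) \<phi> = weak_form u \<phi> + weak_form v \<phi>"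
proof -
  have "energy (\<lambda>x. u x + v x) \<phi> = (\<integral>z. incr u z * incr \<phi> z * J z + incr v z * incr \<phi> z * J z \<partial>lebesgue)"
    unfolding energy_eq by (simp add: incr_def algebra_simps)
  also have "\<dots> = energy u \<phi> + energy v \<phi>"
    unfolding energy_eq by (intro Bochner_Integration.integral_add energy_data_space u v \<phi>)
  finally have 1: "energy (\<lambda>x. u x + v x) \<phi> = energy u \<phi> + energy v \<phi>" .
  have "drift (\<lambda>x. u x + v x) \<phi> = (\<integral>z. incr u z * \<phi> (fst z) * a z + incr v z * \<phi> (fst z) * a z \<partial>lebesgue)"
    unfolding drift_def by (simp add: incr_def algebra_simps)
  also have "\<dots> = drift u \<phi> + drift v \<phi>"
    unfolding drift_def by (intro Bochner_Integration.integral_add drift_data_space u v \<phi>)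
  finally show ?thesis using 1 by (simp add: weak_form_def)
qed

lemma weak_form_bounded_functional:
  assumes g: "g \<in> data_space"
  shows "bounded_functional (weak_form g)"
proof -
  obtain CP where CP: "CP > 0" "\<And>u. u \<in> zero_space \<Longrightarrow> (\<integral>x. (u x)\<^sup>2 \<partial>lebesgue) \<le> CP * energy u u"
    using Poincare by blast
  have "\<bar>weak_form g \<phi>\<bar> \<le> (1/2 * sqrt (2 * inner_energy g) + sqrt (inner_energy g) * sqrt (A * CP)) * nrm \<phi>"
    if \<phi>: "\<phi> \<in> zero_space" for \<phi>
  proof -
    have "sqrt (A * (\<integral>x. (\<phi> x)\<^sup>2 \<partial>lebesgue)) \<le> sqrt (A * CP) * nrm \<phi>"
      using mult_left_mono[OF CP(2)[OF \<phi>] A_nonneg]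
      by (simp add: nrm_def real_sqrt_mult[symmetric] mult.assoc)
    then have "sqrt (inner_energy g) * sqrt (A * (\<integral>x. (\<phi> x)\<^sup>2 \<partial>lebesgue)) \<le> sqrt (inner_energy g) * (sqrt (A * CP) * nrm \<phi>)"
      by (intro mult_left_mono) (simp_all add: inner_energy_def)
    then show ?thesis
      using energy_data_space(2)[OF g \<phi>] drift_data_space(2)[OF g \<phi>]
      unfolding weak_form_def by (simp add: distrib_right)
  qed
  moreover have "weak_form g (\<lambda>x. u x + v x) = weak_form g u + weak_form g v" if u: "u \<in> zero_space" and v: "v \<in> zero_space" for u v
  proof -
    have "energy g (\<lambda>x. u x + v x) = (\<integral>z. incr g z * incr u z * J z + incr g z * incr v z * J z \<partial>lebesgue)"
      unfolding energy_eq by (simp add: incr_def algebra_simps)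
    also have "\<dots> = energy g u + energy g v"
      unfolding energy_eq by (intro Bochner_Integration.integral_add energy_data_space u v g)
    finally have 1: "energy g (\<lambda>x. u x + v x) = energy g u + energy g v" .
    have "drift g (\<lambda>x. u x + v x) = (\<integral>z. incr g z * u (fst z) * a z + incr g z * v (fst z) * a z \<partial>lebesgue)"
      unfolding drift_def by (simp add: algebra_simps)
    also have "\<dots> = drift g u + drift g v"
      unfolding drift_def by (intro Bochner_Integration.integral_add drift_data_space u v g)
    finally show ?thesis using 1 by (simp add: weak_form_def)
  qed
  moreover have "weak_form g (\<lambda>x. k * u x) = k * weak_form g u" for k u
  proof -
    have "energy g (\<lambda>x. k * u x) = (\<integral>z. k * (incr g z * incr u z * J z) \<partial>lebesgue)"
      unfolding energy_eq by (simp add: incr_def algebra_simps)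
    moreover have "drift g (\<lambda>x. k * u x) = (\<integral>z. k * (incr g z * u (fst z) * a z) \<partial>lebesgue)"
      unfolding drift_def by (simp add: algebra_simps)
    ultimately show ?thesis by (simp add: weak_form_def energy_eq drift_def algebra_simps)
  qed
  ultimately show ?thesis unfolding bounded_functional_def by blast
qed

lemma inner_incr_add: "inner_incr (\<lambda>x. u x + v x) z = inner_incr u z + inner_incr v z"
  by (simp add: inner_incr_def weighted_incr_add algebra_simps)

lemma zero_space_data_space:
  assumes w: "w \<in> zero_space"
  shows "w \<in> data_space" "inner_energy w \<le> energy w w"
proof -
  have wm: "w \<in> borel_measurable lebesgue" by (rule zero_space_measurable[OF w])
  have ws: "w \<in> sq_integrable lebesgue" "weighted_incr w \<in> sq_integrable lebesgue" using w by (auto simp: zero_space_def)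
  have d: "inner_incr w \<in> sq_integrable lebesgue"
    by (rule sq_integrable_bound[OF ws(2) inner_incr_measurable[OF wm], of 1]) (simp add: inner_incr_def indicator_def)
  moreover have "(\<lambda>x. indicator \<Omega> x * w x) \<in> sq_integrable lebesgue"
    by (rule sq_integrable_bound[OF ws(1) borel_measurable_times[OF indicator_\<Omega>_measurable wm], of 1])
       (simp add: indicator_def)
  ultimately show "w \<in> data_space" using wm by (simp add: data_space_def)
  show "inner_energy w \<le> energy w w"
    unfolding inner_energy_def energy_sq
    using d ws(2) by (intro integral_mono) (auto simp: sq_integrable_def inner_incr_def indicator_def)
qed

lemma data_space_add:
  assumes "u \<in> data_space" "v \<in> data_space"
  shows "(\<lambda>x. u x + v x) \<in> data_space"
  using assms sq_integrable_add[of "\<lambda>x. indicator \<Omega> x * u x" lebesgue "\<lambda>x. indicator \<Omega> x * v x"]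
    sq_integrable_add[of "inner_incr u" lebesgue "inner_incr v"]
  by (simp add: data_space_def inner_incr_add[abs_def] distrib_left borel_measurable_add)

definition weak_solution :: "(('a \<Rightarrow> real) \<Rightarrow> real) \<Rightarrow> ('a \<Rightarrow> real) \<Rightarrow> ('a \<Rightarrow> real) \<Rightarrow> bool" where
  "weak_solution F g u \<longleftrightarrow> u \<in> data_space \<and> (\<lambda>x. u x - g x) \<in> zero_space \<and> (\<forall>\<phi>\<in>zero_space. weak_form u \<phi> = F \<phi>)"

lemma weak_form_difference:
  assumes g: "g \<in> data_space" and u: "(\<lambda>x. u x - g x) \<in> zero_space" and \<phi>: "\<phi> \<in> zero_space"
  shows "weak_form u \<phi> = weak_form (\<lambda>x. u x - g x) \<phi> + weak_form g \<phi>"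
  using weak_form_add_left[OF zero_space_data_space(1)[OF u] g \<phi>] by simp

lemma weak_solution_exists:
  assumes F: "bounded_functional F" and g: "g \<in> data_space"
  shows "\<exists>u. weak_solution F g u"
proof -
  have "bounded_functional (\<lambda>\<phi>. F \<phi> - weak_form g \<phi>)"
    using bounded_functional_lincomb[OF F weak_form_bounded_functional[OF g], of 1 "-1"] by simp
  from solvability(1)[OF this] obtain w where w: "w \<in> zero_space"
    and eq: "\<forall>\<phi>\<in>zero_space. 1/2 * energy w \<phi> + drift w \<phi> = F \<phi> - weak_form g \<phi>" by blast
  have "weak_form (\<lambda>x. w x + g x) \<phi> = F \<phi>" if "\<phi> \<in> zero_space" for \<phi>
    using weak_form_add_left[OF zero_space_data_space(1)[OF w] g that] eq that by (simp add: weak_form_def)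
  moreover have "(\<lambda>x. w x + g x) \<in> data_space" by (rule data_space_add[OF zero_space_data_space(1)[OF w] g])
  ultimately have "weak_solution F g (\<lambda>x. w x + g x)" using w by (simp add: weak_solution_def)
  then show ?thesis by blast
qed

lemma weak_solution_unique:
  assumes g: "g \<in> data_space" and u: "weak_solution F g u" and w: "weak_solution F g w"
  shows "AE x in lebesgue. w x = u x"
proof -
  have us: "(\<lambda>x. u x - g x) \<in> zero_space" and ws: "(\<lambda>x. w x - g x) \<in> zero_space"
    using u w by (simp_all add: weak_solution_def)
  define d where "d x = w x - u x" for x
  have d: "d \<in> zero_space" using diff_mem[OF ws us] by (simp add: d_def[abs_def])
  have "energy d d = 0"
  proof (rule solvability(2)[OF d])
    fix \<phi> assume \<phi>: "\<phi> \<in> zero_space"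
    have "weak_form w \<phi> = weak_form d \<phi> + weak_form u \<phi>"
      using weak_form_difference[of u w \<phi>] u d \<phi> by (simp add: weak_solution_def d_def[abs_def])
    then show "1/2 * energy d \<phi> + drift d \<phi> = 0"
      using u w \<phi> by (simp add: weak_solution_def weak_form_def)
  qed
  moreover obtain CP where "\<And>u. u \<in> zero_space \<Longrightarrow> (\<integral>x. (u x)\<^sup>2 \<partial>lebesgue) \<le> CP * energy u u"
    using Poincare by blast
  from this[OF d] have "(\<integral>x. (d x)\<^sup>2 \<partial>lebesgue) \<le> CP * energy d d" .
  ultimately have "(\<integral>x. (d x)\<^sup>2 \<partial>lebesgue) = 0" by (simp add: antisym)
  moreover have "integrable lebesgue (\<lambda>x. (d x)\<^sup>2)" using d by (simp add: zero_space_def sq_integrable_def)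
  ultimately have "AE x in lebesgue. (d x)\<^sup>2 = 0" by (subst (asm) integral_nonneg_eq_0_iff_AE) auto
  then show ?thesis by eventually_elim (simp add: d_def)
qed

text \<open>
  Test the equation with \<open>w = u - g\<close>. All terms but \<open>1/2 [w, w]\<close> are products of the square root \<open>X\<close> of the energy of \<open>w\<close>,
  its \<open>L\<^sup>2\<close> norm \<open>m\<close>, the seminorm \<open>G\<close> of \<open>g\<close>, the norm \<open>N\<close> of \<open>F\<close> and \<open>sqrt A\<close>, so Young's inequality
  absorbs the three that contain \<open>X\<close> with a factor \<open>1/12\<close> each.
\<close>

lemma weak_solution_estimate:
  assumes g: "g \<in> data_space" and u: "weak_solution F g u"
    and F: "\<And>\<phi>. \<phi> \<in> zero_space \<Longrightarrow> \<bar>F \<phi>\<bar> \<le> N * sqrt ((\<integral>x. (\<phi> x)\<^sup>2 \<partial>lebesgue) + energy \<phi> \<phi>)" and N: "N \<ge> 0"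
  shows "inner_energy u \<le> (34 + 64 * A) * (N\<^sup>2 + (\<integral>x. (indicator \<Omega> x * g x)\<^sup>2 \<partial>lebesgue) + inner_energy g
    + (\<integral>x. (indicator \<Omega> x * u x)\<^sup>2 \<partial>lebesgue))"
proof -
  define w where "w x = u x - g x" for x
  have w: "w \<in> zero_space" using u by (simp add: weak_solution_def w_def[abs_def])
  have uV: "u \<in> data_space" using u by (simp add: weak_solution_def)
  define X where "X = nrm w"
  define m where "m = sqrt (\<integral>x. (w x)\<^sup>2 \<partial>lebesgue)"
  define G where "G = sqrt (inner_energy g)"
  define B where "B = sqrt A"
  have nn: "0 \<le> X" "0 \<le> m" "0 \<le> G" "0 \<le> B"
    using w A_nonneg by (simp_all add: X_def m_def G_def B_def inner_energy_def)
  have sq: "X\<^sup>2 = energy w w" "m\<^sup>2 = (\<integral>x. (w x)\<^sup>2 \<partial>lebesgue)" "G\<^sup>2 = inner_energy g" "B\<^sup>2 = A"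
    using A_nonneg by (simp_all add: X_def nrm_sq w m_def G_def B_def inner_energy_def)
  have "F w = weak_form w w + weak_form g w"
    using weak_form_difference[OF g _ w, of u] u w by (simp add: weak_solution_def w_def[abs_def])
  then have eq: "1/2 * X\<^sup>2 = F w - drift w w - 1/2 * energy g w - drift g w"
    by (simp add: weak_form_def sq)
  have "\<bar>F w\<bar> \<le> N * (m + X)"
  proof -
    have "sqrt ((\<integral>x. (w x)\<^sup>2 \<partial>lebesgue) + energy w w) \<le> m + X"
      unfolding sq[symmetric] using nn sqrt_add_le_add_sqrt[of "m\<^sup>2" "X\<^sup>2"] by simp
    then show ?thesis using F[OF w] mult_left_mono[OF _ N] by (meson order_trans)
  qed
  moreover have "\<bar>drift w w\<bar> \<le> X * (B * m)"
    using drift_bound[OF w w] by (simp add: X_def B_def m_def real_sqrt_mult)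
  moreover have "\<bar>energy g w\<bar> \<le> 2 * (G * X)"
  proof -
    have "sqrt 2 * (G * X) \<le> 2 * (G * X)" using nn by (intro mult_right_mono) (auto intro: real_le_lsqrt)
    then show ?thesis using energy_data_space(2)[OF g w] by (simp add: G_def X_def real_sqrt_mult mult.assoc)
  qed
  moreover have "\<bar>drift g w\<bar> \<le> G * (B * m)"
    using drift_data_space(2)[OF g w] by (simp add: G_def B_def m_def real_sqrt_mult)
  ultimately have 1: "1/2 * X\<^sup>2 \<le> N * m + N * X + X * (B * m) + G * X + G * (B * m)"
    unfolding eq by (simp add: algebra_simps abs_le_iff)
  have young: "p * q \<le> 3 * p\<^sup>2 + q\<^sup>2 / 12" "p * q \<le> p\<^sup>2 + q\<^sup>2" for p q :: real
  proof -
    have "0 \<le> (6 * p - q)\<^sup>2" by simp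
    then show "p * q \<le> 3 * p\<^sup>2 + q\<^sup>2 / 12" by (simp add: power2_diff power_mult_distrib)
    have "0 \<le> (p - q)\<^sup>2" "0 \<le> p\<^sup>2" "0 \<le> q\<^sup>2" by simp_all
    then show "p * q \<le> p\<^sup>2 + q\<^sup>2" unfolding power2_diff by linarith
  qed
  have "1/4 * X\<^sup>2 \<le> 4 * N\<^sup>2 + m\<^sup>2 + 4 * (B * m)\<^sup>2 + 4 * G\<^sup>2"
    using 1 young(2)[of N m] young(1)[of N X] young(1)[of "B * m" X] young(1)[of G X] young(2)[of G "B * m"]
    by (simp add: mult.commute[of X])
  then have X: "X\<^sup>2 \<le> 16 * N\<^sup>2 + (4 + 16 * A) * m\<^sup>2 + 16 * G\<^sup>2"
    by (simp add: power_mult_distrib sq(4) algebra_simps)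
  define Ug where "Ug = (\<integral>x. (indicator \<Omega> x * g x)\<^sup>2 \<partial>lebesgue)"
  define Uu where "Uu = (\<integral>x. (indicator \<Omega> x * u x)\<^sup>2 \<partial>lebesgue)"
  have U0: "0 \<le> Ug" "0 \<le> Uu" by (simp_all add: Ug_def Uu_def)
  have m: "m\<^sup>2 \<le> 2 * Uu + 2 * Ug"
  proof -
    have ae: "AE x in lebesgue. x \<notin> \<Omega> \<longrightarrow> w x = 0" using w by (simp add: zero_space_def)
    have us: "(\<lambda>x. indicator \<Omega> x * u x) \<in> sq_integrable lebesgue"
      and gs: "(\<lambda>x. indicator \<Omega> x * g x) \<in> sq_integrable lebesgue" using uV g by (simp_all add: data_space_def)
    have gs': "(\<lambda>x. (-1) * (indicator \<Omega> x * g x)) \<in> sq_integrable lebesgue" by (rule sq_integrable_scale[OF gs])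
    note s = sq_integrable_add[OF us gs']
    have "m\<^sup>2 = (\<integral>x. (indicator \<Omega> x * u x + (-1) * (indicator \<Omega> x * g x))\<^sup>2 \<partial>lebesgue)"
      unfolding sq(2)
    proof (rule integral_cong_AE)
      show "(\<lambda>x. (w x)\<^sup>2) \<in> borel_measurable lebesgue" using zero_space_measurable[OF w] by measurable
      show "(\<lambda>x. (indicator \<Omega> x * u x + (-1) * (indicator \<Omega> x * g x))\<^sup>2) \<in> borel_measurable lebesgue"
        by (rule borel_measurable_power[OF sq_integrable_measurable[OF s]])
      show "AE x in lebesgue. (w x)\<^sup>2 = (indicator \<Omega> x * u x + (-1) * (indicator \<Omega> x * g x))\<^sup>2"
        using ae by eventually_elim (auto simp: w_def indicator_def)
    qed
    also have "\<dots> \<le> 2 * Uu + 2 * (\<integral>x. ((-1) * (indicator \<Omega> x * g x))\<^sup>2 \<partial>lebesgue)"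
      unfolding Uu_def by (rule sq_integral_add_le[OF us gs'])
    also have "(\<integral>x. ((-1) * (indicator \<Omega> x * g x))\<^sup>2 \<partial>lebesgue) = Ug" by (simp add: Ug_def)
    finally show ?thesis .
  qed
  have "inner_energy u = (\<integral>z. (inner_incr w z + inner_incr g z)\<^sup>2 \<partial>lebesgue)"
    unfolding inner_energy_def inner_incr_add[symmetric] by (simp add: w_def)
  also have "\<dots> \<le> 2 * inner_energy w + 2 * inner_energy g"
    unfolding inner_energy_def using zero_space_data_space(1)[OF w] g by (intro sq_integral_add_le) (auto simp: data_space_def)
  also have "\<dots> \<le> 2 * X\<^sup>2 + 2 * G\<^sup>2" using zero_space_data_space(2)[OF w] by (simp add: sq)
  also have "\<dots> \<le> 32 * N\<^sup>2 + (8 + 32 * A) * m\<^sup>2 + 34 * G\<^sup>2" using X by (simp add: algebra_simps)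
  also have "(8 + 32 * A) * m\<^sup>2 \<le> (8 + 32 * A) * (2 * Uu + 2 * Ug)"
    using A_nonneg by (intro mult_left_mono m) auto
  also have "32 * N\<^sup>2 + (8 + 32 * A) * (2 * Uu + 2 * Ug) + 34 * G\<^sup>2
      = (32 * N\<^sup>2 + (16 + 64 * A) * (Uu + Ug) + 34 * G\<^sup>2)"
    by (simp add: algebra_simps)
  also have "\<dots> \<le> ((34 + 64 * A) * N\<^sup>2 + (34 + 64 * A) * (Uu + Ug) + (34 + 64 * A) * G\<^sup>2)"
    using U0 A_nonneg by (intro add_mono mult_right_mono) auto
  finally show ?thesis unfolding sq Ug_def[symmetric] Uu_def[symmetric] by (simp add: algebra_simps)
qed

end

section \<open>Kernels with values in the extended half-line\<close>

definition real_sym :: "'a kernel \<Rightarrow> 'a \<times> 'a \<Rightarrow> real" where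
  "real_sym k z = enn2real (k_sym k (fst z) (snd z))"

definition real_anti :: "'a kernel \<Rightarrow> 'a \<times> 'a \<Rightarrow> real" where
  "real_anti k z = real_of_ereal (k_anti k (fst z) (snd z))"

lemma real_sym_nonneg: "0 \<le> real_sym k z"
  by (simp add: real_sym_def)

text \<open>
  This holds everywhere, also where exactly one of the two values of the kernel is infinite; the
  value at a pair of infinite values is 0 by definition.
\<close>

lemma k_anti_swap: "k_anti k y x = - k_anti k x y"
  by (cases "k x y" rule: ennreal_cases; cases "k y x" rule: ennreal_cases)
     (auto simp: k_anti_def enn2ereal_ennreal minus_divide_left)

lemma k_sym_finite_cases:
  assumes "k_sym k x y \<noteq> \<infinity>"
  obtains r s where "0 \<le> r" "0 \<le> s" "k_sym k x y = ennreal ((r + s) / 2)" "k_anti k x y = ereal ((r - s) / 2)"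
proof -
  have two: "(2 :: ennreal) = ennreal 2" by simp
  obtain r where r: "0 \<le> r" "k x y = ennreal r"
    using assms by (cases "k x y" rule: ennreal_cases) (auto simp: k_sym_def ennreal_top_divide)
  obtain s where s: "0 \<le> s" "k y x = ennreal s"
    using assms by (cases "k y x" rule: ennreal_cases) (auto simp: k_sym_def ennreal_top_divide)
  show thesis
  proof (rule that[OF r(1) s(1)])
    show "k_sym k x y = ennreal ((r + s) / 2)"
      unfolding k_sym_def r s two ennreal_plus[OF r(1) s(1), symmetric]
      using r(1) s(1) by (intro divide_ennreal) auto
    show "k_anti k x y = ereal ((r - s) / 2)"
      using r s by (simp add: k_anti_def enn2ereal_ennreal)
  qed
qed

lemma kernel_swap_measurable:
  fixes k :: "'a::euclidean_space kernel"
  assumes "(\<lambda>(x, y). k x y) \<in> borel_measurable lebesgue"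
  shows "(\<lambda>z. k (fst z) (snd z)) \<in> borel_measurable lebesgue" "(\<lambda>z. k (snd z) (fst z)) \<in> borel_measurable lebesgue"
  using assms measurable_compose[OF swap_measurable_lebesgue assms] by (simp_all add: case_prod_beta')

lemma k_sym_measurable:
  fixes k :: "'a::euclidean_space kernel"
  assumes k: "(\<lambda>(x, y). k x y) \<in> borel_measurable lebesgue"
  shows "(\<lambda>z. k_sym k (fst z) (snd z)) \<in> borel_measurable lebesgue"
proof -
  note [measurable] = kernel_swap_measurable[OF k]
  show ?thesis unfolding k_sym_def by measurable
qed

lemma real_sym_measurable:
  fixes k :: "'a::euclidean_space kernel"
  assumes k: "(\<lambda>(x, y). k x y) \<in> borel_measurable lebesgue"
  shows "real_sym k \<in> borel_measurable lebesgue"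
  unfolding real_sym_def[abs_def] by (rule measurable_compose[OF k_sym_measurable[OF k]]) measurable

lemma real_anti_measurable:
  fixes k :: "'a::euclidean_space kernel"
  assumes k: "(\<lambda>(x, y). k x y) \<in> borel_measurable lebesgue"
  shows "real_anti k \<in> borel_measurable lebesgue"
proof -
  note [measurable] = kernel_swap_measurable[OF k]
  have "{z \<in> space lebesgue. k (fst z) (snd z) = \<infinity> \<and> k (snd z) (fst z) = \<infinity>} \<in> sets lebesgue"
    by measurable
  then show ?thesis
    unfolding real_anti_def[abs_def] k_anti_def
    by (intro borel_measurable_real_of_ereal measurable_If borel_measurable_ereal_divide borel_measurable_ereal_diff
        measurable_compose[OF _ measurable_enn2ereal] kernel_swap_measurable k) auto
qed

text \<open>
  The weight \<open>min 1 (norm (x - y))\<^sup>2\<close> vanishes only on the diagonal, which is a null set, and the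
  space is a countable union of compact balls.
\<close>

lemma levy_cond_finite:
  fixes k :: "(real ^ 'd) kernel"
  assumes k: "(\<lambda>(x, y). k x y) \<in> borel_measurable lebesgue" and L: "levy_cond k"
  shows "AE z in lebesgue. k_sym k (fst z) (snd z) \<noteq> \<infinity>"
proof -
  define m where "m z = ennreal (min 1 ((norm (fst z - snd z))\<^sup>2))" for z :: "(real ^ 'd) \<times> (real ^ 'd)"
  define f where "f z = m z * k_sym k (fst z) (snd z)" for z
  have mm: "m \<in> borel_measurable lebesgue"
  proof -
    have "(\<lambda>z :: (real ^ 'd) \<times> (real ^ 'd). min 1 ((norm (fst z - snd z))\<^sup>2)) \<in> borel_measurable borel"
      by (intro borel_measurable_continuous_onI continuous_intros)
    then have "(\<lambda>z :: (real ^ 'd) \<times> (real ^ 'd). min 1 ((norm (fst z - snd z))\<^sup>2)) \<in> borel_measurable lborel" by simp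
    from measurable_compose[OF measurable_completion[OF this] measurable_ennreal]
    show ?thesis by (simp add: m_def[abs_def])
  qed
  have fm: "f \<in> borel_measurable lebesgue"
    unfolding f_def[abs_def] by (intro borel_measurable_times_ennreal mm k_sym_measurable k)
  have "AE z in lebesgue. f z * indicator (cball 0 (real n)) (fst z) \<noteq> \<infinity>" for n :: nat
  proof (rule nn_integral_PInf_AE)
    have S: "cball (0 :: real ^ 'd) (real n) \<in> sets lebesgue" by (rule fmeasurableD[OF lmeasurable_cball])
    show "(\<lambda>z. f z * indicator (cball 0 (real n)) (fst z)) \<in> borel_measurable lebesgue"
      by (intro borel_measurable_times_ennreal fm measurable_fst_lebesgue borel_measurable_indicator S)
    have "(\<integral>\<^sup>+x. (\<integral>\<^sup>+y. f (x, y) \<partial>lebesgue) \<partial>lebesgue_on (cball 0 (real n))) < \<infinity>"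
      using L compact_cball[of 0 "real n"] unfolding levy_cond_def f_def m_def by simp
    then show "(\<integral>\<^sup>+z. f z * indicator (cball 0 (real n)) (fst z) \<partial>lebesgue) \<noteq> \<infinity>"
      unfolding nn_integral_lebesgue_on_fst[OF S fm] by simp
  qed
  then have "AE z in lebesgue. \<forall>n :: nat. f z * indicator (cball 0 (real n)) (fst z) \<noteq> \<infinity>"
    by (subst AE_all_countable) blast
  then show ?thesis
    using AE_lebesgue_off_diagonal
  proof eventually_elim
    case (elim z)
    obtain n :: nat where "norm (fst z) \<le> real n" using real_arch_simple by blast
    then have "f z \<noteq> \<infinity>" using elim(1)[rule_format, of n] by simp
    moreover have "m z \<noteq> 0" using elim(2) by (simp add: m_def min_def ennreal_eq_0_iff)
    ultimately show ?case by (auto simp: f_def ennreal_mult_eq_top_iff)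
  qed
qed

lemma AE_kernel_real:
  fixes k :: "(real ^ 'd) kernel"
  assumes k: "(\<lambda>(x, y). k x y) \<in> borel_measurable lebesgue" and L: "levy_cond k"
  shows "AE z in lebesgue. k_sym k (fst z) (snd z) = ennreal (real_sym k z) \<and>
    k_anti k (fst z) (snd z) = ereal (real_anti k z)"
  using levy_cond_finite[OF assms]
proof eventually_elim
  case (elim z)
  from k_sym_finite_cases[OF elim] obtain r s where "0 \<le> r" "0 \<le> s"
    "k_sym k (fst z) (snd z) = ennreal ((r + s) / 2)" "k_anti k (fst z) (snd z) = ereal ((r - s) / 2)" .
  then show ?case by (simp add: real_sym_def real_anti_def)
qed

lemma anti_bound_weighted:
  fixes k :: "(real ^ 'd) kernel"
  assumes k: "(\<lambda>(x, y). k x y) \<in> borel_measurable lebesgue" and L: "levy_cond k" and A: "anti_bound k A"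
    and h: "h \<in> borel_measurable lebesgue"
  shows "(\<integral>\<^sup>+z. ennreal ((h (fst z))\<^sup>2 * ((real_anti k z)\<^sup>2 / real_sym k z)) \<partial>lebesgue)
    \<le> ennreal A * (\<integral>\<^sup>+x. ennreal ((h x)\<^sup>2) \<partial>lebesgue)"
proof -
  define q where "q z = ennreal ((real_anti k z)\<^sup>2 / real_sym k z)" for z
  have qm: "q \<in> borel_measurable lebesgue"
    unfolding q_def[abs_def]
    by (intro measurable_compose[OF _ measurable_ennreal] borel_measurable_divide borel_measurable_power
        real_anti_measurable real_sym_measurable k)
  have hm: "(\<lambda>x. ennreal ((h x)\<^sup>2)) \<in> borel_measurable lebesgue" using h by measurable
  have q_le: "AE x in lebesgue. (\<integral>\<^sup>+y. q (x, y) \<partial>lebesgue) \<le> ennreal A"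
    using AE_lebesgue_pair[OF AE_kernel_real[OF k L]]
  proof eventually_elim
    case (elim x)
    have "(\<integral>\<^sup>+y. q (x, y) \<partial>lebesgue) = (\<integral>\<^sup>+y\<in>{y. k_sym k x y \<noteq> 0}.
        e2ennreal ((k_anti k x y)\<^sup>2 / enn2ereal (k_sym k x y)) \<partial>lebesgue)"
    proof (rule nn_integral_cong_AE, use elim in eventually_elim)
      fix y
      assume "k_sym k (fst (x, y)) (snd (x, y)) = ennreal (real_sym k (x, y)) \<and>
         k_anti k (fst (x, y)) (snd (x, y)) = ereal (real_anti k (x, y))"
      then have eq: "k_sym k x y = ennreal (real_sym k (x, y))" "k_anti k x y = ereal (real_anti k (x, y))" by simp_all
      have n: "0 \<le> real_sym k (x, y)" by (simp add: real_sym_def)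
      show "q (x, y) = e2ennreal ((k_anti k x y)\<^sup>2 / enn2ereal (k_sym k x y)) * indicator {y. k_sym k x y \<noteq> 0} y"
      proof (cases "real_sym k (x, y) = 0")
        case True
        then show ?thesis by (simp add: q_def eq)
      next
        case False
        then have "(ereal (real_anti k (x, y)))\<^sup>2 / enn2ereal (ennreal (real_sym k (x, y)))
            = ereal ((real_anti k (x, y))\<^sup>2 / real_sym k (x, y))"
          using n by (simp add: enn2ereal_ennreal power2_eq_square)
        then show ?thesis using False n by (simp add: q_def eq e2ennreal_ereal)
      qed
    qed
    also have "\<dots> \<le> ennreal A"
      using A unfolding anti_bound_def by (rule order_trans[OF SUP_upper[OF UNIV_I]])
    finally show ?case .
  qed
  have "(\<integral>\<^sup>+z. ennreal ((h (fst z))\<^sup>2 * ((real_anti k z)\<^sup>2 / real_sym k z)) \<partial>lebesgue)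
      = (\<integral>\<^sup>+z. ennreal ((h (fst z))\<^sup>2) * q z \<partial>lebesgue)"
    by (intro nn_integral_cong) (simp only: q_def ennreal_mult real_sym_nonneg zero_le_power2 divide_nonneg_nonneg)
  also have "\<dots> = (\<integral>\<^sup>+x. (\<integral>\<^sup>+y. ennreal ((h x)\<^sup>2) * q (x, y) \<partial>lebesgue) \<partial>lebesgue)"
    using nn_integral_lebesgue_pair[OF borel_measurable_times_ennreal[OF measurable_fst_lebesgue[OF hm] qm]] by simp
  also have "\<dots> \<le> (\<integral>\<^sup>+x. ennreal A * ennreal ((h x)\<^sup>2) \<partial>lebesgue)"
  proof (rule nn_integral_mono_AE, use q_le AE_lebesgue_section_measurable[OF qm] in eventually_elim)
    fix x assume le: "(\<integral>\<^sup>+y. q (x, y) \<partial>lebesgue) \<le> ennreal A"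
      and m: "(\<lambda>y. q (x, y)) \<in> borel_measurable lebesgue"
    have "(\<integral>\<^sup>+y. ennreal ((h x)\<^sup>2) * q (x, y) \<partial>lebesgue) = ennreal ((h x)\<^sup>2) * (\<integral>\<^sup>+y. q (x, y) \<partial>lebesgue)"
      by (rule nn_integral_cmult[OF m])
    also have "\<dots> \<le> ennreal ((h x)\<^sup>2) * ennreal A" by (rule mult_left_mono[OF le]) simp
    finally show "(\<integral>\<^sup>+y. ennreal ((h x)\<^sup>2) * q (x, y) \<partial>lebesgue) \<le> ennreal A * ennreal ((h x)\<^sup>2)"
      by (simp add: mult.commute)
  qed
  also have "\<dots> = ennreal A * (\<integral>\<^sup>+x. ennreal ((h x)\<^sup>2) \<partial>lebesgue)" by (rule nn_integral_cmult[OF hm])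
  finally show ?thesis .
qed

lemma nn_integral_energy:
  fixes k :: "(real ^ 'd) kernel"
  assumes k: "(\<lambda>(x, y). k x y) \<in> borel_measurable lebesgue" and L: "levy_cond k"
    and u: "u \<in> borel_measurable lebesgue"
  shows "(\<integral>\<^sup>+x. (\<integral>\<^sup>+y. ennreal ((u x - u y)\<^sup>2) * k_sym k x y \<partial>lebesgue) \<partial>lebesgue)
    = (\<integral>\<^sup>+z. ennreal ((incr u z)\<^sup>2 * real_sym k z) \<partial>lebesgue)"
proof -
  have m: "(\<lambda>z. ennreal ((incr u z)\<^sup>2) * k_sym k (fst z) (snd z)) \<in> borel_measurable lebesgue"
    by (intro borel_measurable_times_ennreal measurable_compose[OF _ measurable_ennreal] borel_measurable_power
        incr_measurable u k_sym_measurable k)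
  have "(\<integral>\<^sup>+x. (\<integral>\<^sup>+y. ennreal ((u x - u y)\<^sup>2) * k_sym k x y \<partial>lebesgue) \<partial>lebesgue)
      = (\<integral>\<^sup>+z. ennreal ((incr u z)\<^sup>2) * k_sym k (fst z) (snd z) \<partial>lebesgue)"
    using nn_integral_lebesgue_pair[OF m] by (simp add: incr_def)
  also have "\<dots> = (\<integral>\<^sup>+z. ennreal ((incr u z)\<^sup>2 * real_sym k z) \<partial>lebesgue)"
    by (rule nn_integral_cong_AE, use AE_kernel_real[OF k L] in eventually_elim)
       (simp add: ennreal_mult real_sym_nonneg)
  finally show ?thesis .
qed

lemma nonlocal_kernel_of_kernel:
  fixes k :: "(real ^ 'd) kernel"
  assumes \<Omega>: "open \<Omega>" "bounded \<Omega>" and k: "(\<lambda>(x, y). k x y) \<in> borel_measurable lebesgue"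
    and L: "levy_cond k" and A: "anti_bound k A" "A \<ge> 0" and D: "anti_dominated k D" "D > 1"
    and \<alpha>: "0 < \<alpha>" "\<alpha> < 2" "0 < lam" and frac: "fractional_lower_bound k \<alpha> lam"
  shows "nonlocal_kernel \<Omega> (real_sym k) (real_anti k) A (1 - 1 / D) \<alpha> (lam * \<alpha> * (2 - \<alpha>))"
proof
  show "open \<Omega>" "bounded \<Omega>" "0 < \<alpha>" "0 \<le> A" by fact+
  show "real_sym k \<in> borel_measurable lebesgue" by (rule real_sym_measurable[OF k])
  show "real_anti k \<in> borel_measurable lebesgue" by (rule real_anti_measurable[OF k])
  show "0 \<le> real_sym k z" for z by (simp add: real_sym_def)
  show "real_sym k (prod.swap z) = real_sym k z" for z by (simp add: real_sym_def k_sym_def add.commute)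
  show "real_anti k (prod.swap z) = - real_anti k z" for z
    using k_anti_swap[of k "snd z" "fst z"] by (simp add: real_anti_def)
  show "0 < 1 - 1 / D" "1 - 1 / D \<le> 1" using D(2) by simp_all
  show "0 < lam * \<alpha> * (2 - \<alpha>)" using \<alpha> by simp
  have "AE z in lebesgue. \<bar>k_anti k (fst z) (snd z)\<bar> \<le> ereal (inverse D) * enn2ereal (k_sym k (fst z) (snd z))"
    using D(1) by (simp add: anti_dominated_def case_prod_beta')
  then show "AE z in lebesgue. \<bar>real_anti k z\<bar> \<le> (1 - (1 - 1 / D)) * real_sym k z"
    using AE_kernel_real[OF k L]
  proof eventually_elim
    case (elim z)
    then have "\<bar>ereal (real_anti k z)\<bar> \<le> ereal (inverse D) * enn2ereal (ennreal (real_sym k z))"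
      by argo
    then show ?case by (simp add: enn2ereal_ennreal real_sym_nonneg inverse_eq_divide)
  qed
  show "(\<integral>\<^sup>+z. ennreal ((h (fst z))\<^sup>2 * ((real_anti k z)\<^sup>2 / real_sym k z)) \<partial>lebesgue)
    \<le> ennreal A * (\<integral>\<^sup>+x. ennreal ((h x)\<^sup>2) \<partial>lebesgue)" if "h \<in> borel_measurable lebesgue" for h
    by (rule anti_bound_weighted[OF k L A(1) that])
  fix u :: "real ^ 'd \<Rightarrow> real" assume u: "u \<in> sq_integrable lebesgue"
  then have um: "u \<in> borel_measurable lebesgue" by (rule sq_integrable_measurable)
  have "u \<in> L2_on UNIV"
    using u by (simp add: L2_on_def lebesgue_on_UNIV_eq sq_integrable_iff_nn_integral)
  then have "ennreal (lam * \<alpha> * (2 - \<alpha>)) *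
       (\<integral>\<^sup>+x. (\<integral>\<^sup>+y. ennreal ((u x - u y)\<^sup>2 / norm (x - y) powr (real CARD('d) + \<alpha>)) \<partial>lebesgue) \<partial>lebesgue)
      \<le> (\<integral>\<^sup>+x. (\<integral>\<^sup>+y. ennreal ((u x - u y)\<^sup>2) * k_sym k x y \<partial>lebesgue) \<partial>lebesgue)"
    using frac unfolding fractional_lower_bound_def by blast
  moreover have "(\<integral>\<^sup>+z. ennreal ((incr u z)\<^sup>2 / norm (fst z - snd z) powr (real CARD('d) + \<alpha>)) \<partial>lebesgue)
      = (\<integral>\<^sup>+x. (\<integral>\<^sup>+y. ennreal ((u x - u y)\<^sup>2 / norm (x - y) powr (real CARD('d) + \<alpha>)) \<partial>lebesgue) \<partial>lebesgue)"
    using nn_integral_lebesgue_pair[OF frac_measurable[OF um, of "real CARD('d) + \<alpha>"]] by (simp add: incr_def)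
  ultimately show "ennreal (lam * \<alpha> * (2 - \<alpha>)) *
      (\<integral>\<^sup>+z. ennreal ((incr u z)\<^sup>2 / norm (fst z - snd z) powr (real DIM(real ^ 'd) + \<alpha>)) \<partial>lebesgue)
    \<le> (\<integral>\<^sup>+z. ennreal ((incr u z)\<^sup>2 * real_sym k z) \<partial>lebesgue)"
    by (simp add: nn_integral_energy[OF k L um])
qed

lemma V_space_iff:
  fixes k :: "(real ^ 'd) kernel"
  assumes k: "(\<lambda>(x, y). k x y) \<in> borel_measurable lebesgue" and L: "levy_cond k" and S: "S \<in> sets lebesgue"
  shows "v \<in> V_space S k \<longleftrightarrow> v \<in> borel_measurable lebesgue \<and> (\<lambda>x. indicator S x * v x) \<in> sq_integrable lebesgue \<and>
    (\<lambda>z. indicator S (fst z) * (incr v z * sqrt (real_sym k z))) \<in> sq_integrable lebesgue"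
proof (cases "v \<in> borel_measurable lebesgue")
  case True
  have 1: "v \<in> L2_on S \<longleftrightarrow> (\<lambda>x. indicator S x * v x) \<in> sq_integrable lebesgue"
  proof -
    have "v \<in> borel_measurable (lebesgue_on S)" by (rule measurable_restrict_space1[OF True])
    moreover have "(\<integral>\<^sup>+x. ennreal ((v x)\<^sup>2) \<partial>lebesgue_on S)
        = (\<integral>\<^sup>+x. ennreal ((indicator S x * v x)\<^sup>2) \<partial>lebesgue)"
      using S by (subst nn_integral_restrict_space) (auto intro!: nn_integral_cong simp: indicator_def)
    moreover have "(\<lambda>x. indicator S x * v x) \<in> borel_measurable lebesgue"
      by (intro borel_measurable_times borel_measurable_indicator S True)
    ultimately show ?thesis by (simp add: L2_on_def sq_integrable_iff_nn_integral)
  qed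
  have m: "(\<lambda>z. indicator S (fst z) * (incr v z * sqrt (real_sym k z))) \<in> borel_measurable lebesgue"
    by (intro borel_measurable_times measurable_fst_lebesgue borel_measurable_indicator S incr_measurable True
        measurable_compose[OF real_sym_measurable[OF k] borel_measurable_sqrt])
  have "(\<integral>\<^sup>+(x, y). ennreal ((v x - v y)\<^sup>2) * k_sym k x y \<partial>lebesgue_on (S \<times> UNIV))
      = (\<integral>\<^sup>+z. ennreal ((incr v z)\<^sup>2) * k_sym k (fst z) (snd z) * indicator (S \<times> UNIV) z \<partial>lebesgue)"
    using lebesgue_Times_UNIV[OF S]
    by (subst nn_integral_restrict_space) (auto simp: case_prod_beta' incr_def)
  also have "\<dots> = (\<integral>\<^sup>+z. ennreal ((indicator S (fst z) * (incr v z * sqrt (real_sym k z)))\<^sup>2) \<partial>lebesgue)"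
  proof (rule nn_integral_cong_AE, use AE_kernel_real[OF k L] in eventually_elim)
    case (elim z)
    then show ?case
      by (cases "fst z \<in> S") (auto simp: power_mult_distrib ennreal_mult real_sym_nonneg indicator_def mem_Times_iff)
  qed
  finally have 2: "(\<integral>\<^sup>+(x, y). ennreal ((v x - v y)\<^sup>2) * k_sym k x y \<partial>lebesgue_on (S \<times> UNIV)) < \<infinity>
      \<longleftrightarrow> (\<lambda>z. indicator S (fst z) * (incr v z * sqrt (real_sym k z))) \<in> sq_integrable lebesgue"
    using m by (simp add: sq_integrable_iff_nn_integral)
  show ?thesis using True 1 2 by (simp add: V_space_def)
qed (simp add: V_space_def)

text \<open>
  Membership in \<open>V_space\<close> makes the integrand integrable, so that the iterated integral in \<open>V_form\<close> is an
  integral over the product.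
\<close>

lemma V_form_eq:
  fixes k :: "(real ^ 'd) kernel"
  assumes k: "(\<lambda>(x, y). k x y) \<in> borel_measurable lebesgue" and L: "levy_cond k" and S: "S \<in> sets lebesgue"
    and v: "v \<in> V_space S k"
  shows "V_form S k v v = (\<integral>z. (indicator S (fst z) * (incr v z * sqrt (real_sym k z)))\<^sup>2 \<partial>lebesgue)"
proof -
  have i: "integrable lebesgue (\<lambda>z. (indicator S (fst z) * (incr v z * sqrt (real_sym k z)))\<^sup>2)"
    using v by (simp add: V_space_iff[OF k L S] sq_integrable_def)
  have eq: "(indicator S x * (incr v (x, y) * sqrt (real_sym k (x, y))))\<^sup>2
      = indicator S x * ((v x - v y) * (v x - v y) * enn2real (k_sym k x y))" for x y
  proof -
    have "(sqrt (real_sym k (x, y)))\<^sup>2 = enn2real (k_sym k x y)" by (simp add: real_sym_def)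
    then show ?thesis by (simp add: power_mult_distrib incr_def power2_eq_square[of "v x - v y"] indicator_def)
  qed
  show ?thesis
    unfolding integral_lebesgue_pair[OF i] V_form_def using S
    by (subst integral_restrict_space) (simp_all add: eq)
qed

lemma L2_normsq_eq:
  assumes S: "S \<in> sets lebesgue"
  shows "L2_normsq S u = (\<integral>x. (indicator S x * u x)\<^sup>2 \<partial>lebesgue)"
  unfolding L2_normsq_def using S
  by (subst integral_restrict_space) (auto intro!: Bochner_Integration.integral_cong simp: indicator_def)

text \<open>
  Normalising the argument gives the bound. An element of norm 0 cannot be normalised; there
  the functional vanishes by the definition of the dual space.
\<close>

lemma H_dual_norm_bound:
  assumes f: "f \<in> H_dual \<Omega> k" and nonneg: "\<And>\<psi>. \<psi> \<in> H_zero \<Omega> k \<Longrightarrow> 0 \<le> H_norm k \<psi>"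
    and scale: "\<And>c \<psi>. \<psi> \<in> H_zero \<Omega> k \<Longrightarrow> (\<lambda>x. c * \<psi> x) \<in> H_zero \<Omega> k \<and> H_norm k (\<lambda>x. c * \<psi> x) = \<bar>c\<bar> * H_norm k \<psi>"
    and ne: "H_zero \<Omega> k \<noteq> {}"
  shows "0 \<le> H_dual_norm \<Omega> k f"
    and "\<phi> \<in> H_zero \<Omega> k \<Longrightarrow> \<bar>f \<phi>\<bar> \<le> H_dual_norm \<Omega> k f * H_norm k \<phi>"
proof -
  obtain M where M: "\<And>\<phi>. \<phi> \<in> H_zero \<Omega> k \<Longrightarrow> \<bar>f \<phi>\<bar> \<le> M * H_norm k \<phi>"
    using f unfolding H_dual_def by blast
  have hom: "f (\<lambda>x. c * \<phi> x) = c * f \<phi>" if "\<phi> \<in> H_zero \<Omega> k" for c \<phi>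
    using f that unfolding H_dual_def by blast
  have bdd: "bdd_above ((\<lambda>\<phi>. \<bar>f \<phi>\<bar>) ` {\<phi> \<in> H_zero \<Omega> k. H_norm k \<phi> \<le> 1})"
  proof (rule bdd_aboveI2[where M="\<bar>M\<bar>"])
    fix \<phi> assume "\<phi> \<in> {\<phi> \<in> H_zero \<Omega> k. H_norm k \<phi> \<le> 1}"
    then have \<phi>: "\<phi> \<in> H_zero \<Omega> k" "H_norm k \<phi> \<le> 1" by auto
    have "M * H_norm k \<phi> \<le> \<bar>M\<bar> * 1" using nonneg[OF \<phi>(1)] \<phi>(2) by (intro mult_mono) auto
    then show "\<bar>f \<phi>\<bar> \<le> \<bar>M\<bar>" using M[OF \<phi>(1)] by simp
  qed
  have le: "\<bar>f \<phi>\<bar> \<le> H_dual_norm \<Omega> k f" if "\<phi> \<in> H_zero \<Omega> k" "H_norm k \<phi> \<le> 1" for \<phi>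
    unfolding H_dual_norm_def using that by (intro cSUP_upper bdd) auto
  obtain \<psi> where \<psi>: "\<psi> \<in> H_zero \<Omega> k" using ne by blast
  have "\<bar>f (\<lambda>x. 0 * \<psi> x)\<bar> \<le> H_dual_norm \<Omega> k f" using scale[OF \<psi>, of 0] by (intro le) auto
  then show "0 \<le> H_dual_norm \<Omega> k f" using abs_ge_zero by (rule order_trans[rotated])
  show "\<bar>f \<phi>\<bar> \<le> H_dual_norm \<Omega> k f * H_norm k \<phi>" if \<phi>: "\<phi> \<in> H_zero \<Omega> k"
  proof (cases "H_norm k \<phi> = 0")
    case True then show ?thesis using M[OF \<phi>] by simp
  next
    case False
    then have p: "H_norm k \<phi> > 0" using nonneg[OF \<phi>] by simp
    define c where "c = 1 / H_norm k \<phi>"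
    have c: "c > 0" "c * H_norm k \<phi> = 1" using p by (simp_all add: c_def)
    have "\<bar>f (\<lambda>x. c * \<phi> x)\<bar> \<le> H_dual_norm \<Omega> k f"
      using scale[OF \<phi>, of c] c by (intro le) auto
    then have "c * \<bar>f \<phi>\<bar> \<le> H_dual_norm \<Omega> k f" using c by (simp add: hom[OF \<phi>] abs_mult)
    then show ?thesis using p by (simp add: c_def field_simps)
  qed
qed

theorem theorem4p4:
  fixes C_P A D :: real
  assumes "C_P > 0" and "A \<ge> 0" and "D > 1"
  shows "\<exists>C>0. \<forall>(\<Omega> :: (real ^ 'd) set) k \<alpha> lam f g.
    open \<Omega> \<and> bounded \<Omega> \<and>
    (\<lambda>(x, y). k x y) \<in> borel_measurable lebesgue \<and>
    levy_cond k \<and> anti_bound k A \<and> anti_dominated k D \<and>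
    0 < \<alpha> \<and> \<alpha> < 2 \<and> 0 < lam \<and> fractional_lower_bound k \<alpha> lam \<and>
    f \<in> H_dual \<Omega> k \<and> g \<in> V_space \<Omega> k \<longrightarrow>
    (\<exists>u. dirichlet_solution \<Omega> k f g u \<and>
       (\<forall>w. dirichlet_solution \<Omega> k f g w \<longrightarrow> (AE x in lebesgue. w x = u x)) \<and>
       (poincare_friedrichs \<Omega> k C_P \<longrightarrow>
          V_form \<Omega> k u u \<le> C * ((H_dual_norm \<Omega> k f)\<^sup>2 + L2_normsq \<Omega> g + V_form \<Omega> k g g
                                + L2_normsq \<Omega> u)))"
proof (intro exI[of _ "34 + 64 * A"] conjI allI impI)
  show "0 < 34 + 64 * A" using \<open>A \<ge> 0\<close> by simp
next
  fix \<Omega> :: "(real ^ 'd) set" and k :: "(real ^ 'd) kernel" and \<alpha> lam f g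
  assume "open \<Omega> \<and> bounded \<Omega> \<and>
    (\<lambda>(x, y). k x y) \<in> borel_measurable lebesgue \<and>
    levy_cond k \<and> anti_bound k A \<and> anti_dominated k D \<and>
    0 < \<alpha> \<and> \<alpha> < 2 \<and> 0 < lam \<and> fractional_lower_bound k \<alpha> lam \<and>
    f \<in> H_dual \<Omega> k \<and> g \<in> V_space \<Omega> k"
  then have \<Omega>: "open \<Omega>" "bounded \<Omega>" and k: "(\<lambda>(x, y). k x y) \<in> borel_measurable lebesgue"
    and L: "levy_cond k" and Ab: "anti_bound k A" and Db: "anti_dominated k D"
    and \<alpha>: "0 < \<alpha>" "\<alpha> < 2" "0 < lam" and frac: "fractional_lower_bound k \<alpha> lam"
    and f: "f \<in> H_dual \<Omega> k" and g: "g \<in> V_space \<Omega> k" by blast+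
  interpret K: nonlocal_kernel \<Omega> "real_sym k" "real_anti k" A "1 - 1 / D" \<alpha> "lam * \<alpha> * (2 - \<alpha>)"
    by (rule nonlocal_kernel_of_kernel[OF \<Omega> k L Ab \<open>A \<ge> 0\<close> Db \<open>D > 1\<close> \<alpha> frac])
  have U: "(UNIV :: (real ^ 'd) set) \<in> sets lebesgue" by simp
  have V: "V_space \<Omega> k = K.data_space"
    by (auto simp: V_space_iff[OF k L K.\<Omega>_lebesgue] K.data_space_def K.inner_incr_def[abs_def] K.weighted_incr_def)
  have H: "H_zero \<Omega> k = K.zero_space"
    by (auto simp: H_zero_def H_space_def V_space_iff[OF k L U] K.zero_space_def K.weighted_incr_def[abs_def] sq_integrable_measurable)
  have Vf: "V_form \<Omega> k u u = K.inner_energy u" if "u \<in> V_space \<Omega> k" for u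
    unfolding V_form_eq[OF k L K.\<Omega>_lebesgue that] K.inner_energy_def K.inner_incr_def K.weighted_incr_def ..
  have Hn: "H_norm k \<phi> = sqrt ((\<integral>x. (\<phi> x)\<^sup>2 \<partial>lebesgue) + K.energy \<phi> \<phi>)" if "\<phi> \<in> H_zero \<Omega> k" for \<phi>
  proof -
    have "\<phi> \<in> V_space UNIV k" using that by (simp add: H_zero_def H_space_def)
    from V_form_eq[OF k L U this] show ?thesis
      by (simp add: H_norm_def L2_normsq_eq K.energy_sq K.weighted_incr_def)
  qed
  have bil: "bilin_form k u v = K.weak_form u v" for u v
    by (simp add: bilin_form_def K.weak_form_def K.energy_eq K.drift_def case_prod_beta' incr_def real_sym_def real_anti_def)
  have sol: "dirichlet_solution \<Omega> k f g = K.weak_solution f g"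
    by (auto simp: fun_eq_iff dirichlet_solution_def K.weak_solution_def V H bil)
  have gV: "g \<in> K.data_space" using g by (simp add: V)
  have n0: "0 \<le> (\<integral>x. (\<phi> x)\<^sup>2 \<partial>lebesgue) + K.energy \<phi> \<phi>" if "\<phi> \<in> K.zero_space" for \<phi>
    using K.ip_nonneg[OF that] by simp
  have scale: "(\<lambda>x. c * \<psi> x) \<in> H_zero \<Omega> k \<and> H_norm k (\<lambda>x. c * \<psi> x) = \<bar>c\<bar> * H_norm k \<psi>"
    if \<psi>: "\<psi> \<in> H_zero \<Omega> k" for c \<psi>
  proof -
    have \<psi>': "\<psi> \<in> K.zero_space" using \<psi> by (simp add: H)
    have c: "(\<lambda>x. c * \<psi> x) \<in> K.zero_space" by (rule K.scale_mem[OF \<psi>'])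
    have "(\<integral>x. (c * \<psi> x)\<^sup>2 \<partial>lebesgue) + K.energy (\<lambda>x. c * \<psi> x) (\<lambda>x. c * \<psi> x)
        = c\<^sup>2 * ((\<integral>x. (\<psi> x)\<^sup>2 \<partial>lebesgue) + K.energy \<psi> \<psi>)"
      using K.ip_scale_left[OF \<psi>' c] K.ip_scale_right[OF \<psi>' \<psi>']
      by (simp add: power_mult_distrib distrib_left power2_eq_square[of c])
    then show ?thesis using c \<psi> by (simp add: Hn H real_sqrt_mult)
  qed
  have ne: "H_zero \<Omega> k \<noteq> {}" using K.zero_mem by (auto simp: H)
  have nonneg: "0 \<le> H_norm k \<psi>" if "\<psi> \<in> H_zero \<Omega> k" for \<psi>
    using that n0 by (simp add: Hn H)
  note dual = H_dual_norm_bound[OF f nonneg scale ne]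
  obtain CP where CP: "CP > 0" "\<And>u. u \<in> K.zero_space \<Longrightarrow> (\<integral>x. (u x)\<^sup>2 \<partial>lebesgue) \<le> CP * K.energy u u"
    using K.Poincare by blast
  have Fb: "K.bounded_functional f"
    unfolding K.bounded_functional_def
  proof (intro conjI exI[of _ "H_dual_norm \<Omega> k f * sqrt (CP + 1)"] ballI)
    show "\<forall>c. \<forall>u\<in>K.zero_space. f (\<lambda>x. c * u x) = c * f u" using f by (simp add: H_dual_def H)
    show "f (\<lambda>x. u x + v x) = f u + f v" if "u \<in> K.zero_space" "v \<in> K.zero_space" for u v
      using f that by (simp add: H_dual_def H)
    fix \<phi> assume \<phi>: "\<phi> \<in> K.zero_space"
    have "H_norm k \<phi> \<le> sqrt (CP + 1) * K.nrm \<phi>"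
      using CP(2)[OF \<phi>] \<phi> by (simp add: Hn H K.nrm_def real_sqrt_mult[symmetric] distrib_right)
    then have "H_dual_norm \<Omega> k f * H_norm k \<phi> \<le> H_dual_norm \<Omega> k f * (sqrt (CP + 1) * K.nrm \<phi>)"
      using dual(1) by (rule mult_left_mono)
    then show "\<bar>f \<phi>\<bar> \<le> H_dual_norm \<Omega> k f * sqrt (CP + 1) * K.nrm \<phi>"
      using dual(2)[of \<phi>] \<phi> by (simp add: H mult.assoc)
  qed
  obtain u where u: "K.weak_solution f g u" using K.weak_solution_exists[OF Fb gV] by blast
  have uV: "u \<in> K.data_space" using u by (simp add: K.weak_solution_def)
  show "\<exists>u. dirichlet_solution \<Omega> k f g u \<and>
       (\<forall>w. dirichlet_solution \<Omega> k f g w \<longrightarrow> (AE x in lebesgue. w x = u x)) \<and>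
       (poincare_friedrichs \<Omega> k C_P \<longrightarrow>
          V_form \<Omega> k u u \<le> (34 + 64 * A) * ((H_dual_norm \<Omega> k f)\<^sup>2 + L2_normsq \<Omega> g + V_form \<Omega> k g g
                                + L2_normsq \<Omega> u))"
  proof (intro exI[of _ u] conjI allI impI)
    show "dirichlet_solution \<Omega> k f g u" using u by (simp add: sol)
    show "AE x in lebesgue. w x = u x" if "dirichlet_solution \<Omega> k f g w" for w
      using K.weak_solution_unique[OF gV u] that by (simp add: sol)
    have "\<bar>f \<phi>\<bar> \<le> H_dual_norm \<Omega> k f * sqrt ((\<integral>x. (\<phi> x)\<^sup>2 \<partial>lebesgue) + K.energy \<phi> \<phi>)"
      if "\<phi> \<in> K.zero_space" for \<phi>
      using dual(2)[of \<phi>] that by (simp add: H Hn)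
    from K.weak_solution_estimate[OF gV u this dual(1)]
    show "V_form \<Omega> k u u \<le> (34 + 64 * A) * ((H_dual_norm \<Omega> k f)\<^sup>2 + L2_normsq \<Omega> g + V_form \<Omega> k g g
                                + L2_normsq \<Omega> u)"
      using gV uV by (simp add: Vf V L2_normsq_eq[OF K.\<Omega>_lebesgue])
  qed
qed

end
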